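(* Let $G=(V,E)$ be a finite simple connected graph. Then $\beth^{3}(K^{\chi(G)})\le \beth^{3}(G)$; that is, $$\binom{\chi(G)}{4}-\binom{\chi(G)}{3}+\binom{\chi(G)}{2}-\binom{\chi(G)}{1}\le \beth^{3}(G).$$
   Context: All graphs are finite and simple. $K^{t}$ is the complete graph on $t$ vertices and $\chi(G)$ is the chromatic number of $G$. $C(G)$ is the set of all induced cycles in $G$ (of length at least 3). Solid graphs are the graphs of the following four kinds. (1) Pyramid: a graph consisting of a cycle $C$ and a vertex $w\notin V(C)$ together with at least three edges between $w$ and $C$. (2) Trihedron: the union of three paths $P_1,P_2,P_3$, each of length at least 2, having the same two (distinct) endpoints, such that no interior vertex of any of the paths is used in another of the paths. (3) Stamp: the union of a triangle $T$ and three paths $P_1,P_2,P_3$ of length $\ge 1$ that start at the three different vertices of $T$ and all end at the same vertex $x\notin V(T)$, such that the $P_i-x$ are pairwise vertex-disjoint and each $P_i$ meets $T$ only in its starting vertex. (4) Prism: $T\cup T'\cup P_1\cup P_2\cup P_3$ where $T,T'$ are vertex-disjoint triangles with vertices $x_1,x_2,x_3$ and $y_1,y_2,y_3$ respectively, and the $P_i$ are pairwise vertex-disjoint paths from $x_i$ to $y_i$ (so $P_i$ meets $T\cup T'$ only in $x_i,y_i$). A solid in $G$ is an induced subgraph of $G$ that is isomorphic to a solid graph; $S(G)$ is the set of all solids in $G$. The third graph characteristic is $\beth^{3}(G)=|S(G)|-|C(G)|+|E(G)|-|V(G)|$. *)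

theory Defs
  imports Main
begin

type_synonym 'a ugraph = "'a set \<times> 'a set set"

abbreviation verts :: "'a ugraph \<Rightarrow> 'a set" where
  "verts G \<equiv> fst G"

abbreviation edges :: "'a ugraph \<Rightarrow> 'a set set" where
  "edges G \<equiv> snd G"

definition finite_simple_graph :: "'a ugraph \<Rightarrow> bool" where
  "finite_simple_graph G \<longleftrightarrow>
     finite (verts G) \<and> (\<forall>e\<in>edges G. e \<subseteq> verts G \<and> card e = 2)"

definition subgraph :: "'a ugraph \<Rightarrow> 'a ugraph \<Rightarrow> bool" where
  "subgraph H G \<longleftrightarrow> verts H \<subseteq> verts G \<and> edges H \<subseteq> edges G"

definition induced_subgraph :: "'a ugraph \<Rightarrow> 'a ugraph \<Rightarrow> bool" where
  "induced_subgraph H G \<longleftrightarrow>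
     verts H \<subseteq> verts G \<and> edges H = {e \<in> edges G. e \<subseteq> verts H}"

definition graph_isomorphic :: "'a ugraph \<Rightarrow> 'b ugraph \<Rightarrow> bool" where
  "graph_isomorphic G H \<longleftrightarrow>
     (\<exists>f. bij_betw f (verts G) (verts H) \<and>
          (\<forall>u\<in>verts G. \<forall>v\<in>verts G. {u, v} \<in> edges G \<longleftrightarrow> {f u, f v} \<in> edges H))"

definition graph_union :: "'a ugraph \<Rightarrow> 'a ugraph \<Rightarrow> 'a ugraph" where
  "graph_union G H = (verts G \<union> verts H, edges G \<union> edges H)"

definition path_graph :: "'a list \<Rightarrow> 'a ugraph" where
  "path_graph xs = (set xs, {{xs ! i, xs ! Suc i} | i. Suc i < length xs})"

definition cycle_graph :: "'a list \<Rightarrow> 'a ugraph" where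
  "cycle_graph xs = (set xs, insert {last xs, hd xs} (edges (path_graph xs)))"

definition is_path :: "'a \<Rightarrow> 'a \<Rightarrow> 'a ugraph \<Rightarrow> bool" where
  "is_path a b P \<longleftrightarrow>
     (\<exists>xs. xs \<noteq> [] \<and> distinct xs \<and> hd xs = a \<and> last xs = b \<and> P = path_graph xs)"

abbreviation path_length :: "'a ugraph \<Rightarrow> nat" where
  "path_length P \<equiv> card (edges P)"

definition is_cycle :: "'a ugraph \<Rightarrow> bool" where
  "is_cycle C \<longleftrightarrow> (\<exists>xs. distinct xs \<and> length xs \<ge> 3 \<and> C = cycle_graph xs)"

definition connected_graph :: "'a ugraph \<Rightarrow> bool" where
  "connected_graph G \<longleftrightarrow>
     (\<forall>u\<in>verts G. \<forall>v\<in>verts G. \<exists>P. is_path u v P \<and> subgraph P G)"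

definition complete_graph :: "nat \<Rightarrow> nat ugraph" where
  "complete_graph t = ({..<t}, {e. e \<subseteq> {..<t} \<and> card e = 2})"

definition proper_coloring :: "'a ugraph \<Rightarrow> nat \<Rightarrow> ('a \<Rightarrow> nat) \<Rightarrow> bool" where
  "proper_coloring G k c \<longleftrightarrow>
     (\<forall>v\<in>verts G. c v < k) \<and>
     (\<forall>u\<in>verts G. \<forall>v\<in>verts G. {u, v} \<in> edges G \<longrightarrow> c u \<noteq> c v)"

definition chromatic_number :: "'a ugraph \<Rightarrow> nat" where
  "chromatic_number G = (LEAST k. \<exists>c. proper_coloring G k c)"

definition is_pyramid :: "'a ugraph \<Rightarrow> bool" where
  "is_pyramid H \<longleftrightarrow>
     (\<exists>C w N. is_cycle C \<and> w \<notin> verts C \<and> N \<subseteq> verts C \<and> card N \<ge> 3 \<and>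
        H = (insert w (verts C), edges C \<union> {{w, v} | v. v \<in> N}))"

definition is_trihedron :: "'a ugraph \<Rightarrow> bool" where
  "is_trihedron H \<longleftrightarrow>
     (\<exists>a b P1 P2 P3. a \<noteq> b \<and>
        (\<forall>P\<in>{P1, P2, P3}. is_path a b P \<and> path_length P \<ge> 2) \<and>
        verts P1 \<inter> verts P2 = {a, b} \<and>
        verts P1 \<inter> verts P3 = {a, b} \<and>
        verts P2 \<inter> verts P3 = {a, b} \<and>
        H = graph_union P1 (graph_union P2 P3))"

definition is_stamp :: "'a ugraph \<Rightarrow> bool" where
  "is_stamp H \<longleftrightarrow>
     (\<exists>t1 t2 t3 x P1 P2 P3. distinct [t1, t2, t3] \<and> x \<notin> {t1, t2, t3} \<and>
        is_path t1 x P1 \<and> is_path t2 x P2 \<and> is_path t3 x P3 \<and>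
        path_length P1 \<ge> 1 \<and> path_length P2 \<ge> 1 \<and> path_length P3 \<ge> 1 \<and>
        (verts P1 - {x}) \<inter> (verts P2 - {x}) = {} \<and>
        (verts P1 - {x}) \<inter> (verts P3 - {x}) = {} \<and>
        (verts P2 - {x}) \<inter> (verts P3 - {x}) = {} \<and>
        verts P1 \<inter> {t1, t2, t3} = {t1} \<and>
        verts P2 \<inter> {t1, t2, t3} = {t2} \<and>
        verts P3 \<inter> {t1, t2, t3} = {t3} \<and>
        H = graph_union (cycle_graph [t1, t2, t3]) (graph_union P1 (graph_union P2 P3)))"

definition is_prism :: "'a ugraph \<Rightarrow> bool" where
  "is_prism H \<longleftrightarrow>
     (\<exists>x1 x2 x3 y1 y2 y3 P1 P2 P3. distinct [x1, x2, x3, y1, y2, y3] \<and>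
        is_path x1 y1 P1 \<and> is_path x2 y2 P2 \<and> is_path x3 y3 P3 \<and>
        verts P1 \<inter> verts P2 = {} \<and>
        verts P1 \<inter> verts P3 = {} \<and>
        verts P2 \<inter> verts P3 = {} \<and>
        H = graph_union (cycle_graph [x1, x2, x3]) (graph_union (cycle_graph [y1, y2, y3])
              (graph_union P1 (graph_union P2 P3))))"

definition is_solid_graph :: "'a ugraph \<Rightarrow> bool" where
  "is_solid_graph H \<longleftrightarrow> is_pyramid H \<or> is_trihedron H \<or> is_stamp H \<or> is_prism H"

definition induced_cycles :: "'a ugraph \<Rightarrow> 'a ugraph set" where
  "induced_cycles G = {C. induced_subgraph C G \<and> is_cycle C}"

text \<open>A solid graph isomorphic to \<open>H\<close> can always be found on the vertex type of \<open>H\<close>,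
  so letting \<open>K\<close> range over graphs on that type only is no restriction.\<close>
definition solids :: "'a ugraph \<Rightarrow> 'a ugraph set" where
  "solids G =
     {H. induced_subgraph H G \<and> (\<exists>K :: 'a ugraph. is_solid_graph K \<and> graph_isomorphic H K)}"

definition beth3 :: "'a ugraph \<Rightarrow> int" where
  "beth3 G = int (card (solids G)) - int (card (induced_cycles G))
           + int (card (edges G)) - int (card (verts G))"

end

theory Submission
  imports Defs
begin

text \<open>
  Vertices are deleted one at a time, and each deletion is compared with the identity
  C(d,3) - C(d,2) + d - 1 = C(d-1,3). The deleted vertex \<open>v\<close> is chosen avoidable: some
  connected set \<open>K\<close> missing the closed neighbourhood of \<open>v\<close> meets the neighbourhood of every
  neighbour of \<open>v\<close> that is not adjacent to all other neighbours of \<open>v\<close>. Induced cycles through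
  \<open>v\<close> meet \<open>N(v)\<close> in a pair. For each pair, the solids meeting \<open>N(v)\<close> in that pair are, up to
  one, at least as many as the cycles; for each triple, avoidability yields a solid meeting
  \<open>N(v)\<close> in that triple. Hence deleting an avoidable vertex of degree \<open>d\<close> lowers the
  characteristic by at least C(d-1,3). A greedy colouring in the reverse order needs a new
  colour only at vertices of degree at least the number of colours already used, and these
  decrements add up to C(k-1,4) for \<open>k\<close> colours; for \<open>k > 0\<close> the characteristic of
  \<open>K\<^sup>k\<close> is C(k-1,4) - 1.
\<close>

section \<open>Paths and cycles as lists\<close>

text \<open>The four kinds of solids are the possible outcomes when three legs leave a vertex
  \<open>a\<close> through three of its neighbours and come together again. If at most one edge
  joins these neighbours, the legs start as a star or with a triangle, and they likewise meet in a
  vertex or in a triangle: two stars give a trihedron, a star and a triangle a stamp, two triangles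
  a prism. Two or more edges among the neighbours, and a few degenerate positions of the legs, give
  a pyramid. Hence no triple of suitably attached neighbours is lost. Connectedness is needed
  because C(d,3) - C(d,2) + d - 1 is -1 for d = 0: deleting an isolated vertex would raise the
  characteristic. Deleting an avoidable vertex keeps the graph connected, so the deletions can go on
  down to a single vertex, whose characteristic is the source of the final -1. The greedy colouring
  may use more colours than necessary. This does no harm, since C(k-1,4) is monotone in k and a
  larger k only strengthens the bound.\<close>

lemma edges_path_Nil [simp]: "edges (path_graph []) = {}"
  and edges_path_single [simp]: "edges (path_graph [x]) = {}"
  by (auto simp: path_graph_def)

lemma edges_path_Cons [simp]:
  "edges (path_graph (x # y # zs)) = insert {x, y} (edges (path_graph (y # zs)))"
proof -
  have "(\<exists>i. e = {(x # y # zs) ! i, (x # y # zs) ! Suc i} \<and> Suc i < length (x # y # zs)) \<longleftrightarrow>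
    e = {x, y} \<or> (\<exists>i. e = {(y # zs) ! i, (y # zs) ! Suc i} \<and> Suc i < length (y # zs))" (is "?L \<longleftrightarrow> ?R") for e
  proof
    assume ?L
    then obtain i where "e = {(x # y # zs) ! i, (x # y # zs) ! Suc i}" "Suc i < length (x # y # zs)"
      by blast
    then show ?R by (cases i) auto
  next
    assume ?R
    then show ?L
    proof
      assume "e = {x, y}"
      then show ?L by (intro exI[of _ 0]) simp
    next
      assume "\<exists>i. e = {(y # zs) ! i, (y # zs) ! Suc i} \<and> Suc i < length (y # zs)"
      then obtain i where "e = {(y # zs) ! i, (y # zs) ! Suc i}" "Suc i < length (y # zs)" by blast
      then show ?L by (intro exI[of _ "Suc i"]) simp
    qed
  qed
  then show ?thesis unfolding path_graph_def by auto
qed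

lemma verts_path [simp]: "verts (path_graph xs) = set xs"
  by (simp add: path_graph_def)

lemma verts_cycle [simp]: "verts (cycle_graph xs) = set xs"
  by (simp add: cycle_graph_def)

lemma edges_path_Cons':
  "edges (path_graph (x # xs)) = (if xs = [] then {} else insert {x, hd xs} (edges (path_graph xs)))"
  by (cases xs) auto

lemma edges_path_append:
  "xs \<noteq> [] \<Longrightarrow> ys \<noteq> [] \<Longrightarrow> edges (path_graph (xs @ ys)) =
    insert {last xs, hd ys} (edges (path_graph xs) \<union> edges (path_graph ys))"
  by (induction xs) (auto simp: edges_path_Cons')

lemma edges_path_subset: "e \<in> edges (path_graph xs) \<Longrightarrow> e \<subseteq> set xs"
  by (induction xs) (auto simp: edges_path_Cons' split: if_splits)

lemma finite_edges_path: "finite (edges (path_graph xs))"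
  by (induction xs) (auto simp: edges_path_Cons')

lemma path_length_distinct: "distinct xs \<Longrightarrow> path_length (path_graph xs) = length xs - 1"
proof (induction xs)
  case (Cons x xs)
  show ?case
  proof (cases "xs = []")
    case False
    have "{x, hd xs} \<notin> edges (path_graph xs)"
      using Cons.prems edges_path_subset[of "{x, hd xs}" xs] by auto
    then show ?thesis using Cons False by (simp add: edges_path_Cons' finite_edges_path Suc_leI)
  qed simp
qed simp

lemma edges_path_rev: "edges (path_graph (rev xs)) = edges (path_graph xs)"
  by (induction xs) (auto simp: edges_path_Cons' edges_path_append last_rev)

lemma edges_cycle: "edges (cycle_graph xs) = insert {last xs, hd xs} (edges (path_graph xs))"
  by (simp add: cycle_graph_def)

lemma edges_triangle: "edges (cycle_graph [a, b, c]) = {{a, b}, {b, c}, {c, a}}"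
  by (auto simp: edges_cycle)

section \<open>Degrees in solid graphs and complete solid graphs\<close>

lemma path_inner:
  assumes "is_path a b P" "v \<in> verts P" "v \<noteq> a" "v \<noteq> b"
  shows "\<exists>p q. p \<noteq> q \<and> {v, p} \<in> edges P \<and> {v, q} \<in> edges P"
proof -
  obtain xs where xs: "distinct xs" "hd xs = a" "last xs = b" "P = path_graph xs"
    using assms(1) unfolding is_path_def by blast
  then obtain ys zs where s: "xs = ys @ v # zs" using assms(2) split_list by fastforce
  then have ne: "ys \<noteq> []" "zs \<noteq> []" using xs assms(3,4) by auto
  then have "last ys \<in> set ys" "hd zs \<in> set zs" by auto
  moreover have "set ys \<inter> set zs = {}" using xs(1) s by auto
  ultimately have "last ys \<noteq> hd zs" by (metis disjoint_iff)
  then show ?thesis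
    using ne unfolding xs(4) s
    by (intro exI[of _ "last ys"] exI[of _ "hd zs"]) (auto simp: edges_path_append edges_path_Cons')
qed

lemma is_path_rev: "is_path a b P \<Longrightarrow> is_path b a P"
proof -
  assume "is_path a b P"
  then obtain xs where xs: "xs \<noteq> []" "distinct xs" "hd xs = a" "last xs = b" "P = path_graph xs"
    unfolding is_path_def by blast
  have "path_graph (rev xs) = path_graph xs"
    by (rule prod_eqI) (use edges_path_rev[of xs] in simp_all)
  then show ?thesis unfolding is_path_def using xs
    by (intro exI[of _ "rev xs"]) (auto simp: hd_rev last_rev)
qed

text \<open>The clause excluding \<open>b\<close> serves trihedra: paths sharing both ends leave an
  end through different vertices, because those vertices are interior.\<close>

lemma path_end:
  assumes "is_path a b P" "a \<noteq> b"
  shows "\<exists>p\<in>verts P. p \<noteq> a \<and> {a, p} \<in> edges P \<and> (2 \<le> path_length P \<longrightarrow> p \<noteq> b)"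
proof -
  obtain xs where xs: "xs \<noteq> []" "distinct xs" "hd xs = a" "last xs = b" "P = path_graph xs"
    using assms(1) unfolding is_path_def by blast
  then obtain p ys where s: "xs = a # p # ys" using assms(2) by (cases xs; cases "tl xs") auto
  have "p \<noteq> b" if "2 \<le> path_length P"
  proof -
    have "ys \<noteq> []" using that path_length_distinct[OF xs(2)] xs(5) s by auto
    then show ?thesis using xs(2,4) s by auto
  qed
  then show ?thesis using xs s by (intro bexI[of _ p]) auto
qed

lemma cycle_degree:
  assumes "is_cycle C" "v \<in> verts C"
  shows "\<exists>p q. p \<noteq> q \<and> {v, p} \<in> edges C \<and> {v, q} \<in> edges C"
proof -
  obtain xs where xs: "distinct xs" "3 \<le> length xs" "C = cycle_graph xs"
    using assms(1) unfolding is_cycle_def by blast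
  then obtain ys zs where s: "xs = ys @ v # zs" using assms(2) split_list by fastforce
  \<comment> \<open>\<open>p\<close> and \<open>q\<close> are the cyclic successor and predecessor
    of \<open>v\<close>; they differ because the cycle has at least three vertices.\<close>
  define p where "p = (if zs = [] then hd xs else hd zs)"
  define q where "q = (if ys = [] then last xs else last ys)"
  have "{v, p} \<in> edges C" "{v, q} \<in> edges C"
    unfolding xs(3) edges_cycle p_def q_def s
    using xs(2) s
    by (cases "ys = []"; cases "zs = []"; auto simp: edges_path_append edges_path_Cons' insert_commute)+
  moreover have "p \<noteq> q"
  proof (cases "ys = [] \<or> zs = []")
    case True
    then show ?thesis using xs(1,2) unfolding p_def q_def s
      by (cases ys; cases zs; cases "tl ys"; cases "tl zs") auto
  next
    case False
    then have "last ys \<in> set ys" "hd zs \<in> set zs" by auto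
    moreover have "set ys \<inter> set zs = {}" using xs(1) s by auto
    ultimately have "hd zs \<noteq> last ys" by (metis disjoint_iff)
    then show ?thesis using False unfolding p_def q_def by simp
  qed
  ultimately show ?thesis by blast
qed

lemma cycle_triangle: "distinct [a, b, c] \<Longrightarrow> is_cycle (cycle_graph [a, b, c])"
  unfolding is_cycle_def by (intro exI[of _ "[a, b, c]"]) auto

lemma trihedron_degree:
  assumes "is_trihedron H" "v \<in> verts H"
  shows "\<exists>p q. p \<noteq> q \<and> {v, p} \<in> edges H \<and> {v, q} \<in> edges H"
proof -
  obtain a b P1 P2 P3 where H: "a \<noteq> b"
    "\<forall>P\<in>{P1, P2, P3}. is_path a b P \<and> path_length P \<ge> 2"
    "verts P1 \<inter> verts P2 = {a, b}" "H = graph_union P1 (graph_union P2 P3)"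
    using assms(1) unfolding is_trihedron_def by (elim exE conjE) (rule that; assumption)
  have sub: "edges P \<subseteq> edges H" if "P \<in> {P1, P2, P3}" for P
    using that unfolding H(4) graph_union_def by auto
  have "\<exists>P\<in>{P1, P2, P3}. v \<in> verts P" using assms(2) unfolding H(4) graph_union_def by auto
  then obtain P where P: "P \<in> {P1, P2, P3}" "v \<in> verts P" by blast
  have ends: "\<exists>p q. p \<noteq> q \<and> {v, p} \<in> edges H \<and> {v, q} \<in> edges H"
    if e: "\<And>P. P \<in> {P1, P2, P3} \<Longrightarrow> is_path v c P \<and> path_length P \<ge> 2" "v \<noteq> c" "{v, c} = {a, b}" for c
  proof -
    obtain p where p: "p \<in> verts P1" "p \<noteq> v" "p \<noteq> c" "{v, p} \<in> edges P1"
      using path_end[of v c P1] e(1)[of P1] e(2) by auto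
    obtain q where q: "q \<in> verts P2" "q \<noteq> v" "q \<noteq> c" "{v, q} \<in> edges P2"
      using path_end[of v c P2] e(1)[of P2] e(2) by auto
    have "p \<noteq> q" using p q H(3) e(3) by blast
    then show ?thesis using p q sub[of P1] sub[of P2] by blast
  qed
  consider "v = a" | "v = b" | "v \<noteq> a" "v \<noteq> b" by blast
  then show ?thesis
  proof cases
    case 1
    show ?thesis
    proof (rule ends)
      show "is_path v b P \<and> path_length P \<ge> 2" if "P \<in> {P1, P2, P3}" for P
        using bspec[OF H(2) that] 1 by simp
      show "v \<noteq> b" "{v, b} = {a, b}" using 1 H(1) by simp_all
    qed
  next
    case 2
    show ?thesis
    proof (rule ends)
      show "is_path v a P \<and> path_length P \<ge> 2" if "P \<in> {P1, P2, P3}" for P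
        using bspec[OF H(2) that] 2 is_path_rev[of a b P] by simp
      show "v \<noteq> a" "{v, a} = {a, b}" using 2 H(1) by (simp_all add: insert_commute)
    qed
  next
    case 3
    then show ?thesis using path_inner[of a b P v] bspec[OF H(2) P(1)] P(2) sub[OF P(1)] by blast
  qed
qed

lemma stamp_degree:
  assumes "is_stamp H" "v \<in> verts H"
  shows "\<exists>p q. p \<noteq> q \<and> {v, p} \<in> edges H \<and> {v, q} \<in> edges H"
proof -
  obtain t1 t2 t3 x P1 P2 P3 where H: "distinct [t1, t2, t3]" "x \<notin> {t1, t2, t3}"
    "is_path t1 x P1" "is_path t2 x P2" "is_path t3 x P3"
    "(verts P1 - {x}) \<inter> (verts P2 - {x}) = {}"
    "H = graph_union (cycle_graph [t1, t2, t3]) (graph_union P1 (graph_union P2 P3))"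
    using assms(1) unfolding is_stamp_def by (elim exE conjE) (rule that; assumption)
  have sub: "edges P \<subseteq> edges H" if "P \<in> {P1, P2, P3}" for P
    using that unfolding H(7) graph_union_def by auto
  have subT: "edges (cycle_graph [t1, t2, t3]) \<subseteq> edges H" unfolding H(7) graph_union_def by auto
  consider "v \<in> {t1, t2, t3}" | "v = x" | "v \<notin> {t1, t2, t3}" "v \<noteq> x" by blast
  then show ?thesis
  proof cases
    case 1
    then show ?thesis using cycle_degree[OF cycle_triangle[OF H(1)], of v] subT by auto
  next
    case 2
    obtain p where p: "p \<in> verts P1" "p \<noteq> x" "{x, p} \<in> edges P1"
      using path_end[OF is_path_rev[OF H(3)]] H(2) by auto
    obtain q where q: "q \<in> verts P2" "q \<noteq> x" "{x, q} \<in> edges P2"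
      using path_end[OF is_path_rev[OF H(4)]] H(2) by auto
    have "p \<noteq> q" using p q H(6) by blast
    then show ?thesis using p q sub[of P1] sub[of P2] 2 by blast
  next
    case 3
    then have ne: "v \<noteq> t1" "v \<noteq> t2" "v \<noteq> t3" by auto
    have "v \<in> verts P1 \<or> v \<in> verts P2 \<or> v \<in> verts P3"
      using assms(2) ne unfolding H(7) graph_union_def by auto
    then show ?thesis
      using path_inner[OF H(3), of v] path_inner[OF H(4), of v] path_inner[OF H(5), of v]
        sub[of P1] sub[of P2] sub[of P3] ne 3(2) by blast
  qed
qed

lemma prism_degree:
  assumes "is_prism H" "v \<in> verts H"
  shows "\<exists>p q. p \<noteq> q \<and> {v, p} \<in> edges H \<and> {v, q} \<in> edges H"
proof -
  obtain x1 x2 x3 y1 y2 y3 P1 P2 P3 where H: "distinct [x1, x2, x3, y1, y2, y3]"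
    "is_path x1 y1 P1" "is_path x2 y2 P2" "is_path x3 y3 P3"
    "H = graph_union (cycle_graph [x1, x2, x3]) (graph_union (cycle_graph [y1, y2, y3])
              (graph_union P1 (graph_union P2 P3)))"
    using assms(1) unfolding is_prism_def by (elim exE conjE) (rule that; assumption)
  have sub: "edges P \<subseteq> edges H"
    if "P \<in> {P1, P2, P3, cycle_graph [x1, x2, x3], cycle_graph [y1, y2, y3]}" for P
    using that unfolding H(5) graph_union_def by auto
  have d: "distinct [x1, x2, x3]" "distinct [y1, y2, y3]" using H(1) by auto
  consider "v \<in> {x1, x2, x3}" | "v \<in> {y1, y2, y3}" | "v \<notin> {x1, x2, x3}" "v \<notin> {y1, y2, y3}" by blast
  then show ?thesis
  proof cases
    case 1
    then show ?thesis
      using cycle_degree[OF cycle_triangle[OF d(1)], of v] sub[of "cycle_graph [x1, x2, x3]"] by auto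
  next
    case 2
    then show ?thesis
      using cycle_degree[OF cycle_triangle[OF d(2)], of v] sub[of "cycle_graph [y1, y2, y3]"] by auto
  next
    case 3
    then have ne: "v \<noteq> x1" "v \<noteq> x2" "v \<noteq> x3" "v \<noteq> y1" "v \<noteq> y2" "v \<noteq> y3" by auto
    have "v \<in> verts P1 \<or> v \<in> verts P2 \<or> v \<in> verts P3"
      using assms(2) ne unfolding H(5) graph_union_def by auto
    then show ?thesis
      using path_inner[OF H(2), of v] path_inner[OF H(3), of v] path_inner[OF H(4), of v]
        sub[of P1] sub[of P2] sub[of P3] ne by blast
  qed
qed

lemma pyramid_degree:
  assumes "is_pyramid H" "v \<in> verts H"
  shows "\<exists>p q. p \<noteq> q \<and> {v, p} \<in> edges H \<and> {v, q} \<in> edges H"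
proof -
  obtain C w N where H: "is_cycle C" "w \<notin> verts C" "N \<subseteq> verts C" "card N \<ge> 3"
    "H = (insert w (verts C), edges C \<union> {{w, v} | v. v \<in> N})"
    using assms(1) unfolding is_pyramid_def by blast
  show ?thesis
  proof (cases "v = w")
    case True
    have "\<not> (\<forall>p\<in>N. \<forall>q\<in>N. p = q)"
    proof
      assume eq: "\<forall>p\<in>N. \<forall>q\<in>N. p = q"
      have "N \<noteq> {}" using H(4) by auto
      then obtain p where "p \<in> N" by blast
      then have "N = {p}" using eq by blast
      then show False using H(4) by simp
    qed
    then obtain p q where "p \<in> N" "q \<in> N" "p \<noteq> q" by blast
    then show ?thesis using True unfolding H(5) by auto
  next
    case False
    then show ?thesis using cycle_degree[OF H(1), of v] assms(2) unfolding H(5) by auto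
  qed
qed

text \<open>Minimum degree two is what forces a solid that enters a chain without side exits to run
  through all of it, see \<open>chain_closed\<close>.\<close>

lemma solid_graph_degree:
  "is_solid_graph H \<Longrightarrow> v \<in> verts H \<Longrightarrow> \<exists>p q. p \<noteq> q \<and> {v, p} \<in> edges H \<and> {v, q} \<in> edges H"
  unfolding is_solid_graph_def
  using pyramid_degree[of H v] trihedron_degree[of H v] stamp_degree[of H v] prism_degree[of H v] by blast

section \<open>Solid graphs that are complete\<close>

lemma is_path_simps:
  assumes "is_path a b P"
  shows "a \<in> verts P" "b \<in> verts P" "e \<in> edges P \<Longrightarrow> e \<subseteq> verts P"
proof -
  obtain xs where xs: "xs \<noteq> []" "hd xs = a" "last xs = b" "P = path_graph xs"
    using assms unfolding is_path_def by blast
  show "a \<in> verts P" "b \<in> verts P" using xs by auto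
  show "e \<in> edges P \<Longrightarrow> e \<subseteq> verts P" using edges_path_subset xs(4) by auto
qed

text \<open>On a rim of length at least four the first and third vertices are not consecutive, and
  edges at the apex do not join them. So the rim is a triangle.\<close>

lemma complete_pyramid:
  assumes "is_pyramid H" and com: "\<And>u v. u \<in> verts H \<Longrightarrow> v \<in> verts H \<Longrightarrow> u \<noteq> v \<Longrightarrow> {u, v} \<in> edges H"
  shows "card (verts H) = 4"
proof -
  obtain C w N where H: "is_cycle C" "w \<notin> verts C"
    "H = (insert w (verts C), edges C \<union> {{w, v} | v. v \<in> N})"
    using assms(1) unfolding is_pyramid_def by blast
  obtain xs where xs: "distinct xs" "3 \<le> length xs" "C = cycle_graph xs"
    using H(1) unfolding is_cycle_def by blast
  have "length xs = 3"
  proof (rule ccontr)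
    assume "length xs \<noteq> 3"
    then have "4 \<le> length xs" using xs(2) by simp
    then obtain a b c d ys where s: "xs = a # b # c # d # ys"
      by (metis Suc_le_length_iff numeral_eq_Suc pred_numeral_simps(2,3) BitM.simps semiring_norm(26,27,28))
    have "{a, c} \<in> edges H" using com[of a c] xs s H(3) by auto
    moreover have "w \<noteq> a" "w \<noteq> c" using H(2) xs(3) s by auto
    ultimately have "{a, c} \<in> edges C" using H(3) by (auto simp: doubleton_eq_iff)
    moreover have "last (d # ys) \<in> set (d # ys)" by (rule last_in_set) simp
    then have "last (d # ys) \<noteq> c" using xs(1) unfolding s by auto
    moreover have "{a, c} \<notin> edges (path_graph (c # d # ys))"
      using edges_path_subset[of "{a, c}" "c # d # ys"] xs(1) unfolding s by auto
    ultimately show False using xs(1) unfolding xs(3) s edges_cycle by (auto simp: doubleton_eq_iff split: if_splits)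
  qed
  then show ?thesis using H(2,3) xs(1,3) by (simp add: distinct_card)
qed

text \<open>Every edge lies within one of the three paths, but inner vertices of two different paths
  lie in no common path.\<close>

lemma complete_trihedron:
  assumes "is_trihedron H" and com: "\<And>u v. u \<in> verts H \<Longrightarrow> v \<in> verts H \<Longrightarrow> u \<noteq> v \<Longrightarrow> {u, v} \<in> edges H"
  shows False
proof -
  obtain a b P1 P2 P3 where H: "a \<noteq> b"
    "\<forall>P\<in>{P1, P2, P3}. is_path a b P \<and> path_length P \<ge> 2"
    "verts P1 \<inter> verts P2 = {a, b}" "verts P1 \<inter> verts P3 = {a, b}" "verts P2 \<inter> verts P3 = {a, b}"
    "H = graph_union P1 (graph_union P2 P3)"
    using assms(1) unfolding is_trihedron_def by (elim exE conjE) (rule that; assumption)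
  have P: "is_path a b P1" "path_length P1 \<ge> 2" "is_path a b P2" "path_length P2 \<ge> 2" "is_path a b P3"
    using H(2) by simp_all
  obtain p where p: "p \<in> verts P1" "p \<noteq> a" "p \<noteq> b" using path_end[OF P(1) H(1)] P(2) by blast
  obtain q where q: "q \<in> verts P2" "q \<noteq> a" "q \<noteq> b" using path_end[OF P(3) H(1)] P(4) by blast
  have "p \<noteq> q" using p q H(3) by blast
  then have "{p, q} \<in> edges H" using com[of p q] p q unfolding H(6) graph_union_def by simp
  then have "{p, q} \<subseteq> verts P1 \<or> {p, q} \<subseteq> verts P2 \<or> {p, q} \<subseteq> verts P3"
    unfolding H(6) graph_union_def
    using is_path_simps(3)[OF P(1)] is_path_simps(3)[OF P(3)] is_path_simps(3)[OF P(5)] by auto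
  then show False using p q H(3-5) by blast
qed

text \<open>Every edge lies within the triangle or within one path. An inner vertex of a path
  therefore has no edge to the triangle vertices off that path, so all three paths are single
  edges.\<close>

lemma complete_stamp:
  assumes "is_stamp H" and com: "\<And>u v. u \<in> verts H \<Longrightarrow> v \<in> verts H \<Longrightarrow> u \<noteq> v \<Longrightarrow> {u, v} \<in> edges H"
  shows "card (verts H) = 4"
proof -
  obtain t1 t2 t3 x P1 P2 P3 where H: "distinct [t1, t2, t3]" "x \<notin> {t1, t2, t3}"
    "is_path t1 x P1" "is_path t2 x P2" "is_path t3 x P3"
    "(verts P1 - {x}) \<inter> (verts P2 - {x}) = {}" "(verts P1 - {x}) \<inter> (verts P3 - {x}) = {}"
    "(verts P2 - {x}) \<inter> (verts P3 - {x}) = {}"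
    "verts P1 \<inter> {t1, t2, t3} = {t1}" "verts P2 \<inter> {t1, t2, t3} = {t2}" "verts P3 \<inter> {t1, t2, t3} = {t3}"
    "H = graph_union (cycle_graph [t1, t2, t3]) (graph_union P1 (graph_union P2 P3))"
    using assms(1) unfolding is_stamp_def by (elim exE conjE) (rule that; assumption)
  have vH: "verts H = {t1, t2, t3} \<union> (verts P1 \<union> (verts P2 \<union> verts P3))"
    unfolding H(12) graph_union_def by simp
  have eH: "e \<subseteq> {t1, t2, t3} \<or> e \<subseteq> verts P1 \<or> e \<subseteq> verts P2 \<or> e \<subseteq> verts P3" if "e \<in> edges H" for e
    using that is_path_simps(3)[OF H(3)] is_path_simps(3)[OF H(4)] is_path_simps(3)[OF H(5)]
    unfolding H(12) graph_union_def by (auto simp: edges_cycle)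
  have join: "{p, s} \<subseteq> {t1, t2, t3} \<or> {p, s} \<subseteq> verts P1 \<or> {p, s} \<subseteq> verts P2 \<or> {p, s} \<subseteq> verts P3"
    if "p \<in> verts H" "s \<in> {t1, t2, t3}" "p \<noteq> s" for p s
    using eH com[OF that(1) _ that(3)] that(2) vH by blast
  have t: "t1 \<noteq> t2" "t1 \<noteq> t3" "t2 \<noteq> t3" using H(1) by auto
  have D: "q = x" if "q \<in> verts P1 \<and> q \<in> verts P2 \<or> q \<in> verts P1 \<and> q \<in> verts P3 \<or>
    q \<in> verts P2 \<and> q \<in> verts P3" for q
    using that H(6-8) by blast
  have T: "q \<in> verts P1 \<Longrightarrow> q \<in> {t1, t2, t3} \<Longrightarrow> q = t1"
    "q \<in> verts P2 \<Longrightarrow> q \<in> {t1, t2, t3} \<Longrightarrow> q = t2"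
    "q \<in> verts P3 \<Longrightarrow> q \<in> {t1, t2, t3} \<Longrightarrow> q = t3" for q
    using H(9-11) by blast+
  have "p = t1 \<or> p = x" if p: "p \<in> verts P1" for p
  proof (rule ccontr)
    assume n: "\<not> ?thesis"
    have "p \<notin> {t1, t2, t3}" using T(1)[OF p] n by blast
    moreover have "t2 \<notin> verts P1" using T(1)[of t2] t by auto
    moreover have "p \<in> verts H" using p vH by simp
    ultimately show False using join[of p t2] D[of p] p n by auto
  qed
  moreover have "p = t2 \<or> p = x" if p: "p \<in> verts P2" for p
  proof (rule ccontr)
    assume n: "\<not> ?thesis"
    have "p \<notin> {t1, t2, t3}" using T(2)[OF p] n by blast
    moreover have "t1 \<notin> verts P2" using T(2)[of t1] t by auto
    moreover have "p \<in> verts H" using p vH by simp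
    ultimately show False using join[of p t1] D[of p] p n by auto
  qed
  moreover have "p = t3 \<or> p = x" if p: "p \<in> verts P3" for p
  proof (rule ccontr)
    assume n: "\<not> ?thesis"
    have "p \<notin> {t1, t2, t3}" using T(3)[OF p] n by blast
    moreover have "t1 \<notin> verts P3" using T(3)[of t1] t by auto
    moreover have "p \<in> verts H" using p vH by simp
    ultimately show False using join[of p t1] D[of p] p n by auto
  qed
  ultimately have "verts H = {t1, t2, t3, x}" unfolding vH using is_path_simps(2)[OF H(3)] by auto
  moreover have "t1 \<noteq> x" "t2 \<noteq> x" "t3 \<noteq> x" using H(2) by auto
  ultimately show ?thesis using t by simp
qed

text \<open>\<open>x1\<close> and \<open>y2\<close> lie together in none of the two triangles and
  three paths.\<close>

lemma complete_prism:
  assumes "is_prism H" and com: "\<And>u v. u \<in> verts H \<Longrightarrow> v \<in> verts H \<Longrightarrow> u \<noteq> v \<Longrightarrow> {u, v} \<in> edges H"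
  shows False
proof -
  obtain x1 x2 x3 y1 y2 y3 P1 P2 P3 where H: "distinct [x1, x2, x3, y1, y2, y3]"
    "is_path x1 y1 P1" "is_path x2 y2 P2" "is_path x3 y3 P3"
    "verts P1 \<inter> verts P2 = {}" "verts P1 \<inter> verts P3 = {}" "verts P2 \<inter> verts P3 = {}"
    "H = graph_union (cycle_graph [x1, x2, x3]) (graph_union (cycle_graph [y1, y2, y3])
              (graph_union P1 (graph_union P2 P3)))"
    using assms(1) unfolding is_prism_def by (elim exE conjE) (rule that; assumption)
  have x1: "x1 \<in> verts P1" and y2: "y2 \<in> verts P2"
    using is_path_simps(1)[OF H(2)] is_path_simps(2)[OF H(3)] by auto
  have "{x1, y2} \<in> edges H"
    using H(1) unfolding H(8) graph_union_def by (intro com[unfolded H(8) graph_union_def]) auto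
  then have "{x1, y2} \<subseteq> {x1, x2, x3} \<or> {x1, y2} \<subseteq> {y1, y2, y3} \<or> {x1, y2} \<subseteq> verts P1 \<or>
    {x1, y2} \<subseteq> verts P2 \<or> {x1, y2} \<subseteq> verts P3"
    unfolding H(8) graph_union_def edges_triangle
    using is_path_simps(3)[OF H(2)] is_path_simps(3)[OF H(3)] is_path_simps(3)[OF H(4)] H(1)
    by auto
  moreover have "\<not> {x1, y2} \<subseteq> {x1, x2, x3}" "\<not> {x1, y2} \<subseteq> {y1, y2, y3}" using H(1) by auto
  ultimately show False using x1 y2 H(5-7) by blast
qed

text \<open>This bounds the solids of a complete graph by its 4-element vertex sets, the only place
  where solids must be estimated from above.\<close>

lemma complete_solid_graph:
  assumes "is_solid_graph H" "\<And>u v. u \<in> verts H \<Longrightarrow> v \<in> verts H \<Longrightarrow> u \<noteq> v \<Longrightarrow> {u, v} \<in> edges H"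
  shows "card (verts H) = 4"
  using assms(1) complete_pyramid[OF _ assms(2)] complete_trihedron[OF _ assms(2)]
    complete_stamp[OF _ assms(2)] complete_prism[OF _ assms(2)]
  unfolding is_solid_graph_def by blast

section \<open>Auxiliary counting facts\<close>

lemma third_element:
  assumes "distinct [x, y, z]" "r \<in> {x, y, z}" "s \<in> {x, y, z}" "r \<noteq> s"
  obtains t where "{r, s, t} = {x, y, z}" "distinct [r, s, t]"
proof -
  have "card {x, y, z} = 3" "card {r, s} = 2" using assms(1,4) by simp_all
  moreover have "{r, s} \<subseteq> {x, y, z}" using assms(2,3) by blast
  ultimately have "card ({x, y, z} - {r, s}) = 1" by (subst card_Diff_subset) simp_all
  then obtain t where t: "{x, y, z} - {r, s} = {t}" by (rule card_1_singletonE)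
  then have "{r, s, t} = {x, y, z}" using assms(2,3) by blast
  moreover have "distinct [r, s, t]" using t assms(4) by auto
  ultimately show ?thesis by (rule that)
qed

text \<open>The fibres will be the traces of cycles and solids on a neighbourhood. All traces of
  cycles are known, which gives an equality; for solids only some traces are kept, hence the
  inequality that follows.\<close>

lemma card_eq_sum_fibres:
  assumes "finite S" "finite I" "\<And>x. x \<in> S \<Longrightarrow> f x \<in> I"
  shows "card S = (\<Sum>i\<in>I. card {x \<in> S. f x = i})"
  using sum.group[of S I f "\<lambda>_. 1::nat"] assms by (auto simp: image_subset_iff)

lemma card_ge_sum_fibres:
  assumes "finite S" "finite I"
  shows "(\<Sum>i\<in>I. card {x \<in> S. f x = i}) \<le> card S"
proof -
  let ?S = "{x \<in> S. f x \<in> I}"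
  have "(\<Sum>i\<in>I. card {x \<in> S. f x = i}) = (\<Sum>i\<in>I. card {x \<in> ?S. f x = i})"
    by (intro sum.cong arg_cong[of _ _ card]) auto
  also have "\<dots> = card ?S" using assms by (intro card_eq_sum_fibres[symmetric]) auto
  also have "\<dots> \<le> card S" using assms by (intro card_mono) auto
  finally show ?thesis .
qed

section \<open>Induced paths and connected sets\<close>

text \<open>The edge set stays fixed while vertices are deleted, so an induced subgraph is
  represented by its vertex set \<open>X\<close> alone, with edges \<open>ind X\<close>.\<close>

locale simple_edges =
  fixes E :: "'a set set"
  assumes card2: "e \<in> E \<Longrightarrow> card e = 2"
begin

definition adj :: "'a \<Rightarrow> 'a \<Rightarrow> bool" where "adj u v \<longleftrightarrow> {u, v} \<in> E"

definition ind :: "'a set \<Rightarrow> 'a set set" where "ind X = {e \<in> E. e \<subseteq> X}"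

definition cyc :: "'a set \<Rightarrow> bool" where "cyc X \<longleftrightarrow> is_cycle (X, ind X)"

text \<open>No isomorphism occurs here: for the lower bound on \<open>beth3 G\<close> it is enough
  to count the induced subgraphs that are solid graphs themselves.\<close>

definition solid :: "'a set \<Rightarrow> bool" where "solid X \<longleftrightarrow> is_solid_graph (X, ind X)"

lemma adj_sym: "adj u v \<longleftrightarrow> adj v u"
  by (simp add: adj_def insert_commute)

lemma adj_irrefl [simp]: "\<not> adj u u"
  using card2[of "{u}"] by (auto simp: adj_def)

lemma edge_cases:
  assumes "e \<in> E" obtains u v where "e = {u, v}" "u \<noteq> v" "adj u v"
  using card2[OF assms] assms by (metis adj_def card_2_iff)

lemma ind_eqI:
  assumes "\<And>u v. u \<in> X \<Longrightarrow> v \<in> X \<Longrightarrow> adj u v \<Longrightarrow> {u, v} \<in> F"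
    and "\<And>e. e \<in> F \<Longrightarrow> e \<in> E \<and> e \<subseteq> X"
  shows "ind X = F"
proof
  show "ind X \<subseteq> F"
  proof
    fix e assume "e \<in> ind X"
    then have "e \<in> E" "e \<subseteq> X" by (auto simp: ind_def)
    then show "e \<in> F" by (metis assms(1) edge_cases insert_subset)
  qed
  show "F \<subseteq> ind X" using assms(2) by (auto simp: ind_def)
qed

lemma ind_mem: "{u, v} \<in> ind X \<longleftrightarrow> adj u v \<and> u \<in> X \<and> v \<in> X"
  by (auto simp: ind_def adj_def)

section \<open>Induced paths as lists\<close>

text \<open>Chordless paths as lists, so that they can be cut and concatenated. Only adjacency to
  later vertices is prescribed, symmetry of \<open>adj\<close> gives the rest. For empty
  \<open>xs\<close> the quantifier is vacuous, so the value of \<open>hd xs\<close> does not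
  matter.\<close>

fun ipath :: "'a list \<Rightarrow> bool" where
  "ipath [] = True"
| "ipath (x # xs) = (x \<notin> set xs \<and> (\<forall>w\<in>set xs. adj x w \<longleftrightarrow> w = hd xs) \<and> ipath xs)"

lemma ipath_distinct: "ipath xs \<Longrightarrow> distinct xs"
  by (induction xs) auto

lemma ipath_append:
  "ipath (xs @ ys) \<longleftrightarrow> ipath xs \<and> ipath ys \<and> set xs \<inter> set ys = {} \<and>
    (\<forall>u\<in>set xs. \<forall>w\<in>set ys. adj u w \<longleftrightarrow> u = last xs \<and> w = hd ys)"
proof (induction xs)
  case (Cons x xs)
  show ?case
  proof (cases "xs = []")
    case True
    then show ?thesis by auto
  next
    case False
    then have last: "last (x # xs) = last xs" "hd (xs @ ys) = hd xs" "last xs \<in> set xs" "hd xs \<in> set xs"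
      by auto
    have "ipath ((x # xs) @ ys) \<longleftrightarrow> x \<notin> set xs \<and> x \<notin> set ys \<and>
      (\<forall>w\<in>set xs. adj x w \<longleftrightarrow> w = hd xs) \<and> (\<forall>w\<in>set ys. adj x w \<longleftrightarrow> w = hd xs) \<and> ipath (xs @ ys)"
      using last by auto
    also have "\<dots> \<longleftrightarrow> x \<notin> set xs \<and> x \<notin> set ys \<and> (\<forall>w\<in>set xs. adj x w \<longleftrightarrow> w = hd xs) \<and>
      (\<forall>w\<in>set ys. \<not> adj x w) \<and> ipath (xs @ ys)"
    proof -
      have "set xs \<inter> set ys = {} \<Longrightarrow> (\<forall>w\<in>set ys. adj x w \<longleftrightarrow> w = hd xs) \<longleftrightarrow> (\<forall>w\<in>set ys. \<not> adj x w)"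
        using last(4) by auto
      then show ?thesis unfolding Cons.IH by satx
    qed
    also have "\<dots> \<longleftrightarrow> ipath (x # xs) \<and> ipath ys \<and> set (x # xs) \<inter> set ys = {} \<and>
      (\<forall>u\<in>set (x # xs). \<forall>w\<in>set ys. adj u w \<longleftrightarrow> u = last (x # xs) \<and> w = hd ys)"
      unfolding Cons.IH last(1) ball_simps(7) list.set(2) ipath.simps(2) using last(3) by blast
    finally show ?thesis .
  qed
qed simp

lemma ipath_rev [simp]: "ipath (rev xs) \<longleftrightarrow> ipath xs"
proof (induction xs)
  case (Cons x xs)
  have "(\<forall>u\<in>set xs. adj u x \<longleftrightarrow> u = hd xs) \<longleftrightarrow> (\<forall>u\<in>set xs. adj x u \<longleftrightarrow> u = hd xs)"
    using adj_sym by blast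
  then show ?case using Cons by (auto simp: ipath_append last_rev)
qed simp

lemma ind_ipath: "ipath xs \<Longrightarrow> ind (set xs) = edges (path_graph xs)"
proof (induction xs)
  case Nil
  show ?case using card2[of "{}"] by (auto simp: ind_def)
next
  case (Cons x xs)
  then have IH: "ind (set xs) = edges (path_graph xs)" by simp
  show ?case
  proof (rule ind_eqI)
    fix u v assume uv: "u \<in> set (x # xs)" "v \<in> set (x # xs)" "adj u v"
    show "{u, v} \<in> edges (path_graph (x # xs))"
    proof (cases "u \<in> set xs \<and> v \<in> set xs")
      case True
      then have "{u, v} \<in> ind (set xs)" using uv by (simp add: ind_mem)
      then show ?thesis using IH by (auto simp: edges_path_Cons')
    next
      case False
      then have "{u, v} = {x, hd xs}" "xs \<noteq> []"
        using uv Cons.prems adj_sym[of u v] by auto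
      then show ?thesis by (auto simp: edges_path_Cons')
    qed
  next
    fix e assume "e \<in> edges (path_graph (x # xs))"
    then show "e \<in> E \<and> e \<subseteq> set (x # xs)"
      using Cons.prems IH by (auto simp: edges_path_Cons' ind_def adj_def split: if_splits)
  qed
qed

text \<open>Needed to recover the chordless description when a cycle given by its edge set is cut
  open in \<open>cyc_rotate\<close>.\<close>

lemma ipathI_ind: "distinct xs \<Longrightarrow> ind (set xs) = edges (path_graph xs) \<Longrightarrow> ipath xs"
proof (induction xs)
  case (Cons x xs)
  have eq: "{u, v} \<in> edges (path_graph (x # xs)) \<longleftrightarrow> adj u v"
    if "u \<in> set (x # xs)" "v \<in> set (x # xs)" for u v
    using that Cons.prems(2) ind_mem[of u v "set (x # xs)"] by auto
  have x: "x \<notin> e" if "e \<in> edges (path_graph xs)" for e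
    using edges_path_subset[OF that] Cons.prems(1) by auto
  have "ind (set xs) = edges (path_graph xs)"
  proof (rule ind_eqI)
    fix u v assume "u \<in> set xs" "v \<in> set xs" "adj u v"
    then show "{u, v} \<in> edges (path_graph xs)"
      using eq[of u v] Cons.prems(1) by (auto simp: edges_path_Cons' doubleton_eq_iff split: if_splits)
  next
    fix e assume "e \<in> edges (path_graph xs)"
    moreover then have "e \<in> edges (path_graph (x # xs))" by (auto simp: edges_path_Cons')
    ultimately show "e \<in> E \<and> e \<subseteq> set xs"
      using Cons.prems(2) edges_path_subset[of e xs] unfolding ind_def by blast
  qed
  moreover have "adj x w \<longleftrightarrow> w = hd xs" if "w \<in> set xs" for w
    using eq[of x w] that x[of "{x, w}"] by (auto simp: edges_path_Cons' doubleton_eq_iff split: if_splits)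
  ultimately show ?case using Cons by auto
qed simp

text \<open>Connectivity is expressed by cuts; the empty set counts as connected.\<close>

definition conn :: "'a set \<Rightarrow> bool" where
  "conn K \<longleftrightarrow> (\<forall>M. M \<subseteq> K \<and> M \<noteq> {} \<and> M \<noteq> K \<longrightarrow> (\<exists>u\<in>M. \<exists>w\<in>K - M. adj u w))"

lemma connD: "conn K \<Longrightarrow> M \<subseteq> K \<Longrightarrow> M \<noteq> {} \<Longrightarrow> M \<noteq> K \<Longrightarrow> \<exists>u\<in>M. \<exists>w\<in>K - M. adj u w"
  unfolding conn_def by blast

lemma conn_empty [simp]: "conn {}"
  by (auto simp: conn_def)

lemma conn_single [simp]: "conn {x}"
  by (auto simp: conn_def)

lemma conn_Un:
  assumes "conn K" "conn L" "K \<inter> L \<noteq> {} \<or> (\<exists>u\<in>K. \<exists>w\<in>L. adj u w)"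
  shows "conn (K \<union> L)"
  unfolding conn_def
proof (intro allI impI)
  fix M assume M: "M \<subseteq> K \<union> L \<and> M \<noteq> {} \<and> M \<noteq> K \<union> L"
  show "\<exists>u\<in>M. \<exists>w\<in>K \<union> L - M. adj u w"
  proof (cases "(M \<inter> K \<noteq> {} \<and> M \<inter> K \<noteq> K) \<or> (M \<inter> L \<noteq> {} \<and> M \<inter> L \<noteq> L)")
    case True
    then show ?thesis
      using connD[OF assms(1), of "M \<inter> K"] connD[OF assms(2), of "M \<inter> L"] by blast
  next
    case False
    then have "M = K \<and> M \<inter> L = {} \<or> M = L \<and> M \<inter> K = {}" using M by blast
    then show ?thesis
    proof
      assume "M = K \<and> M \<inter> L = {}"
      then show ?thesis using assms(3) by blast
    next
      assume "M = L \<and> M \<inter> K = {}"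
      then show ?thesis using assms(3) adj_sym[of _ ] by (metis DiffI Un_iff disjoint_iff)
    qed
  qed
qed

lemma conn_insert: "conn K \<Longrightarrow> w \<in> K \<Longrightarrow> adj u w \<Longrightarrow> conn (insert u K)"
  using conn_Un[of "{u}" K] by (simp, blast)

lemma ipath_conn: "ipath xs \<Longrightarrow> conn (set xs)"
proof (induction xs)
  case (Cons x xs)
  then show ?case
    by (cases "xs = []") (auto intro!: conn_insert[of "set xs" "hd xs"])
qed simp

text \<open>A maximal proper connected subset containing \<open>u0\<close> can be enlarged by a
  vertex \<open>u\<close> outside it, and by maximality the result is all of \<open>K\<close>.
  Keeping \<open>u0\<close> allows a second application to produce a second non-cut vertex.\<close>

lemma exists_noncut:
  assumes "conn K" "finite K" "u0 \<in> K" "K \<noteq> {u0}"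
  obtains u where "u \<in> K" "u \<noteq> u0" "conn (K - {u})"
proof -
  let ?F = "{M. M \<subseteq> K \<and> M \<noteq> K \<and> u0 \<in> M \<and> conn M}"
  have "finite ?F" using assms(2) by (intro finite_subset[of ?F "Pow K"]) auto
  moreover have "{u0} \<in> ?F" using assms by auto
  ultimately have "\<exists>M\<in>?F. {u0} \<subseteq> M \<and> (\<forall>M'\<in>?F. M \<subseteq> M' \<longrightarrow> M = M')"
    by (rule finite_has_maximal2)
  then obtain M where M: "M \<in> ?F" and max: "\<forall>M'\<in>?F. M \<subseteq> M' \<longrightarrow> M = M'"
    by blast
  then obtain w u where uw: "w \<in> M" "u \<in> K - M" "adj w u"
    using connD[OF assms(1), of M] by blast
  then have "conn (insert u M)" using M conn_insert[of M w u] adj_sym[of u w] by simp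
  then have "insert u M = K" using M uw max by blast
  then have "K - {u} = M" using uw by blast
  then show ?thesis using that[of u] uw M by blast
qed

text \<open>The ends of induced paths in \<open>K\<close> that meet \<open>A\<close> only in their
  first vertex form a set that no edge of \<open>K\<close> leaves, so they exhaust \<open>K\<close>.
  A path ending at \<open>t\<close> is then cut at its first vertex in \<open>B\<close>.\<close>

lemma connected_ipath:
  assumes "conn K" "u \<in> K" "u \<in> A" "t \<in> K" "t \<in> B"
  obtains P where "ipath P" "P \<noteq> []" "set P \<subseteq> K" "\<forall>w\<in>set P. w \<in> A \<longleftrightarrow> w = hd P"
    "\<forall>w\<in>set P. w \<in> B \<longleftrightarrow> w = last P"
proof -
  let ?good = "\<lambda>P. ipath P \<and> P \<noteq> [] \<and> set P \<subseteq> K \<and> (\<forall>w\<in>set P. w \<in> A \<longleftrightarrow> w = hd P)"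
  have pre: "?good (xs @ [y])" if "?good (xs @ y # ys)" for xs y ys
  proof -
    have "hd (xs @ y # ys) = hd (xs @ [y])" by (cases xs) auto
    moreover have "ipath ((xs @ [y]) @ ys)" using that by simp
    then have "ipath (xs @ [y])" using ipath_append[of "xs @ [y]" ys] by blast
    ultimately show ?thesis using that by auto
  qed
  let ?M = "{w. \<exists>P. ?good P \<and> last P = w}"
  have sub: "?M \<subseteq> K" by auto
  have memI: "last P \<in> ?M" if "?good P" for P using that by blast
  have "u \<in> ?M" using assms memI[of "[u]"] by simp
  have "?M = K"
  proof (rule ccontr)
    assume "?M \<noteq> K"
    then obtain w w' where w: "w \<in> ?M" "w' \<in> K - ?M" "adj w w'"
      using connD[OF assms(1) sub] \<open>u \<in> ?M\<close> by blast
    then obtain P where P: "?good P" "last P = w" by blast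
    have nA: "w' \<notin> A"
    proof
      assume "w' \<in> A"
      then have "?good [w']" using w by simp
      then have "w' \<in> ?M" using memI[of "[w']"] by simp
      then show False using w by blast
    qed
    have nP: "w' \<notin> set P"
    proof
      assume "w' \<in> set P"
      then obtain xs ys where Ps: "P = xs @ w' # ys" using split_list by metis
      from pre[OF P(1)[unfolded Ps]] have "?good (xs @ [w'])" .
      from memI[OF this] have "w' \<in> ?M" by (simp only: last_snoc)
      then show False using w by blast
    qed
    \<comment> \<open>Cutting the path at its first neighbour of \<open>w'\<close> before appending
      \<open>w'\<close> keeps it chordless.\<close>
    have "\<exists>p\<in>set P. adj p w'" using P w by auto
    then obtain xs p ys where s: "P = xs @ p # ys" "adj p w'" "\<forall>q\<in>set xs. \<not> adj q w'"
      using split_list_first_prop[of P "\<lambda>p. adj p w'"] by blast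
    from pre[OF P(1)[unfolded s(1)]] have g: "?good (xs @ [p])" .
    then have "ipath ((xs @ [p]) @ [w'])" using s nP ipath_distinct[of "xs @ [p]"] by (subst ipath_append) auto
    then have "?good ((xs @ [p]) @ [w'])"
    proof -
      have "hd ((xs @ [p]) @ [w']) = hd (xs @ [p])" by (cases xs) auto
      moreover have "w' \<noteq> hd (xs @ [p])" using nP s by (cases xs) auto
      ultimately show ?thesis using g w nA \<open>ipath ((xs @ [p]) @ [w'])\<close> by auto
    qed
    from memI[OF this] have "w' \<in> ?M" by (simp only: last_snoc)
    then show False using w by blast
  qed
  then obtain P where P: "?good P" "last P = t" using assms by blast
  then have "\<exists>p\<in>set P. p \<in> B" using assms last_in_set by blast
  then obtain xs p ys where s: "P = xs @ p # ys" "p \<in> B" "\<forall>q\<in>set xs. q \<notin> B"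
    using split_list_first_prop[of P "\<lambda>p. p \<in> B"] by blast
  from pre[OF P(1)[unfolded s(1)]] have g: "?good (xs @ [p])" .
  have "\<forall>w\<in>set (xs @ [p]). w \<in> B \<longleftrightarrow> w = last (xs @ [p])"
    using s ipath_distinct[of "xs @ [p]"] by auto
  then show ?thesis using g by (intro that[of "xs @ [p]"]) auto
qed

section \<open>Recognizing induced cycles and solids\<close>

lemma cyc_insertI:
  assumes P: "ipath P" "2 \<le> length P" and a: "a \<notin> set P"
    and adj: "\<And>w. w \<in> set P \<Longrightarrow> adj a w \<longleftrightarrow> w = hd P \<or> w = last P"
  shows "cyc (insert a (set P))"
proof -
  have ne: "P \<noteq> []" using P by auto
  have "ind (insert a (set P)) = insert {last P, a} (insert {a, hd P} (ind (set P)))"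
  proof (rule ind_eqI)
    fix u v assume uv: "u \<in> insert a (set P)" "v \<in> insert a (set P)" "adj u v"
    then consider "u \<in> set P" "v \<in> set P" | "u = a" "v \<in> set P" | "v = a" "u \<in> set P"
      by auto
    then show "{u, v} \<in> insert {last P, a} (insert {a, hd P} (ind (set P)))"
      by cases (use uv adj adj_sym[of u v] in \<open>auto simp: ind_mem\<close>)
  next
    fix e assume "e \<in> insert {last P, a} (insert {a, hd P} (ind (set P)))"
    moreover have "adj a (hd P)" "adj a (last P)" using adj ne by auto
    ultimately show "e \<in> E \<and> e \<subseteq> insert a (set P)"
      using ne by (auto simp: ind_def adj_def insert_commute)
  qed
  then have "(insert a (set P), ind (insert a (set P))) = cycle_graph (a # P)"
    using ne by (simp add: ind_ipath[OF P(1)] cycle_graph_def edges_path_Cons')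
  moreover have "distinct (a # P)" "3 \<le> length (a # P)" using P a ipath_distinct by auto
  ultimately show ?thesis unfolding cyc_def is_cycle_def by metis
qed

text \<open>The list of the cycle is cut at \<open>a\<close> and its front part moved to the back,
  so any chosen vertex of an induced cycle closes an induced path.\<close>

lemma cyc_rotate:
  assumes "cyc X" "a \<in> X"
  obtains P where "ipath P" "2 \<le> length P" "a \<notin> set P" "X = insert a (set P)"
    "\<And>w. w \<in> set P \<Longrightarrow> adj a w \<longleftrightarrow> w = hd P \<or> w = last P"
proof -
  obtain xs where xs: "distinct xs" "3 \<le> length xs" "X = set xs"
    "ind X = insert {last xs, hd xs} (edges (path_graph xs))"
    using assms(1) unfolding cyc_def is_cycle_def cycle_graph_def by auto
  then obtain ys zs where s: "xs = ys @ a # zs" using assms(2) split_list by metis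
  define P where "P = zs @ ys"
  have P: "distinct P" "2 \<le> length P" "a \<notin> set P" "X = insert a (set P)" "P \<noteq> []"
    using xs s by (auto simp: P_def)
  \<comment> \<open>The closing edge of the cycle becomes the seam between \<open>zs\<close> and
    \<open>ys\<close>, or an edge at \<open>a\<close> if one of them is empty.\<close>
  have eq: "ind X = insert {a, hd P} (insert {a, last P} (edges (path_graph P)))"
    unfolding xs(4) s P_def
    by (cases "ys = []"; cases "zs = []")
      (use xs s in \<open>auto simp: edges_path_append edges_path_Cons' insert_commute\<close>)
  have na: "a \<notin> e" if "e \<in> edges (path_graph P)" for e
    using edges_path_subset[OF that] P by auto
  have "ind (set P) = edges (path_graph P)"
  proof
    show "ind (set P) \<subseteq> edges (path_graph P)"
    proof
      fix e assume e: "e \<in> ind (set P)"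
      then have "e \<in> ind X" "a \<notin> e" using P by (auto simp: ind_def)
      then show "e \<in> edges (path_graph P)" using eq by auto
    qed
    show "edges (path_graph P) \<subseteq> ind (set P)"
      using eq edges_path_subset[of _ P] by (auto simp: ind_def)
  qed
  then have ip: "ipath P" using P ipathI_ind by blast
  have "adj a w \<longleftrightarrow> w = hd P \<or> w = last P" if "w \<in> set P" for w
  proof -
    have "adj a w \<longleftrightarrow> {a, w} \<in> ind X" using that P by (simp add: ind_mem)
    also have "\<dots> \<longleftrightarrow> w = hd P \<or> w = last P"
      unfolding eq using na[of "{a, w}"] that P by (auto simp: doubleton_eq_iff)
    finally show ?thesis .
  qed
  then show ?thesis using that ip P by blast
qed

lemma ind_insert: "y \<notin> C \<Longrightarrow> ind (insert y C) = ind C \<union> {{y, w} |w. w \<in> {w \<in> C. adj y w}}"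
proof (rule ind_eqI)
  fix u v assume "y \<notin> C" "u \<in> insert y C" "v \<in> insert y C" "adj u v"
  then show "{u, v} \<in> ind C \<union> {{y, w} |w. w \<in> {w \<in> C. adj y w}}"
    using adj_sym[of u v] by (cases "u = y"; cases "v = y") (auto simp: ind_mem)
qed (auto simp: ind_def adj_def)

lemma solid_pyramid:
  assumes "cyc C" "y \<notin> C" "3 \<le> card {w \<in> C. adj y w}"
  shows "solid (insert y C)"
proof -
  have "is_pyramid (insert y C, ind (insert y C))"
    unfolding is_pyramid_def ind_insert[OF assms(2)]
    by (rule exI[of _ "(C, ind C)"], rule exI[of _ y], rule exI[of _ "{w \<in> C. adj y w}"])
      (use assms in \<open>auto simp: cyc_def\<close>)
  then show ?thesis by (simp add: solid_def is_solid_graph_def)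
qed

text \<open>Reduces the edge set of a union of paths to the edges that cross between the
  paths.\<close>

lemma ind_Un_subset:
  assumes "ind A \<subseteq> F" "ind B \<subseteq> F" "\<And>u v. u \<in> A \<Longrightarrow> v \<in> B \<Longrightarrow> adj u v \<Longrightarrow> {u, v} \<in> F"
  shows "ind (A \<union> B) \<subseteq> F"
proof
  fix e assume "e \<in> ind (A \<union> B)"
  then have e: "e \<in> E" "e \<subseteq> A \<union> B" by (auto simp: ind_def)
  then obtain u v where uv: "e = {u, v}" "adj u v" using edge_cases by metis
  then consider "u \<in> A" "v \<in> A" | "u \<in> A" "v \<in> B" | "v \<in> A" "u \<in> B" | "u \<in> B" "v \<in> B"
    using e by blast
  then show "e \<in> F"
  proof cases
    case 3
    then have "{v, u} \<in> F" using assms(3) uv adj_sym[of u v] by blast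
    then show ?thesis using uv by (simp add: insert_commute)
  qed (use assms uv in \<open>auto simp: ind_mem subset_iff\<close>)
qed

lemma is_pathI: "ipath xs \<Longrightarrow> xs \<noteq> [] \<Longrightarrow> hd xs = a \<Longrightarrow> last xs = b \<Longrightarrow> is_path a b (set xs, ind (set xs))"
  unfolding is_path_def using ipath_distinct ind_ipath
  by (intro exI[of _ xs]) (auto simp: path_graph_def)

lemma card_ind_ipath: "ipath xs \<Longrightarrow> card (ind (set xs)) = length xs - 1"
  using path_length_distinct[of xs] ipath_distinct[of xs] by (simp add: ind_ipath)

lemma is_path_Cons_append:
  "ipath (a # L @ [c]) \<Longrightarrow> is_path a c (set (a # L @ [c]), ind (set (a # L @ [c])))"
  by (rule is_pathI) auto

text \<open>A trihedron if the first vertices of \<open>L1\<close> and \<open>L2\<close> are not adjacent, and a stamp with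
  apex \<open>c\<close> if they are.\<close>

lemma spider_aux:
  assumes ne: "L1 \<noteq> []" "L2 \<noteq> []" "L3 \<noteq> []"
    and ip: "ipath (a # L1 @ [c])" "ipath (a # L2 @ [c])" "ipath (a # L3 @ [c])"
    and dis: "set L1 \<inter> set L2 = {}" "set L1 \<inter> set L3 = {}" "set L2 \<inter> set L3 = {}"
    and cross: "\<And>u w. u \<in> set L1 \<Longrightarrow> w \<in> set L2 \<Longrightarrow> adj u w \<Longrightarrow> u = hd L1 \<and> w = hd L2"
      "\<And>u w. u \<in> set L1 \<Longrightarrow> w \<in> set L3 \<Longrightarrow> \<not> adj u w"
      "\<And>u w. u \<in> set L2 \<Longrightarrow> w \<in> set L3 \<Longrightarrow> \<not> adj u w"
  shows "solid (insert a (insert c (set L1 \<union> set L2 \<union> set L3)))" (is "solid ?X")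
proof -
  define A B C where ABC: "A = set (a # L1 @ [c])" "B = set (a # L2 @ [c])" "C = set (a # L3 @ [c])"
  have X: "?X = A \<union> (B \<union> C)" by (auto simp: ABC)
  have ac: "a \<noteq> c" "a \<notin> set L1" "a \<notin> set L2" "a \<notin> set L3" "c \<notin> set L1" "c \<notin> set L2" "c \<notin> set L3"
    using ip by (auto simp: ipath_append)
  show ?thesis
  proof (cases "adj (hd L1) (hd L2)")
    case False
    have no: "\<not> adj u w" if "u \<in> set L1" "w \<in> set L2" for u w using cross(1) that False by blast
    have "ind (B \<union> C) \<subseteq> ind A \<union> (ind B \<union> ind C)"
    proof (rule ind_Un_subset)
      fix u v assume "u \<in> B" "v \<in> C" "adj u v"
      then show "{u, v} \<in> ind A \<union> (ind B \<union> ind C)"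
        using cross(3) by (auto simp: ABC ind_mem)
    qed auto
    then have "ind (A \<union> (B \<union> C)) \<subseteq> ind A \<union> (ind B \<union> ind C)"
    proof (rule ind_Un_subset[rotated])
      fix u v assume "u \<in> A" "v \<in> B \<union> C" "adj u v"
      then show "{u, v} \<in> ind A \<union> (ind B \<union> ind C)"
        using cross(2) no by (auto simp: ABC ind_mem)
    qed auto
    moreover have "ind A \<union> (ind B \<union> ind C) \<subseteq> ind (A \<union> (B \<union> C))"
      by (auto simp: ind_def)
    ultimately have "ind (A \<union> (B \<union> C)) = ind A \<union> (ind B \<union> ind C)" by blast
    then have ind: "ind ?X = ind A \<union> (ind B \<union> ind C)" using X by simp
    have "is_trihedron (?X, ind ?X)"
      unfolding is_trihedron_def
    proof (intro exI conjI)
      show "a \<noteq> c" by (fact ac)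
      show "\<forall>P\<in>{(A, ind A), (B, ind B), (C, ind C)}. is_path a c P \<and> 2 \<le> path_length P"
        using ne is_path_Cons_append[OF ip(1)] is_path_Cons_append[OF ip(2)] is_path_Cons_append[OF ip(3)]
          card_ind_ipath[OF ip(1)] card_ind_ipath[OF ip(2)] card_ind_ipath[OF ip(3)]
        unfolding ABC by (auto simp: Suc_le_eq)
      show "verts (A, ind A) \<inter> verts (B, ind B) = {a, c}"
        "verts (A, ind A) \<inter> verts (C, ind C) = {a, c}"
        "verts (B, ind B) \<inter> verts (C, ind C) = {a, c}"
        using dis by (auto simp: ABC)
      show "(?X, ind ?X) = graph_union (A, ind A) (graph_union (B, ind B) (C, ind C))"
        unfolding ind unfolding X graph_union_def by simp
    qed
    then show ?thesis by (simp add: solid_def is_solid_graph_def)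
  next
    case True
    define x y where xy: "x = hd L1" "y = hd L2"
    define A' B' where AB': "A' = set (L1 @ [c])" "B' = set (L2 @ [c])"
    have ip': "ipath (L1 @ [c])" "ipath (L2 @ [c])" using ip by auto
    have xin: "x \<in> set L1" "y \<in> set L2" using ne by (auto simp: xy)
    then have xyne: "x \<noteq> y" "x \<noteq> a" "y \<noteq> a" "x \<noteq> c" "y \<noteq> c" using dis ac by auto
    have ax: "adj a w \<longleftrightarrow> w = x" if "w \<in> set L1" for w
      using ip(1) that ne by (auto simp: xy)
    have ay: "adj a w \<longleftrightarrow> w = y" if "w \<in> set L2" for w
      using ip(2) that ne by (auto simp: xy)
    \<comment> \<open>The triangle of the stamp is \<open>x\<close>, \<open>y\<close>,
      \<open>a\<close>; the paths from it to \<open>c\<close> are \<open>L1 @ [c]\<close>,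
      \<open>L2 @ [c]\<close> and \<open>a # L3 @ [c]\<close>.\<close>
    let ?T = "{{x, y}, {y, a}, {a, x}}"
    let ?F = "?T \<union> (ind A' \<union> (ind B' \<union> ind C))"
    have Taxy: "?T \<subseteq> ind ?X" using ax ay xin True adj_sym[of a y] by (auto simp: ind_mem xy)
    have "ind (B' \<union> C) \<subseteq> ?F"
    proof (rule ind_Un_subset)
      fix u v assume "u \<in> B'" "v \<in> C" "adj u v"
      then consider "u = c" "v \<in> C" | "u \<in> set L2" "v = a" | "u \<in> set L2" "v = c"
        using cross(3) by (auto simp: ABC AB')
      then show "{u, v} \<in> ?F"
      proof cases
        case 1
        then have "{u, v} \<in> ind C" using \<open>adj u v\<close> by (simp add: ind_mem ABC)
        then show ?thesis by blast
      next
        case 2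
        then have "u = y" using ay \<open>adj u v\<close> adj_sym[of u v] by blast
        then show ?thesis using 2 by blast
      next
        case 3
        then have "{u, v} \<in> ind B'" using \<open>adj u v\<close> by (simp add: ind_mem AB')
        then show ?thesis by blast
      qed
    qed auto
    then have "ind (A' \<union> (B' \<union> C)) \<subseteq> ?F"
    proof (rule ind_Un_subset[rotated])
      fix u v assume "u \<in> A'" "v \<in> B' \<union> C" "adj u v"
      then consider "u = c" "v \<in> B'" | "u = c" "v \<in> C" | "u \<in> set L1" "v = a"
        | "u \<in> set L1" "v = c" | "u \<in> set L1" "v \<in> set L2"
        using cross(2) by (auto simp: ABC AB')
      then show "{u, v} \<in> ?F"
      proof cases
        case 1
        then have "{u, v} \<in> ind B'" using \<open>adj u v\<close> by (simp add: ind_mem AB')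
        then show ?thesis by blast
      next
        case 2
        then have "{u, v} \<in> ind C" using \<open>adj u v\<close> by (simp add: ind_mem ABC)
        then show ?thesis by blast
      next
        case 3
        then have "u = x" using ax \<open>adj u v\<close> adj_sym[of u v] by blast
        then show ?thesis using 3 by blast
      next
        case 4
        then have "{u, v} \<in> ind A'" using \<open>adj u v\<close> by (simp add: ind_mem AB')
        then show ?thesis by blast
      next
        case 5
        then have "{u, v} = {x, y}" using cross(1) \<open>adj u v\<close> unfolding xy by blast
        then show ?thesis by blast
      qed
    qed auto
    moreover have "ind A' \<union> (ind B' \<union> ind C) \<subseteq> ind (A' \<union> (B' \<union> C))"
      by (auto simp: ind_def)
    moreover have X': "?X = A' \<union> (B' \<union> C)" by (auto simp: ABC AB')
    moreover note Taxy[unfolded X']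
    ultimately have ind: "ind ?X = ?F" by simp blast
    have "is_stamp (?X, ind ?X)"
      unfolding is_stamp_def
    proof (intro exI conjI)
      show "distinct [x, y, a]" "c \<notin> {x, y, a}" using xyne ac by auto
      show "is_path x c (A', ind A')" "is_path y c (B', ind B')"
        unfolding AB' using ip' ne by (auto intro!: is_pathI simp: xy simp del: set_append)
      show "is_path a c (C, ind C)" unfolding ABC by (rule is_path_Cons_append[OF ip(3)])
      show "1 \<le> path_length (A', ind A')" "1 \<le> path_length (B', ind B')" "1 \<le> path_length (C, ind C)"
        using card_ind_ipath[OF ip'(1)] card_ind_ipath[OF ip'(2)] card_ind_ipath[OF ip(3)] ne
        unfolding ABC AB' by (auto simp: Suc_le_eq)
      show "(?X, ind ?X) = graph_union (cycle_graph [x, y, a])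
        (graph_union (A', ind A') (graph_union (B', ind B') (C, ind C)))"
        unfolding ind unfolding X' graph_union_def edges_triangle
        using xin by (auto simp: ABC AB')
    qed (use dis ac xin xyne in \<open>auto simp: ABC AB'\<close>)
    then show ?thesis by (simp add: solid_def is_solid_graph_def)
  qed
qed

text \<open>\<open>one\<close> says that at most one edge joins the first vertices of the three
  legs. Permuting the legs turns this edge into one between the first two, as
  \<open>spider_aux\<close> requires.\<close>

lemma solid_spider:
  assumes ne: "L1 \<noteq> []" "L2 \<noteq> []" "L3 \<noteq> []"
    and ip: "ipath (a # L1 @ [c])" "ipath (a # L2 @ [c])" "ipath (a # L3 @ [c])"
    and dis: "set L1 \<inter> set L2 = {}" "set L1 \<inter> set L3 = {}" "set L2 \<inter> set L3 = {}"
    and cross: "\<And>u w. u \<in> set L1 \<Longrightarrow> w \<in> set L2 \<Longrightarrow> adj u w \<Longrightarrow> u = hd L1 \<and> w = hd L2"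
      "\<And>u w. u \<in> set L1 \<Longrightarrow> w \<in> set L3 \<Longrightarrow> adj u w \<Longrightarrow> u = hd L1 \<and> w = hd L3"
      "\<And>u w. u \<in> set L2 \<Longrightarrow> w \<in> set L3 \<Longrightarrow> adj u w \<Longrightarrow> u = hd L2 \<and> w = hd L3"
    and one: "adj (hd L1) (hd L2) \<Longrightarrow> \<not> adj (hd L1) (hd L3) \<and> \<not> adj (hd L2) (hd L3)"
      "\<not> (adj (hd L1) (hd L3) \<and> adj (hd L2) (hd L3))"
  shows "solid (insert a (insert c (set L1 \<union> set L2 \<union> set L3)))"
proof -
  consider "\<not> adj (hd L1) (hd L3)" "\<not> adj (hd L2) (hd L3)"
    | "\<not> adj (hd L1) (hd L2)" "\<not> adj (hd L2) (hd L3)"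
    | "\<not> adj (hd L1) (hd L2)" "\<not> adj (hd L1) (hd L3)"
    using one by blast
  then show ?thesis
  proof cases
    case 1
    then show ?thesis by (intro spider_aux ne ip dis) (use cross in blast)+
  next
    case 2
    have "solid (insert a (insert c (set L1 \<union> set L3 \<union> set L2)))"
    proof (rule spider_aux[OF ne(1,3,2) ip(1,3,2) dis(2,1)])
      show "\<not> adj u w" if "u \<in> set L3" "w \<in> set L2" for u w
        using cross(3)[OF that(2,1)] adj_sym[of u w] 2 by blast
    qed (use dis cross 2 in blast)+
    then show ?thesis by (simp add: Un_ac)
  next
    case 3
    have "solid (insert a (insert c (set L2 \<union> set L3 \<union> set L1)))"
    proof (rule spider_aux[OF ne(2,3,1) ip(2,3,1) dis(3)])
      show "\<not> adj u w" if "u \<in> set L2" "w \<in> set L1" for u w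
        using cross(1)[OF that(2,1)] adj_sym[of u w] 3 by blast
      show "\<not> adj u w" if "u \<in> set L3" "w \<in> set L1" for u w
        using cross(2)[OF that(2,1)] adj_sym[of u w] 3 by blast
    qed (use dis cross 3 in blast)+
    then show ?thesis by (simp add: Un_ac)
  qed
qed

text \<open>A stamp with apex \<open>a\<close> if the first vertices of \<open>L1\<close> and \<open>L2\<close> are not adjacent, and a
  prism if they are.\<close>

lemma trispider_aux:
  assumes ne: "L1 \<noteq> []" "L2 \<noteq> []" "L3 \<noteq> []"
    and ip: "ipath (a # L1)" "ipath (a # L2)" "ipath (a # L3)"
    and dis: "set L1 \<inter> set L2 = {}" "set L1 \<inter> set L3 = {}" "set L2 \<inter> set L3 = {}"
    and last: "adj (last L1) (last L2)" "adj (last L1) (last L3)" "adj (last L2) (last L3)"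
    and cross: "\<And>u w. u \<in> set L1 \<Longrightarrow> w \<in> set L2 \<Longrightarrow> adj u w \<Longrightarrow> u = hd L1 \<and> w = hd L2 \<or> u = last L1 \<and> w = last L2"
      "\<And>u w. u \<in> set L1 \<Longrightarrow> w \<in> set L3 \<Longrightarrow> adj u w \<Longrightarrow> u = last L1 \<and> w = last L3"
      "\<And>u w. u \<in> set L2 \<Longrightarrow> w \<in> set L3 \<Longrightarrow> adj u w \<Longrightarrow> u = last L2 \<and> w = last L3"
    and len: "adj (hd L1) (hd L2) \<Longrightarrow> hd L1 \<noteq> last L1 \<and> hd L2 \<noteq> last L2"
  shows "solid (insert a (set L1 \<union> set L2 \<union> set L3))" (is "solid ?X")
proof -
  define p q t where pqt: "p = last L1" "q = last L2" "t = last L3"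
  have pin: "p \<in> set L1" "q \<in> set L2" "t \<in> set L3" using ne by (auto simp: pqt)
  have an: "a \<notin> set L1" "a \<notin> set L2" "a \<notin> set L3" using ip by auto
  have ne3: "distinct [p, q, t, a]" using pin dis an by auto
  let ?T = "{{p, q}, {q, t}, {t, p}}"
  have Tpqt: "?T \<subseteq> ind ?X" using last pin adj_sym[of p t] by (auto simp: ind_mem pqt)
  define x y where xy: "x = hd L1" "y = hd L2"
  have xin: "x \<in> set L1" "y \<in> set L2" using ne by (auto simp: xy)
  have ax: "adj a w \<longleftrightarrow> w = x" if "w \<in> set L1" for w using ip(1) that by (auto simp: xy)
  have ay: "adj a w \<longleftrightarrow> w = y" if "w \<in> set L2" for w using ip(2) that by (auto simp: xy)
  show ?thesis
  proof (cases "adj x y")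
    case False
    define A B C where ABC: "A = set (a # L1)" "B = set (a # L2)" "C = set (a # L3)"
    let ?F = "?T \<union> (ind A \<union> (ind B \<union> ind C))"
    have "ind (B \<union> C) \<subseteq> ?F"
    proof (rule ind_Un_subset)
      fix u v assume "u \<in> B" "v \<in> C" "adj u v"
      then consider "{u, v} \<subseteq> B" | "{u, v} \<subseteq> C" | "u = q" "v = t"
        using cross(3) by (auto simp: ABC pqt)
      then show "{u, v} \<in> ?F"
        by cases (use \<open>adj u v\<close> ind_mem[of u v] in blast)+
    qed auto
    then have "ind (A \<union> (B \<union> C)) \<subseteq> ?F"
    proof (rule ind_Un_subset[rotated])
      fix u v assume "u \<in> A" "v \<in> B \<union> C" "adj u v"
      then consider "{u, v} \<subseteq> A" | "{u, v} \<subseteq> B" | "{u, v} \<subseteq> C" | "u = p" "v = q" | "u = p" "v = t"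
        using cross(1,2) False by (auto simp: ABC pqt xy)
      then show "{u, v} \<in> ?F"
        by cases (use \<open>adj u v\<close> ind_mem[of u v] in blast)+
    qed auto
    moreover have "ind A \<union> (ind B \<union> ind C) \<subseteq> ind (A \<union> (B \<union> C))"
      by (auto simp: ind_def)
    moreover have X: "?X = A \<union> (B \<union> C)" by (auto simp: ABC)
    moreover note Tpqt[unfolded X]
    ultimately have ind: "ind ?X = ?F" by simp blast
    have rv: "set (rev (a # L)) = set (a # L)" for L by simp
    have path: "is_path (last L) a (set (a # L), ind (set (a # L)))" if "ipath (a # L)" "L \<noteq> []" for L
      using is_pathI[of "rev (a # L)" "last L" a] that unfolding rv ipath_rev by (simp add: hd_rev)
    have "is_stamp (?X, ind ?X)"
      unfolding is_stamp_def
    proof (intro exI conjI)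
      show "distinct [p, q, t]" "a \<notin> {p, q, t}" using ne3 by auto
      show "is_path p a (A, ind A)" "is_path q a (B, ind B)" "is_path t a (C, ind C)"
        unfolding ABC pqt using path ip ne by blast+
      show "1 \<le> path_length (A, ind A)" "1 \<le> path_length (B, ind B)" "1 \<le> path_length (C, ind C)"
        using card_ind_ipath[OF ip(1)] card_ind_ipath[OF ip(2)] card_ind_ipath[OF ip(3)] ne
        unfolding ABC by (auto simp: Suc_le_eq)
      show "(?X, ind ?X) = graph_union (cycle_graph [p, q, t])
        (graph_union (A, ind A) (graph_union (B, ind B) (C, ind C)))"
        unfolding ind unfolding X graph_union_def edges_triangle
        using pin by (auto simp: ABC)
    qed (use dis an pin ne3 in \<open>auto simp: ABC\<close>)
    then show ?thesis by (simp add: solid_def is_solid_graph_def)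
  next
    case True
    define A B C where ABC: "A = set L1" "B = set L2" "C = set (a # L3)"
    have ax': "adj w a \<longleftrightarrow> w = x" if "w \<in> set L1" for w using ax[OF that] adj_sym[of w a] by simp
    have ay': "adj w a \<longleftrightarrow> w = y" if "w \<in> set L2" for w using ay[OF that] adj_sym[of w a] by simp
    let ?S = "{{x, y}, {y, a}, {a, x}}"
    let ?F = "?S \<union> (?T \<union> (ind A \<union> (ind B \<union> ind C)))"
    have S: "?S \<subseteq> ind ?X" using True xin ax ay adj_sym[of a y] by (auto simp: ind_mem)
    have "ind (B \<union> C) \<subseteq> ?F"
    proof (rule ind_Un_subset)
      fix u v assume uv: "u \<in> B" "v \<in> C" "adj u v"
      then have "u = y \<and> v = a \<or> u = q \<and> v = t"
        using cross(3)[of u v] ay'[of u] unfolding ABC pqt by (cases "v = a") simp_all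
      then show "{u, v} \<in> ?F" by (elim disjE conjE) (simp_all add: insert_commute)
    qed auto
    then have "ind (A \<union> (B \<union> C)) \<subseteq> ?F"
    proof (rule ind_Un_subset[rotated])
      fix u v assume uv: "u \<in> A" "v \<in> B \<union> C" "adj u v"
      then consider "v = a" | "v \<in> set L2" | "v \<in> set L3" by (auto simp: ABC)
      then have "u = x \<and> v = y \<or> u = x \<and> v = a \<or> u = p \<and> v = q \<or> u = p \<and> v = t"
      proof cases
        case 1
        then show ?thesis using ax'[of u] uv by (simp add: ABC)
      next
        case 2
        then show ?thesis using cross(1)[of u v] uv unfolding xy pqt ABC by blast
      next
        case 3
        then show ?thesis using cross(2)[of u v] uv unfolding xy pqt ABC by blast
      qed
      then show "{u, v} \<in> ?F" by (elim disjE conjE) (simp_all add: insert_commute)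
    qed auto
    moreover have "ind A \<union> (ind B \<union> ind C) \<subseteq> ind (A \<union> (B \<union> C))"
      by (auto simp: ind_def)
    moreover have X: "?X = A \<union> (B \<union> C)" by (auto simp: ABC)
    moreover note Tpqt[unfolded X] S[unfolded X]
    ultimately have ind: "ind ?X = ?F" by simp blast
    \<comment> \<open>The two triangles of the prism must be disjoint, which is the purpose of
      \<open>len\<close>. The path from \<open>a\<close> to \<open>t\<close> has distinct ends
      anyway, since \<open>a\<close> is off \<open>L3\<close>.\<close>
    have "x \<noteq> p" "y \<noteq> q" using True len by (auto simp: xy pqt)
    have "is_prism (?X, ind ?X)"
      unfolding is_prism_def
    proof (intro exI conjI)
      show "distinct [x, y, a, p, q, t]"
        using ne3 \<open>x \<noteq> p\<close> \<open>y \<noteq> q\<close> xin pin dis an by auto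
      show "is_path x p (A, ind A)" unfolding ABC pqt xy by (rule is_pathI) (use ip ne in simp_all)
      show "is_path y q (B, ind B)" unfolding ABC pqt xy by (rule is_pathI) (use ip ne in simp_all)
      show "is_path a t (C, ind C)" unfolding ABC pqt by (rule is_pathI[OF ip(3)]) (use ne in simp_all)
      show "(?X, ind ?X) = graph_union (cycle_graph [x, y, a]) (graph_union (cycle_graph [p, q, t])
        (graph_union (A, ind A) (graph_union (B, ind B) (C, ind C))))"
        unfolding ind unfolding X graph_union_def edges_triangle
        using pin xin by (auto simp: ABC)
    qed (use dis an in \<open>auto simp: ABC\<close>)
    then show ?thesis by (simp add: solid_def is_solid_graph_def)
  qed
qed

text \<open>As for \<open>solid_spider\<close>, the legs are permuted so that the only possible edge
  between first vertices joins the first two. The third leg may be a single vertex, but only if it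
  takes no part in such an edge, since otherwise the two triangles of the prism would
  overlap.\<close>

lemma solid_trispider:
  assumes ne: "L1 \<noteq> []" "L2 \<noteq> []" "L3 \<noteq> []"
    and ip: "ipath (a # L1)" "ipath (a # L2)" "ipath (a # L3)"
    and dis: "set L1 \<inter> set L2 = {}" "set L1 \<inter> set L3 = {}" "set L2 \<inter> set L3 = {}"
    and last: "adj (last L1) (last L2)" "adj (last L1) (last L3)" "adj (last L2) (last L3)"
    and cross: "\<And>u w. u \<in> set L1 \<Longrightarrow> w \<in> set L2 \<Longrightarrow> adj u w \<Longrightarrow> u = hd L1 \<and> w = hd L2 \<or> u = last L1 \<and> w = last L2"
      "\<And>u w. u \<in> set L1 \<Longrightarrow> w \<in> set L3 \<Longrightarrow> adj u w \<Longrightarrow> u = hd L1 \<and> w = hd L3 \<or> u = last L1 \<and> w = last L3"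
      "\<And>u w. u \<in> set L2 \<Longrightarrow> w \<in> set L3 \<Longrightarrow> adj u w \<Longrightarrow> u = hd L2 \<and> w = hd L3 \<or> u = last L2 \<and> w = last L3"
    and len: "hd L1 \<noteq> last L1" "hd L2 \<noteq> last L2" "hd L3 \<noteq> last L3 \<or> \<not> adj (hd L1) (hd L3) \<and> \<not> adj (hd L2) (hd L3)"
    and one: "adj (hd L1) (hd L2) \<Longrightarrow> \<not> adj (hd L1) (hd L3) \<and> \<not> adj (hd L2) (hd L3)"
      "\<not> (adj (hd L1) (hd L3) \<and> adj (hd L2) (hd L3))"
  shows "solid (insert a (set L1 \<union> set L2 \<union> set L3))"
proof -
  consider "\<not> adj (hd L1) (hd L3)" "\<not> adj (hd L2) (hd L3)"
    | "\<not> adj (hd L1) (hd L2)" "\<not> adj (hd L2) (hd L3)" "hd L3 \<noteq> last L3"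
    | "\<not> adj (hd L1) (hd L2)" "\<not> adj (hd L1) (hd L3)" "hd L3 \<noteq> last L3"
    using one len by blast
  then show ?thesis
  proof cases
    case 1
    then show ?thesis by (intro trispider_aux ne ip dis last) (use cross len in blast)+
  next
    case 2
    have "solid (insert a (set L1 \<union> set L3 \<union> set L2))"
    proof (rule trispider_aux[OF ne(1,3,2) ip(1,3,2) dis(2,1)])
      show "adj (last L3) (last L2)" using last(3) adj_sym by metis
      show "u = last L3 \<and> w = last L2" if "u \<in> set L3" "w \<in> set L2" "adj u w" for u w
        using cross(3)[OF that(2,1)] that(3) adj_sym[of u w] 2 by blast
    qed (use dis cross 2 last len in blast)+
    then show ?thesis by (simp add: Un_ac)
  next
    case 3
    have "solid (insert a (set L2 \<union> set L3 \<union> set L1))"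
    proof (rule trispider_aux[OF ne(2,3,1) ip(2,3,1) dis(3)])
      show "adj (last L2) (last L1)" "adj (last L3) (last L1)" using last adj_sym by metis+
      show "u = last L2 \<and> w = last L1" if "u \<in> set L2" "w \<in> set L1" "adj u w" for u w
        using cross(1)[OF that(2,1)] that(3) adj_sym[of u w] 3 by blast
      show "u = last L3 \<and> w = last L1" if "u \<in> set L3" "w \<in> set L1" "adj u w" for u w
        using cross(2)[OF that(2,1)] that(3) adj_sym[of u w] 3 by blast
    qed (use dis cross 3 last len in blast)+
    then show ?thesis by (simp add: Un_ac)
  qed
qed

section \<open>Solids through three neighbours of a vertex\<close>

text \<open>The path \<open>P\<close> joins \<open>x\<close> to \<open>y\<close>, and \<open>z # Q\<close> leads from \<open>z\<close> to a vertex \<open>t\<close> with neighbours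
  on \<open>P\<close>. Only the first neighbour \<open>p\<close> and the last neighbour \<open>q\<close> of \<open>t\<close> on \<open>P\<close> matter: the part
  \<open>M\<close> between them can be dropped, except when \<open>t = z\<close> is itself the hub of a pyramid.\<close>

lemma solid_two_paths:
  assumes a: "adj a x" "adj a y" "adj a z" and dist: "distinct [x, y, z]"
    and one: "adj x y \<Longrightarrow> \<not> adj x z \<and> \<not> adj y z" "\<not> (adj x z \<and> adj y z)"
    and P: "ipath P" "P \<noteq> []" "a \<notin> set P" "x \<notin> set P" "y \<notin> set P" "\<And>p. p \<in> set P \<Longrightarrow> \<not> adj a p"
      "\<And>p. p \<in> set P \<Longrightarrow> adj x p \<longleftrightarrow> p = hd P" "\<And>p. p \<in> set P \<Longrightarrow> adj y p \<longleftrightarrow> p = last P"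
    and Z: "ipath (z # Q)" "a \<notin> set Q" "x \<notin> set Q" "y \<notin> set Q" "set (z # Q) \<inter> set P = {}"
      "\<And>q. q \<in> set Q \<Longrightarrow> \<not> adj a q \<and> \<not> adj x q \<and> \<not> adj y q"
      "\<And>q. q \<in> set (z # Q) \<Longrightarrow> (\<exists>p\<in>set P. adj q p) \<longleftrightarrow> q = last (z # Q)"
  shows "\<exists>X. solid X \<and> {a, x, y, z} \<subseteq> X \<and> X \<subseteq> {a, x, y, z} \<union> set P \<union> set Q"
proof -
  have ane: "a \<noteq> x" "a \<noteq> y" "a \<noteq> z" using a by auto
  have dne: "x \<noteq> y" "x \<noteq> z" "y \<noteq> z" using dist by auto
  have dQP: "q \<notin> set P" if "q \<in> set Q" for q using Z(5) that by auto
  have zP: "z \<notin> set P" "z \<notin> set Q" using Z(1,5) by auto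
  define t where "t = last (z # Q)"
  have tZ: "t \<in> set (z # Q)" unfolding t_def by (rule last_in_set) simp
  have tP: "t \<notin> set P" using tZ Z(5) by blast
  have onlyt: "q = t" if "q \<in> set (z # Q)" "p \<in> set P" "adj p q" for p q
    using Z(7)[OF that(1)] that(2,3) adj_sym[of p q] unfolding t_def by blast
  have pre: "ipath (a # x # A)" if "P = A @ B" "A \<noteq> []" for A B
  proof -
    have "ipath A" "hd A = hd P" "set A \<subseteq> set P" using that P(1) by (auto simp: ipath_append)
    then show ?thesis using P(3-7) a ane by auto
  qed
  have suf: "ipath (a # y # rev B)" if "P = A @ B" "B \<noteq> []" for A B
  proof -
    have "ipath B" "hd (rev B) = last P" "set B \<subseteq> set P" using that P(1) by (auto simp: ipath_append hd_rev)
    then show ?thesis using P(3-8) a ane by auto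
  qed
  have xsuf: "\<not> adj x p" if "P = A @ B" "A \<noteq> []" "p \<in> set B" for A B p
  proof -
    have "hd A \<in> set A" "hd P = hd A" "set A \<inter> set B = {}"
      using that ipath_distinct[OF P(1)] by auto
    then have "p \<noteq> hd P" "p \<in> set P" using that by (metis disjoint_iff, simp)
    then show ?thesis using P(7)[of p] by simp
  qed
  have ypre: "\<not> adj p y" if "P = A @ B" "B \<noteq> []" "p \<in> set A" for A B p
  proof -
    have "last B \<in> set B" "last P = last B" "set A \<inter> set B = {}"
      using that ipath_distinct[OF P(1)] by auto
    then have "p \<noteq> last P" "p \<in> set P" using that by (metis disjoint_iff, simp)
    then show ?thesis using P(8)[of p] adj_sym[of p y] by simp
  qed
  have gap: "\<not> adj u w" if "P = A @ B @ C" "B \<noteq> []" "u \<in> set A" "w \<in> set C" for A B C u w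
  proof -
    have "hd (B @ C) \<in> set B" using that by simp
    moreover have "set B \<inter> set C = {}" using P(1) that by (auto simp: ipath_append)
    moreover have "adj u w \<longrightarrow> w = hd (B @ C)" using P(1) that by (simp add: ipath_append)
    ultimately show ?thesis using that by blast
  qed
  have aZ: "ipath (a # z # Q)" using Z(1,2,6) a ane by auto
  have xZ: "w = z" if "w \<in> set (z # Q)" "adj x w" for w using that Z(6) by auto
  have yZ: "w = z" if "w \<in> set (z # Q)" "adj y w" for w using that Z(6) by auto
  have "\<exists>p\<in>set P. adj t p" using Z(7)[OF tZ] unfolding t_def by blast
  then obtain U p R where U: "P = U @ p # R" "adj t p" "\<forall>q\<in>set U. \<not> adj t q"
    using split_list_first_prop[of P "adj t"] by blast
  have Ut: "\<not> adj u w" if "u \<in> set U" "w \<in> set (z # Q)" for u w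
    using onlyt[of w u] that U adj_sym[of u w] by auto
  show ?thesis
  proof (cases "\<forall>q\<in>set R. \<not> adj t q")
    case True
    have Rt: "\<not> adj u w" if "u \<in> set R" "w \<in> set (z # Q)" for u w
      using onlyt[of w u] that U True adj_sym[of u w] by auto
    have pP: "p \<in> set P" using U by simp
    have "adj u p \<longleftrightarrow> u = t" if "u \<in> set (z # Q)" for u
      using onlyt[OF that pP] U(2) adj_sym[of p u] by blast
    then have "ipath ((z # Q) @ [p])"
      unfolding ipath_append t_def using Z(1,5) pP by auto
    then have ip3: "ipath (a # (z # Q) @ [p])" using P(3) P(6)[OF pP] pP aZ by auto
    \<comment> \<open>Here \<open>p\<close> is the only neighbour of \<open>t\<close> on
      \<open>P\<close>, so the three legs from \<open>a\<close> meet in \<open>p\<close>.\<close>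
    let ?X = "insert a (insert p (set (x # U) \<union> set (y # rev R) \<union> set (z # Q)))"
    have "solid ?X"
    proof (rule solid_spider)
      show "ipath (a # (x # U) @ [p])" using pre[of "U @ [p]" R] U(1) by simp
      show "ipath (a # (y # rev R) @ [p])" using suf[of U "p # R"] U(1) by simp
      show "ipath (a # (z # Q) @ [p])" by (fact ip3)
      show "set (x # U) \<inter> set (y # rev R) = {}" "set (x # U) \<inter> set (z # Q) = {}"
        "set (y # rev R) \<inter> set (z # Q) = {}"
        using dne P(4,5) Z(3,4,5) U(1) ipath_distinct[OF P(1)] by auto
      show "u = hd (x # U) \<and> w = hd (y # rev R)"
        if "u \<in> set (x # U)" "w \<in> set (y # rev R)" "adj u w" for u w
        using that xsuf[of "U @ [p]" R w] ypre[of U "p # R" u] gap[of U "[p]" R u w] U(1) by auto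
      show "u = hd (x # U) \<and> w = hd (z # Q)"
        if "u \<in> set (x # U)" "w \<in> set (z # Q)" "adj u w" for u w
        using that xZ Ut by auto
      show "u = hd (y # rev R) \<and> w = hd (z # Q)"
        if "u \<in> set (y # rev R)" "w \<in> set (z # Q)" "adj u w" for u w
        using that yZ Rt by auto
    qed (use one in simp_all)
    then show ?thesis by (intro exI[of _ ?X]) (use U in auto)
  next
    case False
    then obtain M q W where W: "R = M @ q # W" "adj t q" "\<forall>w\<in>set W. \<not> adj t w"
      using split_list_last_prop[of R "adj t"] by blast
    have PU: "P = U @ p # M @ q # W" using U W by simp
    have pq: "p \<noteq> q" "p \<in> set P" "q \<in> set P" using ipath_distinct[OF P(1)] PU by auto
    have Wt: "\<not> adj u w" if "u \<in> set W" "w \<in> set (z # Q)" for u w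
      using onlyt[of w u] that PU W adj_sym[of u w] by auto
    \<comment> \<open>In \<open>hub\<close>, \<open>z\<close> sees \<open>a\<close>,
      \<open>p\<close> and \<open>q\<close> on the induced cycle through \<open>a\<close>,
      \<open>x\<close>, \<open>P\<close>, \<open>y\<close>. In \<open>tri\<close>, the legs end in
      the triangle \<open>p\<close>, \<open>q\<close>, \<open>t\<close>. In \<open>spider\<close>,
      they meet in \<open>t\<close>. In \<open>wheel\<close>, the edge between \<open>x\<close> and
      \<open>y\<close> allows a rim that avoids \<open>a\<close>.\<close>
    consider (hub) "Q = []" "\<not> adj x y" | (tri) "M = []" "Q \<noteq> [] \<or> adj x y"
      | (spider) "M \<noteq> []" "Q \<noteq> []" | (wheel) "M \<noteq> []" "Q = []" "adj x y"
      by blast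
    then show ?thesis
    proof cases
      case hub
      have "ipath (x # P @ [y])"
      proof -
        have "adj u y \<longleftrightarrow> u = last P" if "u \<in> set P" for u
          using P(8)[OF that] adj_sym[of u y] by simp
        then have "ipath (P @ [y])" using P(1,5) by (auto simp: ipath_append)
        moreover have "adj x w \<longleftrightarrow> w = hd P" if "w \<in> set (P @ [y])" for w
          using P(2,5,7) that hub(2) by auto
        ultimately show ?thesis using P(2,4) dne by simp
      qed
      then have "cyc (insert a (set (x # P @ [y])))"
        by (rule cyc_insertI) (use P(3,6) a ane in auto)
      moreover have "z \<notin> insert a (set (x # P @ [y]))" using ane dne zP by auto
      moreover have "card {a, p, q} \<le> card {w \<in> insert a (set (x # P @ [y])). adj z w}"
        using hub(1) U W a pq adj_sym[of z a] by (intro card_mono) (auto simp: t_def)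
      moreover have "a \<noteq> p" "a \<noteq> q" using pq P(3) by auto
      then have "card {a, p, q} = 3" using pq(1) by simp
      ultimately have "3 \<le> card {w \<in> insert a (set (x # P @ [y])). adj z w}"
        "cyc (insert a (set (x # P @ [y])))" "z \<notin> insert a (set (x # P @ [y]))"
        by simp_all
      then have "solid (insert z (insert a (set (x # P @ [y]))))" by (metis solid_pyramid)
      then show ?thesis by (intro exI[of _ "insert z (insert a (set (x # P @ [y])))"]) auto
    next
      case tri
      let ?X = "insert a (set (x # U @ [p]) \<union> set (y # rev (q # W)) \<union> set (z # Q))"
      have PU': "P = (U @ [p]) @ q # W" using PU tri by simp
      have adjpq: "adj u w \<longleftrightarrow> u = p \<and> w = q" if "u \<in> set (U @ [p])" "w \<in> set (q # W)" for u w
      proof -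
        have "ipath ((U @ [p]) @ q # W)" using P(1) PU' by simp
        from iffD1[OF ipath_append this]
        have "adj u w \<longleftrightarrow> u = last (U @ [p]) \<and> w = hd (q # W)" using that by blast
        then show ?thesis by simp
      qed
      have lst: "last (x # U @ [p]) = p" "last (y # rev (q # W)) = q" by simp_all
      have "solid ?X"
      proof (rule solid_trispider)
        show "ipath (a # x # U @ [p])" using pre[OF PU'] by simp
        show "ipath (a # y # rev (q # W))" using suf[OF PU'] by simp
        show "set (x # U @ [p]) \<inter> set (y # rev (q # W)) = {}" "set (x # U @ [p]) \<inter> set (z # Q) = {}"
          "set (y # rev (q # W)) \<inter> set (z # Q) = {}"
          using dne P(4,5) Z(3,4,5) PU' ipath_distinct[OF P(1)] by auto
        show "u = hd (x # U @ [p]) \<and> w = hd (y # rev (q # W)) \<or>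
          u = last (x # U @ [p]) \<and> w = last (y # rev (q # W))"
          if "u \<in> set (x # U @ [p])" "w \<in> set (y # rev (q # W))" "adj u w" for u w
          using that xsuf[OF PU', of w] ypre[OF PU', of u] adjpq[of u w] by auto
        show "u = hd (x # U @ [p]) \<and> w = hd (z # Q) \<or> u = last (x # U @ [p]) \<and> w = last (z # Q)"
          if "u \<in> set (x # U @ [p])" "w \<in> set (z # Q)" "adj u w" for u w
          using that xZ[of w] Ut[of u w] onlyt[of w u] pq unfolding lst t_def[symmetric] by auto
        show "u = hd (y # rev (q # W)) \<and> w = hd (z # Q) \<or> u = last (y # rev (q # W)) \<and> w = last (z # Q)"
          if "u \<in> set (y # rev (q # W))" "w \<in> set (z # Q)" "adj u w" for u w
          using that yZ[of w] Wt[of u w] onlyt[of w u] pq unfolding lst t_def[symmetric] by auto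
        show "adj (last (x # U @ [p])) (last (y # rev (q # W)))" using adjpq by simp
        show "adj (last (x # U @ [p])) (last (z # Q))" "adj (last (y # rev (q # W))) (last (z # Q))"
          using U(2) W(2) adj_sym[of t p] adj_sym[of t q] by (simp_all add: t_def)
        show "hd (x # U @ [p]) \<noteq> last (x # U @ [p])" "hd (y # rev (q # W)) \<noteq> last (y # rev (q # W))"
          using P(4,5) pq by auto
        \<comment> \<open>If \<open>z\<close> alone is the third leg, \<open>hub\<close> being
          excluded makes \<open>x\<close> and \<open>y\<close> adjacent, and by \<open>one\<close>
          neither of them is adjacent to \<open>z\<close>.\<close>
        show "hd (z # Q) \<noteq> last (z # Q) \<or> \<not> adj (hd (x # U @ [p])) (hd (z # Q)) \<and>
          \<not> adj (hd (y # rev (q # W))) (hd (z # Q))"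
          using tri(2) one zP last_in_set[of Q] by auto
      qed (use one aZ in simp_all)
      then show ?thesis by (intro exI[of _ ?X]) (use PU in auto)
    next
      case spider
      \<comment> \<open>\<open>t\<close> is now the second centre, so it is removed from the third
        leg.\<close>
      define Z' where "Z' = butlast Q"
      have Q: "Q = Z' @ [t]" using spider by (simp add: Z'_def t_def)
      have tQ: "t \<in> set Q" "t \<noteq> z" "t \<notin> set Z'" using Q zP ipath_distinct[OF Z(1)] by auto
      let ?X = "insert a (insert t (set (x # U @ [p]) \<union> set (y # rev (q # W)) \<union> set (z # Z')))"
      have at: "a \<noteq> t" "x \<noteq> t" "y \<noteq> t" "\<not> adj a t" "\<not> adj x t" "\<not> adj y t"
        using tQ Z(2,3,4,6) by auto
      have P1: "P = (U @ [p]) @ M @ q # W" and P2: "P = (U @ p # M) @ q # W" using PU by auto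
      have "solid ?X"
      proof (rule solid_spider)
        have "ipath ((a # x # U @ [p]) @ [t])"
          unfolding ipath_append[of "a # x # U @ [p]"]
          using pre[OF P1] at U tP P1 Ut[of _ t] tZ adj_sym[of p t] by auto
        then show "ipath (a # (x # U @ [p]) @ [t])" by simp
        have "ipath ((a # y # rev (q # W)) @ [t])"
          unfolding ipath_append[of "a # y # rev (q # W)"]
          using suf[OF P2] at W tP P2 Wt[of _ t] tZ adj_sym[of q t] by auto
        then show "ipath (a # (y # rev (q # W)) @ [t])" by simp
        show "ipath (a # (z # Z') @ [t])" using aZ Q by simp
        show "set (x # U @ [p]) \<inter> set (y # rev (q # W)) = {}" "set (x # U @ [p]) \<inter> set (z # Z') = {}"
          "set (y # rev (q # W)) \<inter> set (z # Z') = {}"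
          using dne P(4,5) Z(3,4,5) PU ipath_distinct[OF P(1)] Q by auto
        show "u = hd (x # U @ [p]) \<and> w = hd (y # rev (q # W))"
          if "u \<in> set (x # U @ [p])" "w \<in> set (y # rev (q # W))" "adj u w" for u w
          using that xsuf[OF P2, of w] ypre[OF P1, of u] gap[OF P1 spider(1), of u w] by auto
        have zt: "w \<in> set (z # Q)" "w \<noteq> t" if "w \<in> set (z # Z')" for w using that Q tQ by auto
        show "u = hd (x # U @ [p]) \<and> w = hd (z # Z')"
          if "u \<in> set (x # U @ [p])" "w \<in> set (z # Z')" "adj u w" for u w
          using that xZ[of w] onlyt[of w u] zt[of w] P1 by auto
        show "u = hd (y # rev (q # W)) \<and> w = hd (z # Z')"
          if "u \<in> set (y # rev (q # W))" "w \<in> set (z # Z')" "adj u w" for u w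
          using that yZ[of w] onlyt[of w u] zt[of w] P2 by auto
      qed (use one in simp_all)
      then show ?thesis by (intro exI[of _ ?X]) (use PU Q in auto)
    next
      case wheel
      have zxy: "\<not> adj x z" "\<not> adj y z" "\<not> adj z x" "\<not> adj z y"
        using wheel one(1) adj_sym[of x z] adj_sym[of y z] by auto
      have tz: "t = z" using wheel by (simp add: t_def)
      have P1: "P = (U @ [p]) @ M @ q # W" and P2: "P = (U @ p # M) @ q # W" using PU by auto
      \<comment> \<open>Replacing \<open>M\<close> by \<open>z\<close> and closing up through
        \<open>y\<close> gives the rim; \<open>a\<close> is the apex and sees \<open>x\<close>,
        \<open>y\<close>, \<open>z\<close> on it.\<close>
      let ?S = "x # (U @ [p]) @ z # q # W"
      have gap': "\<not> adj u w" if "u \<in> set (U @ [p])" "w \<in> set (q # W)" for u w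
        using gap[OF P1 wheel(1) that] .
      have "ipath (q # W)" "ipath (U @ [p])" "set (U @ [p]) \<inter> set (q # W) = {}"
        using P(1) unfolding P1 ipath_append[of "U @ [p]"] ipath_append[of M] by auto
      note ip = this
      have zq: "adj z w \<longleftrightarrow> w = q" if "w \<in> set (q # W)" for w
        using that W(2,3) tz by auto
      have pz: "adj u z \<longleftrightarrow> u = p" if "u \<in> set (U @ [p])" for u
        using that U(2,3) tz adj_sym[of u z] by auto
      have zn: "z \<notin> set (q # W)" "z \<notin> set (U @ [p])" using zP(1) PU by auto
      have "ipath (z # q # W)" using ip(1) zq zn by simp
      moreover have "adj u w \<longleftrightarrow> u = last (U @ [p]) \<and> w = hd (z # q # W)"
        if "u \<in> set (U @ [p])" "w \<in> set (z # q # W)" for u w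
      proof (cases "w = z")
        case True
        then show ?thesis using pz[OF that(1)] by simp
      next
        case False
        then show ?thesis using gap'[OF that(1), of w] that(2) by simp
      qed
      ultimately have ipz: "ipath ((U @ [p]) @ z # q # W)"
        unfolding ipath_append[of "U @ [p]"] using ip zn by simp
      have hdx: "hd ((U @ [p]) @ z # q # W) = hd (U @ [p])" by (cases U) auto
      have "ipath (x # U @ [p])" using pre[OF P1] by simp
      from iffD1[OF ipath.simps(2) this]
      have xU: "adj x w \<longleftrightarrow> w = hd (U @ [p])" if "w \<in> set (U @ [p])" for w
        using that by blast
      have hdU: "hd (U @ [p]) \<in> set (U @ [p])" by (rule hd_in_set) simp
      have "adj x w \<longleftrightarrow> w = hd (U @ [p])" if w: "w \<in> set ((U @ [p]) @ z # q # W)" for w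
      proof -
        consider "w \<in> set (U @ [p])" | "w = z" | "w \<in> set (q # W)" using w by auto
        then show ?thesis
        proof cases
          case 1 then show ?thesis by (rule xU)
        next
          case 2 then show ?thesis using zxy(1) zn(2) hdU by metis
        next
          case 3
          then have "w \<noteq> hd (U @ [p])" using hdU ip(3) by (metis disjoint_iff)
          then show ?thesis using xsuf[OF P2 _ 3] by simp
        qed
      qed
      moreover have "x \<notin> set ((U @ [p]) @ z # q # W)" using P(4) PU dne by auto
      ultimately have ipS: "ipath ?S" using ipz hdx by simp
      have lastS: "last ?S = last P" unfolding P2 by simp
      have "cyc (insert y (set ?S))"
      proof (rule cyc_insertI[OF ipS])
        show "2 \<le> length ?S" by simp
        show "y \<notin> set ?S" using P(5) PU dne by auto
        fix w assume "w \<in> set ?S"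
        then consider "w = x" | "w \<in> set (U @ [p])" | "w = z" | "w \<in> set (q # W)" by auto
        then have "adj y w \<longleftrightarrow> w = x \<or> w = last P"
        proof cases
          case 1 then show ?thesis using wheel(3) adj_sym[of x y] by simp
        next
          case 2
          have "last P \<in> set (q # W)" unfolding P2 by simp
          then have "w \<noteq> last P" using 2 ip(3) by (metis disjoint_iff)
          moreover have "w \<noteq> x" using P(4) P1 2 by auto
          moreover have "\<not> adj y w" using ypre[OF P1 _ 2] adj_sym[of y w] by simp
          ultimately show ?thesis by simp
        next
          case 3 then show ?thesis using zxy(2) dne zP(1) last_in_set[OF P(2)] by metis
        next
          case 4
          then have "w \<in> set P" using PU by auto
          then show ?thesis using P(8)[of w] P(4) by auto
        qed
        then show "adj y w \<longleftrightarrow> w = hd ?S \<or> w = last ?S" unfolding lastS by simp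
      qed
      moreover have "a \<notin> insert y (set ?S)" using ane P(3) PU by auto
      moreover have "card {x, y, z} \<le> card {w \<in> insert y (set ?S). adj a w}"
        using a by (intro card_mono) auto
      moreover have "card {x, y, z} = 3" using dne by simp
      ultimately have "solid (insert a (insert y (set ?S)))" by (intro solid_pyramid) simp_all
      then show ?thesis by (intro exI[of _ "insert a (insert y (set ?S))"]) (use PU in auto)
    qed
  qed
qed

section \<open>Neighbours inside solids and induced cycles\<close>

lemma solid_degree:
  assumes "solid X" "v \<in> X"
  obtains p q where "p \<noteq> q" "p \<in> X" "q \<in> X" "adj v p" "adj v q"
proof -
  have "\<exists>p q. p \<noteq> q \<and> {v, p} \<in> ind X \<and> {v, q} \<in> ind X"
    using solid_graph_degree[of "(X, ind X)" v] assms by (simp add: solid_def)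
  then show ?thesis using that by (auto simp: ind_mem)
qed

lemma cyc_nonempty: "cyc X \<Longrightarrow> X \<noteq> {}"
  by (auto simp: cyc_def is_cycle_def cycle_graph_def)

lemma cyc_conn: "cyc X \<Longrightarrow> conn X"
proof -
  assume c: "cyc X"
  then obtain a where "a \<in> X" using cyc_nonempty by blast
  then obtain P where P: "ipath P" "2 \<le> length P" "X = insert a (set P)"
    "\<And>w. w \<in> set P \<Longrightarrow> adj a w \<longleftrightarrow> w = hd P \<or> w = last P"
    using cyc_rotate[OF c] by metis
  then have "hd P \<in> set P" by (intro hd_in_set) auto
  then show ?thesis using conn_insert[of "set P" "hd P" a] ipath_conn P by blast
qed

text \<open>Cut open at \<open>a\<close>, the cycle is an induced path from \<open>p\<close> to
  \<open>q\<close>. Its interior is a connected set attached to \<open>p\<close> and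
  \<open>q\<close> and away from \<open>a\<close>, of the kind \<open>solid_triple\<close> asks for;
  it is empty for a triangle, hence the implication.\<close>

lemma cyc_nbrs:
  assumes "cyc X" "a \<in> X"
  obtains p q where "p \<noteq> q" "{w \<in> X. adj a w} = {p, q}" "conn (X - {a, p, q})"
    "\<forall>k\<in>X - {a, p, q}. \<not> adj a k"
    "X - {a, p, q} \<noteq> {} \<longrightarrow> (\<exists>k \<in> X - {a, p, q}. adj p k) \<and> (\<exists>k \<in> X - {a, p, q}. adj q k)"
proof -
  obtain P where P: "ipath P" "2 \<le> length P" "a \<notin> set P" "X = insert a (set P)"
    "\<And>w. w \<in> set P \<Longrightarrow> adj a w \<longleftrightarrow> w = hd P \<or> w = last P"
    using cyc_rotate[OF assms] by metis
  obtain p R where "P = p # R" using P(2) by (cases P) auto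
  moreover then obtain M q where "R = M @ [q]" using P(2) by (cases R rule: rev_cases) auto
  ultimately have s: "P = p # M @ [q]" by simp
  have ip: "ipath M" "p \<noteq> q" "p \<notin> set M" "q \<notin> set M"
    using P(1) unfolding s by (auto simp: ipath_append)
  have X: "X - {a, p, q} = set M" using P(3,4) ip unfolding s by auto
  show ?thesis
  proof
    show "p \<noteq> q" by (fact ip)
    have Ps: "adj a w \<longleftrightarrow> w = p \<or> w = q" if "w \<in> set P" for w
      using P(5)[OF that] unfolding s by simp
    have pq: "p \<in> set P" "q \<in> set P" unfolding s by simp_all
    show "{w \<in> X. adj a w} = {p, q}"
      using Ps pq adj_irrefl[of a] unfolding P(4) by blast
    show "conn (X - {a, p, q})" unfolding X using ipath_conn ip by blast
    show "\<forall>k\<in>X - {a, p, q}. \<not> adj a k"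
      using Ps unfolding P(4) by blast
    show "X - {a, p, q} \<noteq> {} \<longrightarrow> (\<exists>k \<in> X - {a, p, q}. adj p k) \<and> (\<exists>k \<in> X - {a, p, q}. adj q k)"
    proof
      assume "X - {a, p, q} \<noteq> {}"
      then have "M \<noteq> []" unfolding X by simp
      then have "adj p (hd M)" "adj (last M) q" "hd M \<in> set M" "last M \<in> set M"
        using P(1) unfolding s by (auto simp: ipath_append)
      then show "(\<exists>k \<in> X - {a, p, q}. adj p k) \<and> (\<exists>k \<in> X - {a, p, q}. adj q k)"
        unfolding X using adj_sym[of q "last M"] by blast
    qed
  qed
qed

text \<open>A vertex of an induced cycle has only two neighbours on it. If both lie in
  \<open>Z\<close> for all vertices of \<open>Z\<close>, no edge leaves \<open>Z\<close>, and the
  cycle is connected.\<close>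

lemma cyc_eq_subset:
  assumes "cyc X" "Z \<subseteq> X" "Z \<noteq> {}"
    and deg: "\<And>z. z \<in> Z \<Longrightarrow> \<exists>p q. p \<noteq> q \<and> p \<in> Z \<and> q \<in> Z \<and> adj z p \<and> adj z q"
  shows "Z = X"
proof (rule ccontr)
  assume "Z \<noteq> X"
  then obtain u w where uw: "u \<in> Z" "w \<in> X - Z" "adj u w"
    using connD[OF cyc_conn[OF assms(1)] assms(2,3)] by blast
  then have "u \<in> X" using assms(2) by blast
  obtain p q where "{w \<in> X. adj u w} = {p, q}" by (rule cyc_nbrs[OF assms(1) \<open>u \<in> X\<close>])
  moreover obtain p' q' where "p' \<noteq> q'" "p' \<in> Z" "q' \<in> Z" "adj u p'" "adj u q'"
    using deg[OF uw(1)] by blast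
  ultimately have "p' \<in> {p, q}" "q' \<in> {p, q}" "w \<in> {p, q}" "p' \<noteq> q'" "w \<noteq> p'" "w \<noteq> q'"
    using uw assms(2) by blast+
  then show False by auto
qed

text \<open>In a smallest connected set attached to all three vertices, every non-cut vertex is the
  only neighbour of one of them; this is how \<open>u\<close> and \<open>w\<close> arise.\<close>

lemma solid_private:
  assumes K: "conn K" "K \<inter> {a, x, y, z} = {}" "\<And>k. k \<in> K \<Longrightarrow> \<not> adj a k"
    and a: "adj a x" "adj a y" "adj a z" and dist: "distinct [x, y, z]"
    and one: "adj x y \<Longrightarrow> \<not> adj x z \<and> \<not> adj y z" "\<not> (adj x z \<and> adj y z)"
    and x: "u \<in> K" "\<And>k. k \<in> K \<Longrightarrow> adj x k \<longleftrightarrow> k = u"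
    and y: "w \<in> K" "\<And>k. k \<in> K \<Longrightarrow> adj y k \<longleftrightarrow> k = w"
    and z: "k0 \<in> K" "adj z k0"
  shows "\<exists>X. solid X \<and> {a, x, y, z} \<subseteq> X \<and> X \<subseteq> {a, x, y, z} \<union> K"
proof -
  obtain P where P: "ipath P" "P \<noteq> []" "set P \<subseteq> K" "\<forall>v\<in>set P. v \<in> {u} \<longleftrightarrow> v = hd P"
    "\<forall>v\<in>set P. v \<in> {w} \<longleftrightarrow> v = last P"
    by (rule connected_ipath[OF K(1) x(1) _ y(1), of "{u}" "{w}"]) auto
  have hl: "hd P = u" "last P = w" using P(2,4,5) by auto
  let ?B = "{k. \<exists>p\<in>set P. adj k p}"
  have cz: "conn (insert z K)" using conn_insert[OF K(1) z] .
  \<comment> \<open>Since \<open>z\<close> is off \<open>P\<close>, connectivity yields some vertex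
    off \<open>P\<close> with a neighbour on \<open>P\<close>. It serves only to show that the
    target set \<open>?B\<close> is met; the path from \<open>z\<close> may end elsewhere.\<close>
  have "set P \<subseteq> insert z K" "set P \<noteq> {}" "set P \<noteq> insert z K" using P(2,3) K(2) by auto
  then obtain p t where pt: "p \<in> set P" "t \<in> insert z K - set P" "adj p t"
    using connD[OF cz] by blast
  have tB: "t \<in> ?B" using pt adj_sym[of p t] by blast
  obtain Z where Z: "ipath Z" "Z \<noteq> []" "set Z \<subseteq> insert z K" "\<forall>v\<in>set Z. v \<in> {z} \<longleftrightarrow> v = hd Z"
    "\<forall>v\<in>set Z. v \<in> ?B \<longleftrightarrow> v = last Z"
    by (rule connected_ipath[OF cz, of z "{z}" t ?B]) (use pt tB in auto)
  have "hd Z = z" using Z(2,4) by auto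
  then obtain Q where Q: "Z = z # Q" using Z(2) by (cases Z) auto
  have QK: "set Q \<subseteq> K" using Z(1,3) unfolding Q by auto
  \<comment> \<open>If \<open>Z\<close> entered \<open>P\<close>, the vertex before the entry would
    already have a neighbour on \<open>P\<close>, although only the last vertex of \<open>Z\<close>
    has one.\<close>
  have dis: "set (z # Q) \<inter> set P = {}"
  proof (rule ccontr)
    assume "set (z # Q) \<inter> set P \<noteq> {}"
    then obtain q where q: "q \<in> set Q" "q \<in> set P" using P(3) K(2) by auto
    then obtain A C where s: "Q = A @ q # C" using split_list by metis
    let ?r = "last (z # A)"
    have "ipath ((z # A) @ q # C)" using Z(1) unfolding Q s by simp
    from iffD1[OF ipath_append this]
    have cr: "\<forall>u\<in>set (z # A). \<forall>v\<in>set (q # C). adj u v \<longleftrightarrow> u = ?r \<and> v = hd (q # C)"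
      and "set (z # A) \<inter> set (q # C) = {}"
      by blast+
    have "?r \<in> set (z # A)" by (rule last_in_set) simp
    have "q \<in> set (q # C)" by simp
    with cr \<open>?r \<in> set (z # A)\<close> have "adj ?r q" by (metis list.sel(1))
    have "?r \<in> ?B" using \<open>adj ?r q\<close> q(2) by blast
    moreover have "?r \<in> set Z" using \<open>?r \<in> set (z # A)\<close> unfolding Q s set_append list.set(2) by blast
    ultimately have "?r = last Z" using Z(5) by blast
    moreover have "last Z \<in> set (q # C)" unfolding Q s by simp
    ultimately show False
      using \<open>?r \<in> set (z # A)\<close> \<open>set (z # A) \<inter> set (q # C) = {}\<close> by (metis disjoint_iff)
  qed
  have "\<exists>X. solid X \<and> {a, x, y, z} \<subseteq> X \<and> X \<subseteq> {a, x, y, z} \<union> set P \<union> set Q"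
  proof (rule solid_two_paths[OF a dist one P(1,2)])
    show "a \<notin> set P" "x \<notin> set P" "y \<notin> set P" using P(3) K(2) by auto
    show "\<not> adj a p" if "p \<in> set P" for p using K(3) P(3) that by blast
    show "adj x p \<longleftrightarrow> p = hd P" if "p \<in> set P" for p using x(2)[of p] P(3) that hl by auto
    show "adj y p \<longleftrightarrow> p = last P" if "p \<in> set P" for p using y(2)[of p] P(3) that hl by auto
    show "ipath (z # Q)" using Z(1) Q by simp
    show "a \<notin> set Q" "x \<notin> set Q" "y \<notin> set Q" using QK K(2) by auto
    show "set (z # Q) \<inter> set P = {}" by (fact dis)
    show "\<not> adj a q \<and> \<not> adj x q \<and> \<not> adj y q" if "q \<in> set Q" for q
    proof -
      have "q \<in> K" "q \<noteq> u" "q \<noteq> w" using that QK dis hl P(2) hd_in_set[of P] last_in_set[of P] by auto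
      then show ?thesis using K(3) x(2) y(2) by blast
    qed
    show "(\<exists>p\<in>set P. adj q p) \<longleftrightarrow> q = last (z # Q)" if "q \<in> set (z # Q)" for q
      using Z(5) that unfolding Q by blast
  qed
  then obtain X where "solid X" "{a, x, y, z} \<subseteq> X" "X \<subseteq> {a, x, y, z} \<union> set P \<union> set Q" by blast
  then show ?thesis using P(3) QK by (intro exI[of _ X]) blast
qed

text \<open>\<open>a\<close>, \<open>x\<close> and \<open>z\<close> are neighbours of
  \<open>y\<close>, so every induced cycle through these three that avoids \<open>y\<close> is the
  rim of a pyramid with apex \<open>y\<close>. The cycle is a triangle, or an induced path from
  \<open>x\<close> through \<open>K\<close> to \<open>z\<close> closed by \<open>a\<close>.\<close>

lemma solid_hub:
  assumes K: "conn K" "K \<inter> {a, x, y, z} = {}" "\<And>k. k \<in> K \<Longrightarrow> \<not> adj a k"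
    and a: "adj a x" "adj a y" "adj a z" and dist: "distinct [x, y, z]"
    and y: "adj y x" "adj y z"
    and xz: "adj x z \<or> (\<exists>k\<in>K. adj x k) \<and> (\<exists>k\<in>K. adj z k)"
  shows "\<exists>X. solid X \<and> {a, x, y, z} \<subseteq> X \<and> X \<subseteq> {a, x, y, z} \<union> K"
proof -
  have ane: "a \<noteq> x" "a \<noteq> z" "a \<noteq> y" using a by auto
  obtain C where C: "cyc C" "{a, x, z} \<subseteq> C" "C \<subseteq> {a, x, z} \<union> K"
  proof (cases "adj x z")
    case True
    have "cyc (insert a (set [x, z]))"
      by (rule cyc_insertI) (use True a ane dist in auto)
    then show ?thesis by (intro that[of "insert a (set [x, z])"]) auto
  next
    case False
    then obtain k k' where k: "k \<in> K" "adj x k" "k' \<in> K" "adj z k'" using xz by blast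
    obtain P where P: "ipath P" "P \<noteq> []" "set P \<subseteq> K"
      "\<forall>v\<in>set P. v \<in> {v. adj x v} \<longleftrightarrow> v = hd P" "\<forall>v\<in>set P. v \<in> {v. adj z v} \<longleftrightarrow> v = last P"
      by (rule connected_ipath[OF K(1) k(1) _ k(3), of "{v. adj x v}" "{v. adj z v}"]) (use k in auto)
    have "adj u z \<longleftrightarrow> u = last P" if "u \<in> set P" for u
      using P(5) that adj_sym[of u z] by blast
    then have "ipath (P @ [z])" using P(1,3) K(2) by (auto simp: ipath_append)
    moreover have "adj x w \<longleftrightarrow> w = hd P" if "w \<in> set (P @ [z])" for w
    proof (cases "w = z")
      case True
      have "z \<noteq> hd P" using hd_in_set[OF P(2)] P(3) K(2) by blast
      then show ?thesis using True False by simp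
    next
      case F: False
      then show ?thesis using that P(4) by simp
    qed
    ultimately have "ipath (x # P @ [z])" using P(2,3) K(2) dist by auto
    then have "cyc (insert a (set (x # P @ [z])))"
    proof (rule cyc_insertI)
      show "a \<notin> set (x # P @ [z])" using ane P(3) K(2) by auto
      show "adj a w \<longleftrightarrow> w = hd (x # P @ [z]) \<or> w = last (x # P @ [z])" if "w \<in> set (x # P @ [z])" for w
        using that K(3)[of w] P(3) a K(2) by auto
    qed simp
    then show ?thesis using P(3) by (intro that[of "insert a (set (x # P @ [z]))"]) auto
  qed
  have "finite C" using C(1) unfolding cyc_def is_cycle_def cycle_graph_def by auto
  moreover have "{a, x, z} \<subseteq> {w \<in> C. adj y w}" using C(2) y a(2) adj_sym[of y a] by auto
  ultimately have "card {a, x, z} \<le> card {w \<in> C. adj y w}" by (intro card_mono) auto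
  moreover have "card {a, x, z} = 3" using ane dist by auto
  ultimately have c3: "3 \<le> card {w \<in> C. adj y w}" by linarith
  have "y \<notin> C" using C(3) K(2) ane dist by auto
  then have "solid (insert y C)" using c3 by (rule solid_pyramid[OF C(1)])
  moreover have "{a, x, y, z} \<subseteq> insert y C" "insert y C \<subseteq> {a, x, y, z} \<union> K" using C(2,3) by blast+
  ultimately show ?thesis by blast
qed

text \<open>If one of the three is adjacent to both others, it becomes the apex in
  \<open>solid_hub\<close>. Otherwise at most one edge joins them, the second alternative in
  \<open>att\<close> is impossible, all three are attached to \<open>K\<close>, and a smallest
  attached subset leads to \<open>solid_private\<close>.\<close>

lemma solid_triple:
  assumes K: "conn K" "finite K" "K \<inter> {a, x, y, z} = {}" "\<And>k. k \<in> K \<Longrightarrow> \<not> adj a k"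
    and a: "adj a x" "adj a y" "adj a z" and dist: "distinct [x, y, z]"
    and att: "\<And>s. s \<in> {x, y, z} \<Longrightarrow> (\<exists>k\<in>K. adj s k) \<or> (\<forall>s'\<in>{x, y, z} - {s}. adj s s')"
  shows "\<exists>X. solid X \<and> {a, x, y, z} \<subseteq> X \<and> X \<subseteq> {a, x, y, z} \<union> K"
proof (cases "\<exists>r s t. {r, s, t} = {x, y, z} \<and> distinct [r, s, t] \<and> adj s r \<and> adj s t")
  case True
  then obtain r s t where rst: "{r, s, t} = {x, y, z}" "distinct [r, s, t]" "adj s r" "adj s t" by blast
  have aT: "adj a v" if "v \<in> {x, y, z}" for v using that a by auto
  have "r \<in> {x, y, z}" "s \<in> {x, y, z}" "t \<in> {x, y, z}" using rst(1) by blast+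
  then have "adj a r" "adj a s" "adj a t" using aT by blast+
  moreover have "K \<inter> {a, r, s, t} = {}" using K(3) rst(1) by blast
  \<comment> \<open>If \<open>r\<close> and \<open>t\<close> are not adjacent, neither is adjacent
    to both others, so \<open>att\<close> attaches both to \<open>K\<close>.\<close>
  moreover have "adj r t \<or> (\<exists>k\<in>K. adj r k) \<and> (\<exists>k\<in>K. adj t k)"
  proof (rule ccontr)
    assume n: "\<not> ?thesis"
    have "r \<in> {x, y, z}" "t \<in> {x, y, z}" "t \<in> {x, y, z} - {r}" "r \<in> {x, y, z} - {t}"
      using rst(1,2) by auto
    then show False using att[of r] att[of t] n adj_sym[of r t] by blast
  qed
  ultimately have "\<exists>X. solid X \<and> {a, r, s, t} \<subseteq> X \<and> X \<subseteq> {a, r, s, t} \<union> K"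
    by (intro solid_hub[of K a r s t] K(1,4) rst(2-4))
  then show ?thesis using rst(1) by simp
next
  case False
  let ?T = "{x, y, z}"
  have nbr: "\<not> (adj s r \<and> adj s t)" if "{r, s, t} = ?T" "distinct [r, s, t]" for r s t
    using False that by blast
  define Att where "Att L \<longleftrightarrow> conn L \<and> L \<subseteq> K \<and> (\<forall>s\<in>?T. \<exists>k\<in>L. adj s k)" for L
  have "Att K"
    unfolding Att_def
  proof (intro conjI ballI)
    fix s assume s: "s \<in> ?T"
    show "\<exists>k\<in>K. adj s k"
    proof (rule ccontr)
      assume "\<not> ?thesis"
      then have all: "\<forall>s'\<in>?T - {s}. adj s s'" using att[OF s] by blast
      have "\<exists>r\<in>?T. r \<noteq> s" using dist by auto
      then obtain r where r: "r \<in> ?T" "r \<noteq> s" by blast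
      obtain t where t: "{r, s, t} = ?T" "distinct [r, s, t]" by (rule third_element[OF dist r(1) s r(2)])
      then have "r \<in> ?T - {s}" "t \<in> ?T - {s}" by auto
      then show False using nbr[OF t] all by blast
    qed
  qed (use K in auto)
  then have "\<exists>L. Att L \<and> (\<forall>L'. Att L' \<longrightarrow> card L \<le> card L')"
    by (rule ex_has_least_nat)
  then obtain L where L: "Att L" "\<And>L'. Att L' \<Longrightarrow> card L \<le> card L'" by blast
  have LK: "conn L" "L \<subseteq> K" "finite L" "\<And>s. s \<in> ?T \<Longrightarrow> \<exists>k\<in>L. adj s k"
    using L(1) K(2) finite_subset unfolding Att_def by auto
  have priv: "\<exists>s\<in>?T. \<forall>k\<in>L. adj s k \<longleftrightarrow> k = u" if u: "u \<in> L" "conn (L - {u})" for u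
  proof -
    have "card (L - {u}) < card L" using LK(3) u(1) by (rule card_Diff1_less)
    then have "\<not> Att (L - {u})" using L(2)[of "L - {u}"] by linarith
    then obtain s where s: "s \<in> ?T" "\<not> (\<exists>k\<in>L - {u}. adj s k)" using u LK(2) unfolding Att_def by blast
    then have "\<forall>k\<in>L. adj s k \<longleftrightarrow> k = u" using LK(4)[OF s(1)] by blast
    then show ?thesis using s(1) by blast
  qed
  have "\<exists>s s' u w. s \<in> ?T \<and> s' \<in> ?T \<and> s \<noteq> s' \<and> u \<in> L \<and> w \<in> L \<and>
    (\<forall>k\<in>L. adj s k \<longleftrightarrow> k = u) \<and> (\<forall>k\<in>L. adj s' k \<longleftrightarrow> k = w)"
  proof -
    obtain u0 where u0: "u0 \<in> L" using LK(4)[of x] by blast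
    show ?thesis
    proof (cases "L = {u0}")
      \<comment> \<open>A singleton has just one non-cut vertex, but then all three vertices are
        attached to it and \<open>u = w\<close> is admissible.\<close>
      case True
      have xy: "\<forall>k\<in>L. adj x k \<longleftrightarrow> k = u0" "\<forall>k\<in>L. adj y k \<longleftrightarrow> k = u0"
        using LK(4)[of x] LK(4)[of y] unfolding True by simp_all
      have T: "x \<in> ?T" "y \<in> ?T" "x \<noteq> y" using dist by simp_all
      show ?thesis
        by (rule exI[of _ x], rule exI[of _ y], rule exI[of _ u0], rule exI[of _ u0])
          (intro conjI xy T u0)
    next
      case F: False
      obtain u where u: "u \<in> L" "u \<noteq> u0" "conn (L - {u})" by (rule exists_noncut[OF LK(1,3) u0 F])
      have "L \<noteq> {u}" using u0 u by blast
      obtain w where w: "w \<in> L" "w \<noteq> u" "conn (L - {w})"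
        by (rule exists_noncut[OF LK(1,3) u(1) \<open>L \<noteq> {u}\<close>])
      obtain s where s: "s \<in> ?T" "\<forall>k\<in>L. adj s k \<longleftrightarrow> k = u" using priv[OF u(1,3)] by blast
      obtain s' where s': "s' \<in> ?T" "\<forall>k\<in>L. adj s' k \<longleftrightarrow> k = w" using priv[OF w(1,3)] by blast
      have ss: "s \<noteq> s'" using bspec[OF s(2) u(1)] bspec[OF s'(2) u(1)] w(2) by auto
      show ?thesis
        by (rule exI[of _ s], rule exI[of _ s'], rule exI[of _ u], rule exI[of _ w])
          (intro conjI ss s s' u(1) w(1))
    qed
  qed
  then obtain r s u w where rs: "r \<in> ?T" "s \<in> ?T" "r \<noteq> s" "u \<in> L" "w \<in> L"
    "\<forall>k\<in>L. adj r k \<longleftrightarrow> k = u" "\<forall>k\<in>L. adj s k \<longleftrightarrow> k = w" by blast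
  obtain t where t: "{r, s, t} = ?T" "distinct [r, s, t]" by (rule third_element[OF dist rs(1-3)])
  have tT: "t \<in> ?T" using t(1) by blast
  obtain k0 where k0: "k0 \<in> L" "adj t k0" using LK(4)[OF tT] by blast
  have aa: "adj a r" "adj a s" "adj a t" using a rs(1,2) tT by blast+
  have "\<exists>X. solid X \<and> {a, r, s, t} \<subseteq> X \<and> X \<subseteq> {a, r, s, t} \<union> L"
  proof (rule solid_private[OF LK(1) _ _ aa t(2)])
    show "L \<inter> {a, r, s, t} = {}" using LK(2) K(3) t(1) by blast
    show "\<not> adj a k" if "k \<in> L" for k using that LK(2) K(4) by blast
    have perm: "{s, r, t} = ?T" "{r, t, s} = ?T" using t(1) by auto
    show "\<not> adj r t \<and> \<not> adj s t" if "adj r s"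
      using that nbr[OF perm(1)] nbr[OF t(1)] t(2) adj_sym[of r s] by auto
    show "\<not> (adj r t \<and> adj s t)"
      using nbr[OF perm(2)] t(2) adj_sym[of r t] adj_sym[of s t] by auto
  qed (use rs k0 in auto)
  then obtain X where "solid X" "{a, r, s, t} \<subseteq> X" "X \<subseteq> {a, r, s, t} \<union> L" by blast
  then show ?thesis using LK(2) t(1) by (intro exI[of _ X]) blast
qed

section \<open>Avoidable vertices\<close>

text \<open>The set \<open>K\<close> joins any two nonadjacent neighbours of \<open>v\<close>
  outside the closed neighbourhood of \<open>v\<close>, and one \<open>K\<close> serves all pairs,
  so that it can be used for triples. With empty \<open>K\<close> the condition says that
  \<open>v\<close> is simplicial.\<close>

definition avoidable :: "'a set \<Rightarrow> 'a \<Rightarrow> bool" where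
  "avoidable W v \<longleftrightarrow> (\<exists>K. conn K \<and> K \<subseteq> W - {v} \<and> (\<forall>k\<in>K. \<not> adj v k) \<and>
    (\<forall>s\<in>W. adj v s \<longrightarrow> (\<exists>k\<in>K. adj s k) \<or> (\<forall>s'\<in>W. adj v s' \<and> s' \<noteq> s \<longrightarrow> adj s s')))"

text \<open>If \<open>K\<close> is a maximal connected set whose closed neighbourhood is not everything, then its
  boundary is complete to the set of remaining vertices, since a boundary vertex missing one of
  them could be added to \<open>K\<close>. An avoidable vertex of the remainder is then avoidable in the
  whole graph.\<close>

lemma exists_avoidable:
  assumes "finite W" "W \<noteq> {}"
  shows "\<exists>v\<in>W. avoidable W v"
  using assms
proof (induction W rule: finite_psubset_induct)
  case (psubset W)
  define rest where "rest K = {w \<in> W - K. \<forall>k\<in>K. \<not> adj w k}" for K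
  let ?F = "{K. conn K \<and> K \<noteq> {} \<and> K \<subseteq> W \<and> rest K \<noteq> {}}"
  show ?case
  proof (cases "?F = {}")
    case True
    \<comment> \<open>No singleton leaves a remainder, so the graph is complete and the empty set is
      a witness for every vertex.\<close>
    have all: "adj s s'" if "s \<in> W" "s' \<in> W" "s' \<noteq> s" for s s'
    proof (rule ccontr)
      assume "\<not> adj s s'"
      then have "s' \<in> rest {s}" using that adj_sym[of s s'] unfolding rest_def by simp
      then have "{s} \<in> ?F" using that by auto
      then show False using True by blast
    qed
    obtain v where "v \<in> W" using psubset.prems by blast
    then show ?thesis
      unfolding avoidable_def using all by (intro bexI[of _ v] exI[of _ "{}"]) auto
  next
    case False
    have "finite ?F" by (rule finite_subset[of _ "Pow W"]) (use psubset.hyps in auto)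
    then have "\<exists>K\<in>?F. \<forall>K'\<in>?F. K \<subseteq> K' \<longrightarrow> K = K'"
      using False by (rule finite_has_maximal)
    then obtain K where KF: "K \<in> ?F" and maxF: "\<forall>K'\<in>?F. K \<subseteq> K' \<longrightarrow> K = K'" by (rule bexE)
    have max: "K = K'" if "K' \<in> ?F" "K \<subseteq> K'" for K' using bspec[OF maxF that(1)] that(2) by (rule mp)
    have K: "conn K" "K \<noteq> {}" "K \<subseteq> W" "rest K \<noteq> {}" using KF by simp_all
    define D where "D = rest K"
    have D: "D \<subseteq> W" "D \<inter> K = {}" "\<And>w k. w \<in> D \<Longrightarrow> k \<in> K \<Longrightarrow> \<not> adj w k"
      unfolding D_def rest_def by auto
    have att: "\<exists>k\<in>K. adj s k" if "s \<in> W" "s \<notin> K" "s \<notin> D" for s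
      using that unfolding D_def rest_def by blast
    have full: "adj s d" if s: "s \<in> W" "s \<notin> K" "s \<notin> D" and d: "d \<in> D" for s d
    proof (rule ccontr)
      assume n: "\<not> adj s d"
      obtain k where "k \<in> K" "adj s k" using att[OF s] by blast
      then have "conn (insert s K)" using conn_insert[OF K(1)] by blast
      moreover have "d \<in> rest (insert s K)"
        using d s n D adj_sym[of s d] unfolding rest_def by auto
      ultimately have "insert s K \<in> ?F" using s K by auto
      then have "K = insert s K" using max by blast
      then show False using s by blast
    qed
    have "D \<subset> W" using D K by blast
    moreover have "D \<noteq> {}" using K unfolding D_def by blast
    ultimately obtain v where v: "v \<in> D" "avoidable D v" using psubset.IH by blast
    then obtain K' where K': "conn K'" "K' \<subseteq> D - {v}" "\<And>k. k \<in> K' \<Longrightarrow> \<not> adj v k"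
      and dom: "\<And>s. s \<in> D \<Longrightarrow> adj v s \<Longrightarrow> (\<exists>k\<in>K'. adj s k) \<or> (\<forall>s'\<in>D. adj v s' \<and> s' \<noteq> s \<longrightarrow> adj s s')"
      unfolding avoidable_def by blast
    \<comment> \<open>A nonempty \<open>K'\<close> lies in \<open>D\<close> and is therefore seen by
      every boundary vertex. An empty \<open>K'\<close> attaches nothing, so \<open>K\<close> takes
      over, to which every boundary vertex is attached.\<close>
    define L where "L = (if K' = {} then K else K')"
    have "conn L" "L \<subseteq> W - {v}" "\<forall>k\<in>L. \<not> adj v k"
      using K K' D v(1) unfolding L_def by auto
    moreover have "(\<exists>k\<in>L. adj s k) \<or> (\<forall>s'\<in>W. adj v s' \<and> s' \<noteq> s \<longrightarrow> adj s s')"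
      if s: "s \<in> W" "adj v s" for s
    proof (cases "s \<in> D")
      case True
      show ?thesis
      proof (cases "\<exists>k\<in>K'. adj s k")
        case True
        then show ?thesis unfolding L_def by auto
      next
        case False
        have "adj s s'" if s': "s' \<in> W" "adj v s'" "s' \<noteq> s" for s'
        proof (cases "s' \<in> D")
          case True
          then show ?thesis using dom[OF \<open>s \<in> D\<close> s(2)] False s' by blast
        next
          case False
          moreover have "s' \<notin> K" using D(3)[OF v(1)] s'(2) by blast
          ultimately have "adj s' s" using full[OF s'(1)] \<open>s \<in> D\<close> by blast
          then show ?thesis using adj_sym[of s s'] by blast
        qed
        then show ?thesis by blast
      qed
    next
      case False
      have sK: "s \<notin> K" using D(3)[OF v(1)] s(2) by blast
      show ?thesis
      proof (cases "K' = {}")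
        case True
        then show ?thesis using att[OF s(1) sK False] unfolding L_def by auto
      next
        case ne: False
        then obtain k where "k \<in> K'" by blast
        then have "adj s k" using full[OF s(1) sK False, of k] K'(2) by blast
        then show ?thesis using \<open>k \<in> K'\<close> ne unfolding L_def by auto
      qed
    qed
    ultimately have "avoidable W v" unfolding avoidable_def by blast
    then show ?thesis using v(1) D(1) by blast
  qed
qed

text \<open>If deleting \<open>v\<close> split the graph, \<open>v\<close> would have nonadjacent
  neighbours on both sides. Both would be attached to \<open>K\<close>, and the connected set
  \<open>K\<close> avoids \<open>v\<close> and so cannot meet both sides.\<close>

lemma avoidable_conn:
  assumes "conn W" "avoidable W v"
  shows "conn (W - {v})"
  unfolding conn_def
proof (intro allI impI, rule ccontr)
  fix M assume M: "M \<subseteq> W - {v} \<and> M \<noteq> {} \<and> M \<noteq> W - {v}"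
    and "\<not> (\<exists>u\<in>M. \<exists>w\<in>W - {v} - M. adj u w)"
  then have no: "\<not> adj u w" if "u \<in> M" "w \<in> W" "w \<noteq> v" "w \<notin> M" for u w using that by blast
  define R where "R = W - {v} - M"
  have R: "R \<subseteq> W" "R \<noteq> {}" "R \<noteq> W" using M unfolding R_def by auto
  obtain K where K: "conn K" "K \<subseteq> W - {v}" "\<And>k. k \<in> K \<Longrightarrow> \<not> adj v k"
    and dom: "\<And>s. s \<in> W \<Longrightarrow> adj v s \<Longrightarrow> (\<exists>k\<in>K. adj s k) \<or> (\<forall>s'\<in>W. adj v s' \<and> s' \<noteq> s \<longrightarrow> adj s s')"
    using assms(2) unfolding avoidable_def by blast
  have "M \<subseteq> W" "M \<noteq> {}" "M \<noteq> W" using M R unfolding R_def by auto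
  then obtain x x' where x: "x \<in> M" "x' \<in> W - M" "adj x x'" using connD[OF assms(1)] by blast
  then have "x' = v" using no by blast
  obtain y y' where y: "y \<in> R" "y' \<in> W - R" "adj y y'" using connD[OF assms(1) R] by blast
  have "y' \<notin> M" using no[of y' y] y adj_sym[of y y'] unfolding R_def by blast
  then have "y' = v" using y unfolding R_def by blast
  have vxy: "adj v x" "adj v y" using x y \<open>x' = v\<close> \<open>y' = v\<close> adj_sym[of v x] adj_sym[of v y] by auto
  have yM: "y \<in> W" "y \<noteq> v" "y \<notin> M" using y unfolding R_def by auto
  have xy: "\<not> adj x y" "x \<noteq> y" using no[OF x(1) yM(1-3)] x(1) yM(3) by auto
  then have yx: "\<not> adj y x" using adj_sym[of x y] by simp
  have xW: "x \<in> W" using x(1) M by blast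
  obtain k where k: "k \<in> K" "adj x k" using dom[OF xW vxy(1)] xy vxy(2) yM(1) by blast
  obtain k' where k': "k' \<in> K" "adj y k'" using dom[OF yM(1) vxy(2)] xy yx vxy(1) xW by blast
  have "k \<in> M" using no[OF x(1), of k] k K(2) by blast
  moreover have "k' \<notin> M" using no[of k' y] yM k'(2) adj_sym[of y k'] by blast
  ultimately have "K \<inter> M \<noteq> {}" "K \<inter> M \<noteq> K" using k(1) k'(1) by auto
  then obtain u w where "u \<in> K \<inter> M" "w \<in> K - K \<inter> M" "adj u w" using connD[OF K(1), of "K \<inter> M"] by blast
  then show False using no[of u w] K(2) by blast
qed

text \<open>Within \<open>X\<close>, a vertex \<open>v\<close> of the chain that has no neighbour in
  \<open>Y\<close> can only have its two chain neighbours. It needs two, so the next vertex of the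
  chain belongs to \<open>X\<close>. The last vertex of the chain may have further
  neighbours.\<close>

lemma chain_closed:
  assumes deg: "\<And>v. v \<in> X \<Longrightarrow> \<exists>p q. p \<noteq> q \<and> p \<in> X \<and> q \<in> X \<and> adj v p \<and> adj v q"
  shows "ipath (A @ u # v # C) \<Longrightarrow> v \<in> X \<Longrightarrow> X \<subseteq> set (A @ u # v # C) \<union> Y \<Longrightarrow>
    (\<And>m w. m \<in> set (butlast (v # C)) \<Longrightarrow> w \<in> Y \<Longrightarrow> \<not> adj m w) \<Longrightarrow> set C \<subseteq> X"
proof (induction C arbitrary: A u v)
  case (Cons w C)
  obtain p q where pq: "p \<noteq> q" "p \<in> X" "q \<in> X" "adj v p" "adj v q" using deg[OF Cons.prems(2)] by blast
  have "s \<in> {u, w}" if s: "s \<in> X" "adj v s" for s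
  proof -
    have "s \<notin> Y" using Cons.prems(4)[of v s] s by auto
    then have "s \<in> set (A @ u # v # w # C)" using s Cons.prems(3) by blast
    then consider "s \<in> set A" | "s = u" | "s = v" | "s = w" | "s \<in> set C" by auto
    then show ?thesis
    proof cases
      case 1
      have "ipath (u # v # w # C)" "\<forall>x\<in>set A. adj x v \<longleftrightarrow> x = last A \<and> v = u"
        using Cons.prems(1) unfolding ipath_append by auto
      then show ?thesis using 1 s(2) adj_sym[of s v] by auto
    next
      case 3
      then show ?thesis using s(2) by simp
    next
      case 5
      have "ipath (v # w # C)" using Cons.prems(1) unfolding ipath_append by simp
      then show ?thesis using 5 s(2) by simp
    qed simp_all
  qed
  then have "p \<in> {u, w}" "q \<in> {u, w}" using pq by blast+
  then have w: "w \<in> X" using pq by auto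
  have "set C \<subseteq> X"
  proof (rule Cons.IH[of "A @ [u]" v w])
    show "\<not> adj m x" if "m \<in> set (butlast (w # C))" "x \<in> Y" for m x
      using Cons.prems(4)[of m x] that by simp
  qed (use Cons.prems w in simp_all)
  then show ?case using w by simp
qed simp

section \<open>Counting solids and induced cycles\<close>

text \<open>An induced cycle contains no smaller one, since the smaller one already has two
  neighbours at each of its vertices. So once a chain closes up, only one cycle continues
  it.\<close>

lemma cyc_subset_unique:
  assumes "cyc Z" shows "{X. cyc X \<and> Z \<subseteq> X} \<subseteq> {Z}"
proof
  fix X assume "X \<in> {X. cyc X \<and> Z \<subseteq> X}"
  then have X: "cyc X" "Z \<subseteq> X" by auto
  have "Z = X"
  proof (rule cyc_eq_subset[OF X cyc_nonempty[OF assms]])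
    fix z assume z: "z \<in> Z"
    obtain p q where "p \<noteq> q" "{w \<in> Z. adj z w} = {p, q}" by (rule cyc_nbrs[OF assms z])
    then show "\<exists>p q. p \<noteq> q \<and> p \<in> Z \<and> q \<in> Z \<and> adj z p \<and> adj z q" by blast
  qed
  then show "X \<in> {Z}" by simp
qed

text \<open>Branch on the neighbours \<open>u\<close> of the first vertex of \<open>B\<close>: a cycle continues \<open>B\<close> by exactly one
  of them, to which the induction hypothesis for \<open>u # B\<close> applies, and any two that occur lie in a
  common solid. With \<open>n\<close> branches this suffices because n - 1 \<open>\<le>\<close> C(n,2).\<close>

lemma pair_count:
  assumes "finite Y" "ipath B" "3 \<le> length B" "set B \<inter> Y = {}"
    and "\<And>b w. b \<in> set (butlast (tl B)) \<Longrightarrow> w \<in> Y \<Longrightarrow> \<not> adj b w"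
  shows "card {X. cyc X \<and> set B \<subseteq> X \<and> X \<subseteq> set B \<union> Y} \<le>
    card {X. solid X \<and> set B \<subseteq> X \<and> X \<subseteq> set B \<union> Y} + 1"
  using assms
proof (induction Y arbitrary: B rule: finite_psubset_induct)
  case (psubset Y)
  define CS where "CS = {X. cyc X \<and> set B \<subseteq> X \<and> X \<subseteq> set B \<union> Y}"
  define SS where "SS = {X. solid X \<and> set B \<subseteq> X \<and> X \<subseteq> set B \<union> Y}"
  have sub: "CS \<subseteq> Pow (set B \<union> Y)" "SS \<subseteq> Pow (set B \<union> Y)" unfolding CS_def SS_def by auto
  then have fin: "finite CS" "finite SS" using psubset.hyps finite_subset by fastforce+
  obtain a c R where B: "B = a # c # R" "R \<noteq> []"
    using psubset.prems(2) by (cases B; cases "tl B"; cases "tl (tl B)") auto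
  define b where "b = last R"
  have ipB: "ipath (a # c # R)" using psubset.prems(1) B by simp
  have bR: "b \<in> set R" using B unfolding b_def by simp
  have ac: "adj a c" "a \<noteq> c" "a \<notin> set R" "c \<notin> set R" "\<And>r. r \<in> set R \<Longrightarrow> \<not> adj a r"
    using ipB by auto
  have inner: "\<not> adj m w" if "m \<in> set (butlast (c # R))" "w \<in> Y" for m w
    using psubset.prems(4)[of m w] that B by simp
  define U where "U = {u \<in> Y. adj a u}"
  have UY: "U \<subseteq> Y" "finite U" unfolding U_def using psubset.hyps by auto
  \<comment> \<open>All neighbours of \<open>a\<close> are removed, not only the chosen one, so that
    \<open>a\<close> becomes an inner vertex of the longer chain \<open>u # B\<close> without
    neighbours in \<open>Y'\<close>.\<close>
  define Y' where "Y' = Y - U"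
  have BY: "set B \<inter> Y = {}" using psubset.prems(3) .
  \<comment> \<open>One of the two cycle neighbours of \<open>a\<close> is \<open>c\<close>, the
    next vertex of the chain, and the chain has no others, so the second one lies in
    \<open>U\<close>.\<close>
  have CSU: "\<exists>u\<in>U. {w \<in> X. adj a w} = {u, c} \<and> X \<inter> U = {u}" if X: "X \<in> CS" for X
  proof -
    have X': "cyc X" "set B \<subseteq> X" "X \<subseteq> set B \<union> Y" using X unfolding CS_def by auto
    have "a \<in> X" "c \<in> X" using X'(2) B by auto
    obtain p q where pq: "p \<noteq> q" "{w \<in> X. adj a w} = {p, q}" by (rule cyc_nbrs[OF X'(1) \<open>a \<in> X\<close>])
    have "c \<in> {p, q}" using pq(2) \<open>c \<in> X\<close> ac by blast
    then have "\<exists>u. u \<noteq> c \<and> {p, q} = {u, c}" using pq(1) by (metis insertE insert_commute singletonD)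
    then obtain u where u: "u \<noteq> c" "{w \<in> X. adj a w} = {u, c}" unfolding pq(2) by blast
    have ua: "u \<in> X" "adj a u" using u(2) by blast+
    then have "u \<notin> set B" using u(1) ac B by auto
    then have "u \<in> U" using ua X'(3) unfolding U_def by blast
    moreover have "c \<notin> U" using BY B UY(1) by auto
    then have "X \<inter> U = {u}" using u(2) \<open>u \<in> U\<close> ua(1) unfolding U_def by blast
    ultimately show ?thesis using u(2) by blast
  qed
  \<comment> \<open>Only branches taken by some cycle are kept: those cycles provide the connected
    sets from which \<open>pair\<close> builds its solids.\<close>
  define U' where "U' = {u \<in> U. \<exists>X\<in>CS. X \<inter> U = {u}}"
  have U': "U' \<subseteq> U" "finite U'" using UY unfolding U'_def by auto
  have branch: "card {X \<in> CS. X \<inter> U = {u}} \<le> card {X \<in> SS. X \<inter> U = {u}} + 1" if u: "u \<in> U'" for u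
  proof -
    have uU: "u \<in> U" "u \<in> Y" "adj a u" "u \<notin> set B" using u U' UY BY unfolding U_def by auto
    have eq: "(set B \<subseteq> X \<and> X \<subseteq> set B \<union> Y) \<and> X \<inter> U = {u} \<longleftrightarrow>
      set (u # B) \<subseteq> X \<and> X \<subseteq> set (u # B) \<union> Y'" for X
    proof
      assume l: "(set B \<subseteq> X \<and> X \<subseteq> set B \<union> Y) \<and> X \<inter> U = {u}"
      then have "u \<in> X" by blast
      then show "set (u # B) \<subseteq> X \<and> X \<subseteq> set (u # B) \<union> Y'"
        using l unfolding Y'_def list.set(2) by blast
    next
      assume r: "set (u # B) \<subseteq> X \<and> X \<subseteq> set (u # B) \<union> Y'"
      have "set B \<inter> U = {}" "Y' \<inter> U = {}" using BY UY(1) unfolding Y'_def by blast+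
      moreover have "X \<subseteq> insert u (set B) \<union> Y'" "u \<in> X" "set B \<subseteq> X" using r by simp_all
      ultimately have "X \<inter> U = {u}" using uU(1) by blast
      moreover have "X \<subseteq> set B \<union> Y"
        using \<open>X \<subseteq> insert u (set B) \<union> Y'\<close> uU(2) unfolding Y'_def by blast
      ultimately show "(set B \<subseteq> X \<and> X \<subseteq> set B \<union> Y) \<and> X \<inter> U = {u}" using \<open>set B \<subseteq> X\<close> by blast
    qed
    have eqC: "{X \<in> CS. X \<inter> U = {u}} = {X. cyc X \<and> set (u # B) \<subseteq> X \<and> X \<subseteq> set (u # B) \<union> Y'}"
    proof -
      have "X \<in> {X \<in> CS. X \<inter> U = {u}} \<longleftrightarrow> cyc X \<and> ((set B \<subseteq> X \<and> X \<subseteq> set B \<union> Y) \<and> X \<inter> U = {u})" for X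
        unfolding CS_def mem_Collect_eq by (simp only: conj_assoc)
      then show ?thesis unfolding eq by (intro set_eqI) (simp only: mem_Collect_eq)
    qed
    have eqS: "{X \<in> SS. X \<inter> U = {u}} = {X. solid X \<and> set (u # B) \<subseteq> X \<and> X \<subseteq> set (u # B) \<union> Y'}"
    proof -
      have "X \<in> {X \<in> SS. X \<inter> U = {u}} \<longleftrightarrow> solid X \<and> ((set B \<subseteq> X \<and> X \<subseteq> set B \<union> Y) \<and> X \<inter> U = {u})" for X
        unfolding SS_def mem_Collect_eq by (simp only: conj_assoc)
      then show ?thesis unfolding eq by (intro set_eqI) (simp only: mem_Collect_eq)
    qed
    have mid: "\<not> adj u w" if "w \<in> set (butlast (c # R))" for w
      using inner[OF that uU(2)] adj_sym[of u w] by simp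
    have cRb: "c # R = butlast (c # R) @ [b]"
      using append_butlast_last_id[of "c # R"] B(2) unfolding b_def by simp
    have "set (c # R) = set (butlast (c # R) @ [b])" using cRb by (rule arg_cong)
    also have "\<dots> = insert b (set (butlast (c # R)))" by simp
    finally have cR: "set (c # R) = insert b (set (butlast (c # R)))" .
    show ?thesis
    proof (cases "adj u b")
      case True
      \<comment> \<open>If \<open>u\<close> is adjacent to \<open>b\<close>, the chain closes up
        into a cycle, which is the only one in this branch and is covered by the summand 1.\<close>
      have "cyc (insert u (set B))"
      proof (rule cyc_insertI[OF psubset.prems(1)])
        show "2 \<le> length B" "u \<notin> set B" using B uU by auto
        fix w assume "w \<in> set B"
        then have "w = a \<or> w = b \<or> w \<in> set (butlast (c # R))" using cR B by auto
        moreover have "adj u a" using uU adj_sym[of u a] by simp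
        moreover have "w \<in> set (butlast (c # R)) \<Longrightarrow> w \<noteq> a \<and> w \<noteq> b"
        proof -
          assume w: "w \<in> set (butlast (c # R))"
          have "distinct (butlast (c # R) @ [b])"
            using ipath_distinct[OF ipB] unfolding cRb[symmetric] by simp
          then have "w \<noteq> b" using w by auto
          moreover have "w \<in> set (c # R)" using w by (rule in_set_butlastD)
          ultimately show "w \<noteq> a \<and> w \<noteq> b" using ac by auto
        qed
        ultimately show "adj u w \<longleftrightarrow> w = hd B \<or> w = last B"
          using True mid B unfolding b_def by auto
      qed
      then have "{X \<in> CS. X \<inter> U = {u}} \<subseteq> {insert u (set B)}"
        unfolding eqC using cyc_subset_unique[of "insert u (set B)"] by auto
      then have "card {X \<in> CS. X \<inter> U = {u}} \<le> card {insert u (set B)}" by (intro card_mono) auto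
      then show ?thesis by simp
    next
      case False
      have nc: "\<not> adj u w" if "w \<in> set (c # R)" for w
        using that mid False unfolding cR by blast
      have "adj u w \<longleftrightarrow> w = hd B" if "w \<in> set B" for w
        using that nc B uU(3) ac adj_sym[of a u] by auto
      then have "ipath (u # B)" using psubset.prems(1) uU(4) by simp
      moreover have "Y' \<subset> Y" using uU UY unfolding Y'_def by blast
      moreover have "set (u # B) \<inter> Y' = {}" using BY uU unfolding Y'_def by auto
      moreover have "\<not> adj m w" if "m \<in> set (butlast (tl (u # B)))" "w \<in> Y'" for m w
      proof (cases "m = a")
        case True
        then show ?thesis using that(2) unfolding Y'_def U_def by blast
      next
        case False
        then show ?thesis using that inner[of m w] B unfolding Y'_def by auto
      qed
      moreover have "3 \<le> length (u # B)" using psubset.prems(2) by simp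
      ultimately show ?thesis unfolding eqC eqS using psubset.IH[of Y' "u # B"] by blast
    qed
  qed
  have pair: "1 \<le> card {X \<in> SS. X \<inter> U = e}" if e: "e \<subseteq> U'" "card e = 2" for e
  proof -
    obtain u u' where uu: "e = {u, u'}" "u \<noteq> u'" using e(2) by (auto simp: card_2_iff)
    have uU: "u \<in> U" "u' \<in> U" using uu e U' by auto
    \<comment> \<open>A cycle through \<open>v\<close>, without \<open>a\<close> and its two
      neighbours there, is connected and attached to \<open>v\<close> and \<open>c\<close>. It
      contains the chain end \<open>b\<close>, so the sets from two branches have a connected
      union.\<close>
    have get: "\<exists>K. conn K \<and> finite K \<and> b \<in> K \<and> K \<subseteq> set B \<union> Y \<and> K \<inter> insert a (insert c U) = {} \<and>
      (\<forall>k\<in>K. \<not> adj a k) \<and> (\<exists>k\<in>K. adj v k) \<and> (\<exists>k\<in>K. adj c k)" if v: "v \<in> U'" for v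
    proof -
      obtain X where X: "X \<in> CS" "X \<inter> U = {v}" using v unfolding U'_def by blast
      have X': "cyc X" "set B \<subseteq> X" "X \<subseteq> set B \<union> Y" using X unfolding CS_def by auto
      obtain v' where v': "{w \<in> X. adj a w} = {v', c}" "X \<inter> U = {v'}" using CSU[OF X(1)] by blast
      then have "v' = v" using X(2) by blast
      have "a \<in> X" using X'(2) B by auto
      obtain p q where pq: "p \<noteq> q" "{w \<in> X. adj a w} = {p, q}" "conn (X - {a, p, q})"
        "\<forall>k\<in>X - {a, p, q}. \<not> adj a k"
        "X - {a, p, q} \<noteq> {} \<longrightarrow> (\<exists>k \<in> X - {a, p, q}. adj p k) \<and> (\<exists>k \<in> X - {a, p, q}. adj q k)"
        by (rule cyc_nbrs[OF X'(1) \<open>a \<in> X\<close>])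
      have pqv: "{p, q} = {v, c}" using pq(2) v'(1) \<open>v' = v\<close> by simp
      have "v \<notin> set B" using v U' UY BY by blast
      then have bX: "b \<in> X - {a, p, q}" using bR ac B X'(2) pqv by auto
      have K: "X - {a, p, q} = X - {a, v, c}" using pqv by auto
      have "(\<exists>k \<in> X - {a, p, q}. adj v k) \<and> (\<exists>k \<in> X - {a, p, q}. adj c k)"
        using pq(5) bX pqv by (metis doubleton_eq_iff empty_iff)
      moreover have "(X - {a, p, q}) \<inter> insert a (insert c U) = {}" using X(2) unfolding K by blast
      moreover have "finite (X - {a, p, q})" using X'(3) psubset.hyps finite_subset by fastforce
      ultimately show ?thesis using pq(3,4) bX X'(3) by (intro exI[of _ "X - {a, p, q}"]) blast
    qed
    obtain K where K: "conn K" "finite K" "b \<in> K" "K \<subseteq> set B \<union> Y" "K \<inter> insert a (insert c U) = {}"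
      "\<forall>k\<in>K. \<not> adj a k" "\<exists>k\<in>K. adj u k" "\<exists>k\<in>K. adj c k"
      using get[of u] uu e by auto
    obtain L where L: "conn L" "finite L" "b \<in> L" "L \<subseteq> set B \<union> Y" "L \<inter> insert a (insert c U) = {}"
      "\<forall>k\<in>L. \<not> adj a k" "\<exists>k\<in>L. adj u' k"
      using get[of u'] uu e by auto
    have cB: "c \<notin> U" "a \<notin> U" using BY B UY(1) by auto
    have "\<exists>X. solid X \<and> {a, u, u', c} \<subseteq> X \<and> X \<subseteq> {a, u, u', c} \<union> (K \<union> L)"
    proof (rule solid_triple)
      show "conn (K \<union> L)" using conn_Un[OF K(1) L(1)] K(3) L(3) by blast
      show "finite (K \<union> L)" using K L by blast
      show "(K \<union> L) \<inter> {a, u, u', c} = {}" using K(5) L(5) uU by blast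
      show "\<not> adj a k" if "k \<in> K \<union> L" for k using that K(6) L(6) by blast
      show "adj a u" "adj a u'" "adj a c" using uU ac unfolding U_def by auto
      show "distinct [u, u', c]" using uu(2) cB uU by auto
      show "(\<exists>k\<in>K \<union> L. adj s k) \<or> (\<forall>s'\<in>{u, u', c} - {s}. adj s s')" if "s \<in> {u, u', c}" for s
        using that K(7,8) L(7) by blast
    qed
    then obtain X where X: "solid X" "{a, u, u', c} \<subseteq> X" "X \<subseteq> {a, u, u', c} \<union> (K \<union> L)" by blast
    have XBY: "X \<subseteq> set B \<union> Y" using X(3) K(4) L(4) uU UY(1) B by auto
    \<comment> \<open>\<open>solid_triple\<close> only guarantees \<open>a\<close> and
      \<open>c\<close>; the minimum degree of the solid drags the rest of the chain along.\<close>
    have "set R \<subseteq> X"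
    proof (rule chain_closed[of X "[]" a c R Y])
      show "\<exists>p q. p \<noteq> q \<and> p \<in> X \<and> q \<in> X \<and> adj v p \<and> adj v q" if "v \<in> X" for v
        using solid_degree[OF X(1) that] by metis
      show "ipath ([] @ a # c # R)" using ipB by simp
      show "c \<in> X" using X(2) by blast
      show "X \<subseteq> set ([] @ a # c # R) \<union> Y" using XBY B by simp
    qed (rule inner)
    then have "X \<in> SS" using X(1,2) XBY B unfolding SS_def by auto
    moreover have "X \<inter> U = e" using X(2,3) K(5) L(5) cB uU unfolding uu(1) by blast
    ultimately have "{X} \<subseteq> {X \<in> SS. X \<inter> U = e}" by blast
    then have "card {X} \<le> card {X \<in> SS. X \<inter> U = e}" using fin by (intro card_mono) auto
    then show ?thesis by simp
  qed
  define n where "n = card U'"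
  let ?I1 = "(\<lambda>u. {u}) ` U'" and ?I2 = "{e. e \<subseteq> U' \<and> card e = 2}"
  let ?s = "\<lambda>u. card {X \<in> SS. X \<inter> U = {u}}"
  have "card CS = (\<Sum>i\<in>?I1. card {X \<in> CS. X \<inter> U = i})"
  proof (rule card_eq_sum_fibres[OF fin(1)])
    show "X \<inter> U \<in> ?I1" if "X \<in> CS" for X using CSU[OF that] that unfolding U'_def by blast
  qed (use U' in simp)
  also have "\<dots> = (\<Sum>u\<in>U'. card {X \<in> CS. X \<inter> U = {u}})" by (subst sum.reindex) auto
  also have "\<dots> \<le> (\<Sum>u\<in>U'. ?s u + 1)" using branch by (rule sum_mono)
  also have "\<dots> = (\<Sum>u\<in>U'. ?s u) + n" unfolding sum.distrib n_def by simp
  finally have le1: "card CS \<le> (\<Sum>u\<in>U'. ?s u) + n" .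
  have finI2: "finite ?I2" using U' by simp
  have "(\<Sum>u\<in>U'. ?s u) + (n choose 2) = (\<Sum>i\<in>?I1. card {X \<in> SS. X \<inter> U = i}) + (\<Sum>i\<in>?I2. 1)"
    using n_subsets[OF U'(2), of 2] by (subst sum.reindex) (auto simp: n_def)
  also have "\<dots> \<le> (\<Sum>i\<in>?I1. card {X \<in> SS. X \<inter> U = i}) + (\<Sum>i\<in>?I2. card {X \<in> SS. X \<inter> U = i})"
    using pair by (intro add_left_mono sum_mono) auto
  also have "\<dots> = (\<Sum>i\<in>?I1 \<union> ?I2. card {X \<in> SS. X \<inter> U = i})"
    using U' finI2 by (intro sum.union_disjoint[symmetric]) auto
  also have "\<dots> \<le> card SS" using U' finI2 by (intro card_ge_sum_fibres fin) auto
  finally have le2: "(\<Sum>u\<in>U'. ?s u) + (n choose 2) \<le> card SS" .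
  have "n \<le> (n choose 2) + 1"
    by (induction n) (auto simp: numeral_2_eq_2)
  then show ?case using le1 le2 unfolding CS_def SS_def by linarith
qed

text \<open>This is the drop of the characteristic at \<open>v\<close>, written in natural numbers
  with the negative terms moved across: \<open>card N\<close> counts the edges at \<open>v\<close>
  and 1 the vertex itself.\<close>

lemma link_count:
  assumes "finite W" "v \<in> W" "avoidable W v" and N: "N = {w \<in> W. adj v w}" "N \<noteq> {}"
  shows "(card N - 1 choose 3) + card {X. X \<subseteq> W \<and> cyc X \<and> v \<in> X} + 1 \<le>
    card {X. X \<subseteq> W \<and> solid X \<and> v \<in> X} + card N"
proof -
  define CS where "CS = {X. X \<subseteq> W \<and> cyc X \<and> v \<in> X}"
  define SS where "SS = {X. X \<subseteq> W \<and> solid X \<and> v \<in> X}"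
  have fin: "finite CS" "finite SS"
    using assms(1) unfolding CS_def SS_def by (auto intro: finite_subset[of _ "Pow W"])
  have NW: "N \<subseteq> W" "finite N" "v \<notin> N" using assms(1) N by auto
  have CSN: "X \<inter> N = {w \<in> X. adj v w}" if "X \<subseteq> W" for X using that N(1) by blast
  have pairs: "card {X \<in> CS. X \<inter> N = e} \<le> card {X \<in> SS. X \<inter> N = e} + 1"
    if e: "e \<subseteq> N" "card e = 2" for e
  proof -
    obtain x y where xy: "e = {x, y}" "x \<noteq> y" using e(2) by (auto simp: card_2_iff)
    have xyN: "x \<in> N" "y \<in> N" "adj v x" "adj v y" "x \<in> W" "y \<in> W" using e xy N(1) by auto
    have vxy: "v \<noteq> x" "v \<noteq> y" using xyN NW(3) by auto
    show ?thesis
    proof (cases "adj x y")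
      case True
      have "cyc (insert v (set [x, y]))"
        by (rule cyc_insertI) (use True xy xyN vxy in auto)
      then have "{X. cyc X \<and> {v, x, y} \<subseteq> X} \<subseteq> {{v, x, y}}"
        using cyc_subset_unique[of "{v, x, y}"] by simp
      moreover have "{X \<in> CS. X \<inter> N = e} \<subseteq> {X. cyc X \<and> {v, x, y} \<subseteq> X}"
        unfolding CS_def xy by blast
      ultimately have "{X \<in> CS. X \<inter> N = e} \<subseteq> {{v, x, y}}" by (rule order_trans[rotated])
      then have "card {X \<in> CS. X \<inter> N = e} \<le> card {{v, x, y}}" by (intro card_mono) auto
      then show ?thesis by simp
    next
      case False
      \<comment> \<open>The branching starts with the chain \<open>[x, v, y]\<close>. Its inner
        vertex \<open>v\<close> has no neighbour in \<open>Y\<close>, as all other neighbours of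
        \<open>v\<close> are left out.\<close>
      define Y where "Y = W - insert v N"
      let ?B = "[x, v, y]"
      have eq: "(X \<subseteq> W \<and> v \<in> X) \<and> X \<inter> N = e \<longleftrightarrow> set ?B \<subseteq> X \<and> X \<subseteq> set ?B \<union> Y" for X
      proof
        assume "(X \<subseteq> W \<and> v \<in> X) \<and> X \<inter> N = e"
        then show "set ?B \<subseteq> X \<and> X \<subseteq> set ?B \<union> Y" unfolding Y_def xy by auto
      next
        assume r: "set ?B \<subseteq> X \<and> X \<subseteq> set ?B \<union> Y"
        then have "x \<in> X" "v \<in> X" "y \<in> X" "X \<subseteq> {x, v, y} \<union> Y" by simp_all
        moreover have "Y \<inter> N = {}" "Y \<subseteq> W" unfolding Y_def by blast+
        ultimately show "(X \<subseteq> W \<and> v \<in> X) \<and> X \<inter> N = e"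
          using xyN NW(3) assms(2) unfolding xy(1) by blast
      qed
      have C: "{X \<in> CS. X \<inter> N = e} = {X. cyc X \<and> set ?B \<subseteq> X \<and> X \<subseteq> set ?B \<union> Y}"
        unfolding CS_def eq[symmetric] by (intro set_eqI) auto
      have S: "{X \<in> SS. X \<inter> N = e} = {X. solid X \<and> set ?B \<subseteq> X \<and> X \<subseteq> set ?B \<union> Y}"
        unfolding SS_def eq[symmetric] by (intro set_eqI) auto
      show ?thesis
        unfolding C S
      proof (rule pair_count)
        show "finite Y" using assms(1) unfolding Y_def by simp
        show "ipath ?B" using False xy xyN vxy adj_sym[of v x] by auto
        show "set ?B \<inter> Y = {}" using xyN unfolding Y_def by auto
        show "\<not> adj b w" if "b \<in> set (butlast (tl ?B))" "w \<in> Y" for b w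
          using that N(1) unfolding Y_def by auto
      qed simp
    qed
  qed
  have triples: "1 \<le> card {X \<in> SS. X \<inter> N = e}" if e: "e \<subseteq> N" "card e = 3" for e
  proof -
    obtain x y z where xyz: "e = {x, y, z}" "distinct [x, y, z]" using e(2) by (auto simp: card_3_iff)
    obtain K where K: "conn K" "K \<subseteq> W - {v}" "\<forall>k\<in>K. \<not> adj v k"
      and dom: "\<forall>s\<in>W. adj v s \<longrightarrow> (\<exists>k\<in>K. adj s k) \<or> (\<forall>s'\<in>W. adj v s' \<and> s' \<noteq> s \<longrightarrow> adj s s')"
      using assms(3) unfolding avoidable_def by blast
    have eN: "adj v s" "s \<in> W" if "s \<in> {x, y, z}" for s using that e xyz N(1) by auto
    have "\<exists>X. solid X \<and> {v, x, y, z} \<subseteq> X \<and> X \<subseteq> {v, x, y, z} \<union> K"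
    proof (rule solid_triple[OF K(1)])
      show "finite K" using K(2) assms(1) finite_subset by blast
      show "K \<inter> {v, x, y, z} = {}" using K(2,3) eN by blast
      show "\<not> adj v k" if "k \<in> K" for k using K(3) that by blast
      show "(\<exists>k\<in>K. adj s k) \<or> (\<forall>s'\<in>{x, y, z} - {s}. adj s s')" if "s \<in> {x, y, z}" for s
        using bspec[OF dom eN(2)[OF that]] eN that by blast
    qed (use eN xyz(2) in auto)
    then obtain X where X: "solid X" "{v, x, y, z} \<subseteq> X" "X \<subseteq> {v, x, y, z} \<union> K" by blast
    have "X \<subseteq> W" using X(3) K(2) eN(2) assms(2) by blast
    then have "X \<in> SS" using X unfolding SS_def by blast
    moreover have "K \<inter> N = {}" using K(3) N(1) by blast
    then have "X \<inter> N = e" using X(2,3) NW(3) e(1) unfolding xyz(1) by blast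
    ultimately have "{X} \<subseteq> {X \<in> SS. X \<inter> N = e}" by blast
    then have "card {X} \<le> card {X \<in> SS. X \<inter> N = e}" using fin by (intro card_mono) auto
    then show ?thesis by simp
  qed
  let ?I2 = "{e. e \<subseteq> N \<and> card e = 2}" and ?I3 = "{e. e \<subseteq> N \<and> card e = 3}"
  let ?s = "\<lambda>e. card {X \<in> SS. X \<inter> N = e}"
  define d where "d = card N"
  have finI: "finite ?I2" "finite ?I3" using NW by simp_all
  have "card CS = (\<Sum>e\<in>?I2. card {X \<in> CS. X \<inter> N = e})"
  proof (rule card_eq_sum_fibres[OF fin(1) finI(1)])
    fix X assume "X \<in> CS"
    then have X: "X \<subseteq> W" "cyc X" "v \<in> X" unfolding CS_def by auto
    obtain p q where "p \<noteq> q" "{w \<in> X. adj v w} = {p, q}" by (rule cyc_nbrs[OF X(2,3)])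
    then show "X \<inter> N \<in> ?I2" using CSN[OF X(1)] by auto
  qed
  also have "\<dots> \<le> (\<Sum>e\<in>?I2. ?s e + 1)" using pairs by (intro sum_mono) blast
  also have "\<dots> = (\<Sum>e\<in>?I2. ?s e) + (d choose 2)"
    unfolding sum.distrib d_def using n_subsets[OF NW(2), of 2] by simp
  finally have le1: "card CS \<le> (\<Sum>e\<in>?I2. ?s e) + (d choose 2)" .
  have "(\<Sum>e\<in>?I2. ?s e) + (d choose 3) = (\<Sum>e\<in>?I2. ?s e) + (\<Sum>e\<in>?I3. 1)"
    unfolding d_def using n_subsets[OF NW(2), of 3] by simp
  also have "\<dots> \<le> (\<Sum>e\<in>?I2. ?s e) + (\<Sum>e\<in>?I3. ?s e)"
    using triples by (intro add_left_mono sum_mono) blast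
  also have "\<dots> = (\<Sum>e\<in>?I2 \<union> ?I3. ?s e)"
    by (intro sum.union_disjoint[symmetric] finI) auto
  also have "\<dots> \<le> card SS" using finI by (intro card_ge_sum_fibres fin) auto
  finally have le2: "(\<Sum>e\<in>?I2. ?s e) + (d choose 3) \<le> card SS" .
  \<comment> \<open>The binomial identity needs a positive degree: for \<open>d = 0\<close> its left
    side is -1.\<close>
  have "d \<noteq> 0" using N NW unfolding d_def by auto
  then obtain m where m: "d = Suc m" by (cases d) auto
  have "(d choose 3) = (m choose 3) + (m choose 2)" "(d choose 2) = (m choose 2) + m"
    unfolding m by (simp_all add: numeral_3_eq_3 numeral_2_eq_2)
  then show ?thesis using le1 le2 m unfolding CS_def SS_def d_def by simp
qed

section \<open>The characteristic and colourings\<close>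

text \<open>The characteristic as a function of the vertex set, so that it can be compared along
  deletions. Solids are counted without isomorphism, and \<open>euler_le_beth3\<close> leads back to
  \<open>beth3\<close>.\<close>

definition euler :: "'a set \<Rightarrow> int" where
  "euler W = int (card {X. X \<subseteq> W \<and> solid X}) - int (card {X. X \<subseteq> W \<and> cyc X})
    + int (card (ind W)) - int (card W)"

lemma card_remove_vertex:
  assumes "finite W" "v \<in> W"
  shows "card {X. X \<subseteq> W \<and> P X} = card {X. X \<subseteq> W - {v} \<and> P X} + card {X. X \<subseteq> W \<and> P X \<and> v \<in> X}"
proof -
  have "{X. X \<subseteq> W \<and> P X} = {X. X \<subseteq> W - {v} \<and> P X} \<union> {X. X \<subseteq> W \<and> P X \<and> v \<in> X}"
    by blast
  moreover have "finite {X. X \<subseteq> W - {v} \<and> P X}" "finite {X. X \<subseteq> W \<and> P X \<and> v \<in> X}"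
    using assms(1) by (auto intro: finite_subset[of _ "Pow W"])
  ultimately show ?thesis by (simp add: card_Un_disjoint disjoint_iff subset_Diff_insert)
qed

lemma card_ind_remove:
  assumes "finite W" "v \<in> W"
  shows "card (ind W) = card (ind (W - {v})) + card {w \<in> W. adj v w}"
proof -
  have "ind W = ind (W - {v}) \<union> (\<lambda>w. {v, w}) ` {w \<in> W. adj v w}"
  proof (rule ind_eqI)
    fix x y assume "x \<in> W" "y \<in> W" "adj x y"
    then show "{x, y} \<in> ind (W - {v}) \<union> (\<lambda>w. {v, w}) ` {w \<in> W. adj v w}"
      using adj_sym[of x y] by (cases "x = v"; cases "y = v") (auto simp: ind_mem insert_commute)
  qed (use assms(2) in \<open>auto simp: ind_def adj_def\<close>)
  moreover have "finite (ind (W - {v}))"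
    using assms(1) by (auto simp: ind_def intro: finite_subset[of _ "Pow W"])
  moreover have "ind (W - {v}) \<inter> (\<lambda>w. {v, w}) ` {w \<in> W. adj v w} = {}" by (auto simp: ind_def)
  moreover have "inj_on (\<lambda>w. {v, w}) {w \<in> W. adj v w}" by (auto simp: inj_on_def doubleton_eq_iff)
  ultimately show ?thesis using assms(1) by (simp add: card_Un_disjoint card_image)
qed

text \<open>The colouring and the bound are built together, because the number \<open>k\<close> of
  greedy colours is what the drops are charged to. The \<open>+ 1\<close> comes from the single
  vertex, where \<open>k = 1\<close> and the one vertex is the only negative contribution.\<close>

lemma euler_bound:
  assumes "finite W" "W \<noteq> {}" "conn W"
  shows "\<exists>k c. 1 \<le> k \<and> (\<forall>v\<in>W. c v < k) \<and> (\<forall>u\<in>W. \<forall>v\<in>W. adj u v \<longrightarrow> c u \<noteq> (c v :: nat)) \<and>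
    int (k - 1 choose 4) \<le> euler W + 1"
  using assms
proof (induction W rule: finite_psubset_induct)
  case (psubset W)
  obtain v where v: "v \<in> W" "avoidable W v" using exists_avoidable psubset.hyps psubset.prems(1) by blast
  show ?case
  proof (cases "W = {v}")
    case True
    have noc: "\<not> cyc X" if "X \<subseteq> {v}" for X
    proof
      assume c: "cyc X"
      then have X: "X = {v}" using that cyc_nonempty by blast
      then have "v \<in> X" by simp
      then obtain p q where "{w \<in> X. adj v w} = {p, q}" by (rule cyc_nbrs[OF c])
      then show False unfolding X by auto
    qed
    have none: "{X. X \<subseteq> {v} \<and> cyc X} = {}" using noc by blast
    have "0 \<le> euler W + 1" unfolding euler_def True none by simp
    then show ?thesis using True by (intro exI[of _ 1] exI[of _ "\<lambda>_. 0"]) (auto simp: numeral_eq_Suc)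
  next
    case False
    define N where "N = {w \<in> W. adj v w}"
    have finN: "finite N" using psubset.hyps unfolding N_def by simp
    have "\<exists>u\<in>{v}. \<exists>w\<in>W - {v}. adj u w" by (rule connD[OF psubset.prems(2)]) (use v False in auto)
    then have "N \<noteq> {}" unfolding N_def by blast
    have "W - {v} \<subset> W" "W - {v} \<noteq> {}" using v False by auto
    then obtain k c where kc: "1 \<le> k" "\<forall>u\<in>W - {v}. c u < k"
      "\<forall>u\<in>W - {v}. \<forall>w\<in>W - {v}. adj u w \<longrightarrow> c u \<noteq> (c w :: nat)"
      "int (k - 1 choose 4) \<le> euler (W - {v}) + 1"
      using psubset.IH avoidable_conn[OF psubset.prems(2) v(2)] by metis
    have step: "euler (W - {v}) + int (card N - 1 choose 3) \<le> euler W"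
      unfolding euler_def
      using link_count[OF psubset.hyps v N_def \<open>N \<noteq> {}\<close>] card_remove_vertex[OF psubset.hyps v(1), of cyc]
        card_remove_vertex[OF psubset.hyps v(1), of solid] card_ind_remove[OF psubset.hyps v(1)]
        card.remove[OF psubset.hyps v(1)]
      unfolding N_def by linarith
    have vN: "adj u w \<Longrightarrow> u = v \<and> w \<in> N \<or> w = v \<and> u \<in> N \<or> u \<in> W - {v} \<and> w \<in> W - {v}"
      if "u \<in> W" "w \<in> W" for u w
      using that adj_sym[of u w] unfolding N_def by auto
    have vnN: "v \<notin> N" unfolding N_def by simp
    show ?thesis
    proof (cases "card N < k")
      case True
      have "card (c ` N) < k" using True card_image_le[OF finN, of c] by linarith
      then have "\<not> {..<k} \<subseteq> c ` N" using card_mono[of "c ` N" "{..<k}"] finN by auto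
      then obtain i where i: "i < k" "i \<notin> c ` N" by blast
      let ?c = "c(v := i)"
      have "\<forall>u\<in>W. ?c u < k" using kc(2) i by auto
      moreover have "?c u \<noteq> ?c w" if "u \<in> W" "w \<in> W" "adj u w" for u w
        using vN[OF that] kc(3) that i vnN by auto
      moreover have "int (k - 1 choose 4) \<le> euler W + 1" using kc(4) step by linarith
      ultimately show ?thesis using kc(1) by (intro exI[of _ k] exI[of _ ?c]) blast
    next
      case F: False
      let ?c = "c(v := k)"
      have "\<forall>u\<in>W. ?c u < Suc k" using kc(2) by (auto simp: less_Suc_eq)
      moreover have "?c u \<noteq> ?c w" if "u \<in> W" "w \<in> W" "adj u w" for u w
        using vN[OF that] kc(2,3) that by auto
      \<comment> \<open>A new colour raises the target by C(k-1,3), which is paid for by a deleted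
        vertex of degree at least \<open>k\<close>.\<close>
      moreover have "(k choose 4) = (k - 1 choose 4) + (k - 1 choose 3)"
        using kc(1) by (cases k) (auto simp: numeral_eq_Suc)
      moreover have "(k - 1 choose 3) \<le> (card N - 1 choose 3)" using F by (intro binomial_right_mono) simp
      ultimately show ?thesis
        using kc(4) step by (intro exI[of _ "Suc k"] exI[of _ ?c]) auto
    qed
  qed
qed

section \<open>From vertex sets back to graphs\<close>

text \<open>A path from inside \<open>M\<close> to outside contains an edge that leaves
  \<open>M\<close>.\<close>

lemma connected_graph_conn:
  assumes "connected_graph (W, E)"
  shows "conn W"
  unfolding conn_def
proof (intro allI impI)
  fix M assume M: "M \<subseteq> W \<and> M \<noteq> {} \<and> M \<noteq> W"
  then obtain u v where uv: "u \<in> M" "u \<in> W" "v \<in> W - M" by blast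
  then obtain P where P: "is_path u v P" "subgraph P (W, E)"
    using assms M unfolding connected_graph_def fst_conv by (meson DiffD1)
  then obtain xs where xs: "xs \<noteq> []" "hd xs = u" "last xs = v" "P = path_graph xs"
    unfolding is_path_def by blast
  have "hd ys \<in> M \<Longrightarrow> last ys \<notin> M \<Longrightarrow> ys \<noteq> [] \<Longrightarrow> set ys \<subseteq> W \<Longrightarrow> edges (path_graph ys) \<subseteq> E \<Longrightarrow>
    \<exists>u\<in>M. \<exists>w\<in>W - M. adj u w" for ys
  proof (induction ys)
    case (Cons y ys)
    show ?case
    proof (cases "ys = []")
      case True
      then show ?thesis using Cons.prems by simp
    next
      case False
      then have e: "adj y (hd ys)" "edges (path_graph ys) \<subseteq> E"
        using Cons.prems(5) by (auto simp: edges_path_Cons' adj_def)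
      show ?thesis
      proof (cases "hd ys \<in> M")
        case True
        then show ?thesis using Cons.IH Cons.prems False e by simp
      next
        case n: False
        have "hd ys \<in> W - M" using n Cons.prems(4) hd_in_set[OF False] by auto
        then show ?thesis using e(1) Cons.prems(1) by auto
      qed
    qed
  qed simp
  then show "\<exists>u\<in>M. \<exists>w\<in>W - M. adj u w"
    using xs uv P(2) unfolding subgraph_def by auto
qed

lemma induced_subgraph_iff: "induced_subgraph H (W, E) \<longleftrightarrow> verts H \<subseteq> W \<and> H = (verts H, ind (verts H))"
  by (cases H) (auto simp: induced_subgraph_def ind_def)

lemma induced_cycles_eq: "induced_cycles (W, E) = (\<lambda>X. (X, ind X)) ` {X. X \<subseteq> W \<and> cyc X}"
proof
  show "induced_cycles (W, E) \<subseteq> (\<lambda>X. (X, ind X)) ` {X. X \<subseteq> W \<and> cyc X}"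
  proof
    fix C assume "C \<in> induced_cycles (W, E)"
    then have C: "verts C \<subseteq> W" "C = (verts C, ind (verts C))" "is_cycle C"
      unfolding induced_cycles_def induced_subgraph_iff by auto
    then have "cyc (verts C)" unfolding cyc_def by simp
    then show "C \<in> (\<lambda>X. (X, ind X)) ` {X. X \<subseteq> W \<and> cyc X}"
      using C by (intro image_eqI[of _ _ "verts C"]) simp_all
  qed
qed (auto simp: induced_cycles_def induced_subgraph_iff cyc_def)

text \<open>Solids enter \<open>beth3\<close> positively, so this inclusion is the direction
  required for a lower bound; the identity is the isomorphism.\<close>

lemma solids_superset: "(\<lambda>X. (X, ind X)) ` {X. X \<subseteq> W \<and> solid X} \<subseteq> solids (W, E)"
proof -
  have "graph_isomorphic H H" for H :: "'a ugraph"
    unfolding graph_isomorphic_def by (intro exI[of _ id]) auto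
  then show ?thesis unfolding solids_def induced_subgraph_iff solid_def by auto
qed

text \<open>Supplies the finiteness of \<open>solids\<close>, without which \<open>card\<close>
  would be 0 and monotonicity would fail.\<close>

lemma solids_subset: "solids (W, E) \<subseteq> (\<lambda>X. (X, ind X)) ` Pow W"
proof
  fix S assume "S \<in> solids (W, E)"
  then have "verts S \<subseteq> W" "S = (verts S, ind (verts S))"
    unfolding solids_def induced_subgraph_iff by auto
  then show "S \<in> (\<lambda>X. (X, ind X)) ` Pow W" by (intro image_eqI[of _ _ "verts S"]) simp_all
qed

lemma card_induced_cycles: "card (induced_cycles (W, E)) = card {X. X \<subseteq> W \<and> cyc X}"
  unfolding induced_cycles_eq by (rule card_image) (simp add: inj_on_def)

lemma euler_le_beth3:
  assumes "finite W" "\<Union> E \<subseteq> W"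
  shows "euler W \<le> beth3 (W, E)"
proof -
  have "ind W = E" using assms(2) unfolding ind_def by blast
  moreover have "finite (solids (W, E))"
    by (rule finite_subset[OF solids_subset]) (use assms(1) in simp)
  then have "card ((\<lambda>X. (X, ind X)) ` {X. X \<subseteq> W \<and> solid X}) \<le> card (solids (W, E))"
    using solids_superset by (rule card_mono)
  moreover have "card ((\<lambda>X. (X, ind X)) ` {X. X \<subseteq> W \<and> solid X}) = card {X. X \<subseteq> W \<and> solid X}"
    by (rule card_image) (simp add: inj_on_def)
  ultimately show ?thesis unfolding euler_def beth3_def card_induced_cycles by simp
qed

end

section \<open>Complete graphs and the conclusion\<close>

text \<open>One inequality suffices here. Every triple spans a triangle, which bounds the cycles
  from below. An isomorphism carries completeness over to the solid graph, so
  \<open>complete_solid_graph\<close> bounds the solids by the 4-element sets.\<close>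

lemma beth3_complete_graph:
  "beth3 (complete_graph t) \<le> int (t choose 4) - int (t choose 3) + int (t choose 2) - int (t choose 1)"
proof -
  define E where "E = {e. e \<subseteq> {..<t} \<and> card e = 2}"
  interpret simple_edges E by unfold_locales (simp add: E_def)
  have cg: "complete_graph t = ({..<t}, E)" by (simp add: complete_graph_def E_def)
  have adj: "adj u v" if "u < t" "v < t" "u \<noteq> v" for u v
  proof -
    have "{u, v} \<in> E" using that unfolding E_def by simp
    then show ?thesis by (simp add: adj_def)
  qed
  have "{e. e \<subseteq> {..<t} \<and> card e = 3} \<subseteq> {X. X \<subseteq> {..<t} \<and> cyc X}"
  proof
    fix e assume "e \<in> {e. e \<subseteq> {..<t} \<and> card e = 3}"
    then obtain a b c where e: "e = {a, b, c}" "distinct [a, b, c]" "e \<subseteq> {..<t}"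
      by (auto simp: card_3_iff)
    have "cyc (insert a (set [b, c]))"
      by (rule cyc_insertI) (use e adj in auto)
    then show "e \<in> {X. X \<subseteq> {..<t} \<and> cyc X}" using e by simp
  qed
  then have "card {e. e \<subseteq> {..<t} \<and> card e = 3} \<le> card {X. X \<subseteq> {..<t} \<and> cyc X}"
    by (intro card_mono) (auto intro: finite_subset[of _ "Pow {..<t}"])
  then have c: "t choose 3 \<le> card (induced_cycles ({..<t}, E))"
    using n_subsets[of "{..<t}" 3] unfolding card_induced_cycles by simp
  have "solids ({..<t}, E) \<subseteq> (\<lambda>X. (X, ind X)) ` {X. X \<subseteq> {..<t} \<and> card X = 4}"
  proof
    fix S assume S: "S \<in> solids ({..<t}, E)"
    then have v: "verts S \<subseteq> {..<t}" "S = (verts S, ind (verts S))"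
      unfolding solids_def induced_subgraph_iff by auto
    obtain K :: "nat ugraph" and f where K: "is_solid_graph K" and f: "bij_betw f (verts S) (verts K)"
      "\<forall>u\<in>verts S. \<forall>v\<in>verts S. {u, v} \<in> edges S \<longleftrightarrow> {f u, f v} \<in> edges K"
      using S unfolding solids_def graph_isomorphic_def by auto
    have "{u', v'} \<in> edges K" if uv: "u' \<in> verts K" "v' \<in> verts K" "u' \<noteq> v'" for u' v'
    proof -
      obtain u v where "u \<in> verts S" "v \<in> verts S" "u' = f u" "v' = f v"
        using uv f(1) unfolding bij_betw_def by blast
      moreover then have "adj u v" using v(1) uv(3) by (intro adj) auto
      then have "{u, v} \<in> ind (verts S)"
        using \<open>u \<in> verts S\<close> \<open>v \<in> verts S\<close> by (simp add: ind_mem)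
      then have "{u, v} \<in> edges S" using arg_cong[OF v(2), of snd] by simp
      ultimately show ?thesis using f(2) by blast
    qed
    then have "card (verts K) = 4" using complete_solid_graph[OF K] by blast
    then have "card (verts S) = 4" using bij_betw_same_card[OF f(1)] by simp
    then show "S \<in> (\<lambda>X. (X, ind X)) ` {X. X \<subseteq> {..<t} \<and> card X = 4}"
      using v by (intro image_eqI[of _ _ "verts S"]) simp_all
  qed
  then have "card (solids ({..<t}, E)) \<le> card ((\<lambda>X. (X, ind X)) ` {X. X \<subseteq> {..<t} \<and> card X = 4})"
    by (rule card_mono[rotated]) simp
  also have "\<dots> \<le> card {X. X \<subseteq> {..<t} \<and> card X = 4}" by (rule card_image_le) simp
  also have "\<dots> = t choose 4" using n_subsets[of "{..<t}" 4] by simp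
  finally have s: "card (solids ({..<t}, E)) \<le> t choose 4" .
  have "card E = t choose 2" using n_subsets[of "{..<t}" 2] by (simp add: E_def)
  then show ?thesis using c s unfolding cg beth3_def by simp
qed

text \<open>By Pascal's rule the sum telescopes to C(m,4) - C(m,0).\<close>

lemma alternating_binomial:
  "int (Suc m choose 4) - int (Suc m choose 3) + int (Suc m choose 2) - int (Suc m choose 1) = int (m choose 4) - 1"
  by (simp add: numeral_eq_Suc)

theorem corollary4p3p1:
  fixes G :: "'a ugraph"
  assumes "finite_simple_graph G"
    and "connected_graph G"
  shows "beth3 (complete_graph (chromatic_number G)) \<le> beth3 G \<and>
    int (chromatic_number G choose 4) - int (chromatic_number G choose 3)
      + int (chromatic_number G choose 2) - int (chromatic_number G choose 1) \<le> beth3 G"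
proof -
  obtain W E where G: "G = (W, E)" by (cases G)
  have fs: "finite W" "\<And>e. e \<in> E \<Longrightarrow> e \<subseteq> W \<and> card e = 2"
    using assms(1) unfolding G finite_simple_graph_def by auto
  interpret simple_edges E by unfold_locales (use fs in blast)
  let ?t = "chromatic_number G"
  have beth: "euler W \<le> beth3 G" unfolding G using fs by (intro euler_le_beth3) auto
  have col: "proper_coloring G k c \<longleftrightarrow> (\<forall>v\<in>W. c v < k) \<and> (\<forall>u\<in>W. \<forall>v\<in>W. adj u v \<longrightarrow> c u \<noteq> c v)" for k c
    unfolding proper_coloring_def G adj_def by simp
  have "int (?t choose 4) - int (?t choose 3) + int (?t choose 2) - int (?t choose 1) \<le> beth3 G"
  proof (cases "W = {}")
    \<comment> \<open>The graph without vertices also satisfies \<open>connected_graph\<close>. Its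
      chromatic number is 0, so \<open>alternating_binomial\<close> does not apply, but the
      alternating sum is simply 0.\<close>
    case True
    have "\<exists>c. proper_coloring G 0 c" unfolding col True by simp
    then have "?t = 0" unfolding chromatic_number_def by (rule Least_eq_0)
    moreover have none: "{X. X \<subseteq> {} \<and> cyc X} = {}" using cyc_nonempty by blast
    have "0 \<le> euler W" unfolding euler_def True none by simp
    ultimately show ?thesis using beth by (simp add: numeral_eq_Suc)
  next
    case False
    obtain k c where k: "1 \<le> k" "proper_coloring G k c" "int (k - 1 choose 4) \<le> euler W + 1"
      using euler_bound[OF fs(1) False connected_graph_conn[OF assms(2)[unfolded G]]] unfolding col by blast
    \<comment> \<open>The greedy colouring may exceed the chromatic number; monotonicity of the
      binomial coefficient transfers the bound.\<close>
    have "?t \<le> k" unfolding chromatic_number_def by (rule Least_le) (use k(2) in blast)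
    then have "(?t - 1 choose 4) \<le> (k - 1 choose 4)" by (intro binomial_right_mono) simp
    moreover have "\<exists>c. proper_coloring G ?t c"
      unfolding chromatic_number_def by (rule LeastI_ex) (use k(2) in blast)
    then have "?t \<noteq> 0" using False unfolding col by auto
    then obtain m where "?t = Suc m" by (cases ?t) auto
    ultimately show ?thesis using alternating_binomial[of m] k(3) beth by simp
  qed
  then show ?thesis using beth3_complete_graph[of ?t] by linarith
qed

end
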